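(* Let $t_1,t_2,t_3,t_4$ be four triangles in $\mathbb{R}^3$ in (algebraic) general position. Then they admit at most $162$ distinct common tangent lines in $\mathbb{R}^3$. If moreover the four triangles are (pairwise) disjoint, then this number is at most $156$.
   Context: A triangle in $\mathbb{R}^3$ is the convex hull of three distinct non-collinear points of $\mathbb{R}^3$; its three edges are the (closed) segments joining pairs of these points. A line in $\mathbb{R}^3$ is tangent to a triangle if it meets an edge of the triangle; a common tangent line of four triangles is a line tangent to each of them. The supporting line of an edge is the line containing it, regarded also as a line in $\mathbb{C}\mathbb{P}^3$. A transversal in $\mathbb{C}\mathbb{P}^3$ to four lines is a line of $\mathbb{C}\mathbb{P}^3$ meeting all four. Choosing one edge from each of four triangles gives $3^4=81$ quadruples of supporting lines. Four triangles are in (algebraic) general position if each of the 81 quadruples of supporting lines has exactly two transversals in $\mathbb{C}\mathbb{P}^3$, and all $162$ transversals so obtained are distinct. *)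

theory Defs
  imports "HOL-Analysis.Analysis"
begin

definition is_triangle :: "(real^3) set \<Rightarrow> bool" where
  "is_triangle T \<longleftrightarrow> (\<exists>a b c. \<not> collinear {a, b, c} \<and> T = convex hull {a, b, c})"

text \<open>A triangle is a point set that determines its three vertices, so its edges can be read off
  from any presentation as a hull of non-collinear points (see \<open>triangle_edges_convex_hull\<close>).\<close>

definition triangle_edges :: "(real^3) set \<Rightarrow> (real^3) set set" where
  "triangle_edges T =
     {closed_segment a b |a b. \<exists>c. \<not> collinear {a, b, c} \<and> T = convex hull {a, b, c}}"

definition is_line :: "(real^3) set \<Rightarrow> bool" where
  "is_line l \<longleftrightarrow> affine l \<and> aff_dim l = 1"

definition tangent_to_triangle :: "(real^3) set \<Rightarrow> (real^3) set \<Rightarrow> bool" where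
  "tangent_to_triangle l T \<longleftrightarrow> (\<exists>E\<in>triangle_edges T. l \<inter> E \<noteq> {})"

definition common_tangent_lines :: "(4 \<Rightarrow> (real^3) set) \<Rightarrow> (real^3) set set" where
  "common_tangent_lines t = {l. is_line l \<and> (\<forall>i. tangent_to_triangle l (t i))}"

text \<open>Points and lines of \<open>\<complex>\<P>\<^sup>3\<close> are the complex subspaces of \<open>\<complex>\<^sup>4\<close> of complex dimension 1 and 2;
  incidence is inclusion.\<close>

definition is_CP3_point :: "(complex^4) set \<Rightarrow> bool" where
  "is_CP3_point P \<longleftrightarrow> vec.subspace P \<and> vec.dim P = 1"

definition is_CP3_line :: "(complex^4) set \<Rightarrow> bool" where
  "is_CP3_line L \<longleftrightarrow> vec.subspace L \<and> vec.dim L = 2"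

definition CP3_lines_meet :: "(complex^4) set \<Rightarrow> (complex^4) set \<Rightarrow> bool" where
  "CP3_lines_meet L M \<longleftrightarrow> (\<exists>P. is_CP3_point P \<and> P \<subseteq> L \<and> P \<subseteq> M)"

text \<open>The homogeneous coordinate vector \<open>(p\<^sub>1, p\<^sub>2, p\<^sub>3, 1)\<close>; in the index type the fourth index is
  \<open>4 = 0\<close>.\<close>

definition homogenize :: "real^3 \<Rightarrow> complex^4" where
  "homogenize p = (\<chi> i. if i = 1 then of_real (p$1) else if i = 2 then of_real (p$2)
                        else if i = 3 then of_real (p$3) else 1)"

definition supporting_line :: "(real^3) set \<Rightarrow> (real^3) set" where
  "supporting_line E = affine hull E"

definition CP3_line_of :: "(real^3) set \<Rightarrow> (complex^4) set" where
  "CP3_line_of l = vec.span (homogenize ` l)"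

definition CP3_transversals :: "(4 \<Rightarrow> (complex^4) set) \<Rightarrow> (complex^4) set set" where
  "CP3_transversals m = {L. is_CP3_line L \<and> (\<forall>i. CP3_lines_meet L (m i))}"

definition edge_quadruples :: "(4 \<Rightarrow> (real^3) set) \<Rightarrow> (4 \<Rightarrow> (real^3) set) set" where
  "edge_quadruples t = {e. \<forall>i. e i \<in> triangle_edges (t i)}"

definition edge_transversals :: "(4 \<Rightarrow> (real^3) set) \<Rightarrow> (complex^4) set set" where
  "edge_transversals e = CP3_transversals (\<lambda>i. CP3_line_of (supporting_line (e i)))"

definition algebraic_general_position :: "(4 \<Rightarrow> (real^3) set) \<Rightarrow> bool" where
  "algebraic_general_position t \<longleftrightarrow>
     (\<forall>e\<in>edge_quadruples t. card (edge_transversals e) = 2) \<and>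
     disjoint_family_on edge_transversals (edge_quadruples t)"

lemma triangle_edges_convex_hull:
  fixes a b c :: "real^3"
  assumes nc: "\<not> collinear {a, b, c}"
  shows "triangle_edges (convex hull {a, b, c}) =
           {closed_segment a b, closed_segment b c, closed_segment c a}"
proof -
  have ext: "x \<in> {p, q, r} \<longleftrightarrow> x extreme_point_of (convex hull {p, q, r})"
    if "\<not> collinear {p, q, r}" for p q r x :: "real^3"
    using that extreme_point_of_convex_hull_affine_independent[of "{p, q, r}" x]
    by (auto simp: collinear_3_eq_affine_dependent)
  have eq: "{p, q, r} = {a, b, c}"
    if "\<not> collinear {p, q, r}" "convex hull {a, b, c} = convex hull {p, q, r}" for p q r
    by (rule set_eqI) (simp only: ext[OF that(1)] ext[OF nc] that(2))
  have dist: "p \<noteq> q" if "\<not> collinear {p, q, r}" for p q r :: "real^3"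
    using that by (auto simp: collinear_2)
  show ?thesis (is "?L = ?R")
  proof
    show "?L \<subseteq> ?R"
    proof
      fix s assume "s \<in> ?L"
      then obtain p q r where s: "s = closed_segment p q" and ncp: "\<not> collinear {p, q, r}"
        and h: "convex hull {a, b, c} = convex hull {p, q, r}"
        unfolding triangle_edges_def by blast
      have "p \<in> {a, b, c}" "q \<in> {a, b, c}" "p \<noteq> q"
        using eq[OF ncp h] dist[OF ncp] by auto
      then show "s \<in> ?R" using s closed_segment_commute[of p q] by blast
    qed
    have perm: "{b, c, a} = {a, b, c}" "{c, a, b} = {a, b, c}" by auto
    have "closed_segment p q \<in> ?L" if "{p, q, r} = {a, b, c}" for p q r
      unfolding triangle_edges_def mem_Collect_eq
      by (intro exI[of _ p] exI[of _ q] conjI exI[of _ r]) (simp_all only: nc that not_False_eq_True)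
    then show "?R \<subseteq> ?L" using perm by (intro insert_subsetI empty_subsetI) blast+
  qed
qed

end

theory Submission
  imports Defs
begin

text \<open>A tangent line meets an edge of each triangle, hence is a transversal of one of the 81 quadruples
  of supporting lines; each quadruple has two of them, which gives 162. Since no transversal belongs to
  two quadruples, a tangent line never passes through a vertex.

  For disjoint triangles it suffices to lose two lines for each of three choices of edges. If two
  supporting lines of one triangle meet another one, then by Menelaus no supporting line of the latter
  meets the former; counting such incidences yields a supporting line \<open>c\<close> of one triangle that misses
  two others. Fix \<open>c\<close> and an edge line \<open>b\<close> of the fourth triangle, and parametrize the planes through
  \<open>c\<close> by \<open>x\<close>. The lines meeting \<open>c\<close>, \<open>b\<close> and an edge of each of the two missed triangles are roots of
  a quadratic in \<open>x\<close> that lie in the intersection of two arcs of the pencil. Either one of the nine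
  intersections is empty, or the arcs interleave in an essentially unique way. In the latter case, if
  more than 16 roots were in place, then by parity all nine quadratics would have both of their roots in
  their arcs, which contradicts the signs of the quadratics at a common vertex.\<close>

section \<open>Complex projective lines\<close>

text \<open>A line \<open>c\<close> missing a triangle confines the planes of the pencil that meet
  the triangle to a proper arc; in the nondegenerate case one edge covers the whole arc, and the
  other two cover the parts on either side of the middle vertex. Such a \<open>c\<close> exists for
  two triangles at once: otherwise each of the twelve supporting lines would meet two other
  triangles, giving 24 incidences, while each of the six pairs of triangles admits at most 3. In a
  plane of the pencil each edge line gives one point, and coplanarity of two such points with
  \<open>b\<close> is a bilinear interpolation of values at the vertices, hence quadratic in the
  parameter. The obstacle is that the two arcs may cover the pencil together. A chart then keeps
  only one triangle away from its plane at infinity, and the other one crosses it; the interleaved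
  order is of this kind. There every value at a vertex belongs to two edges, so the product of the
  values at all ends of arcs is a square, and a single sign change among the nine quadratics is
  impossible. The bound 156 is 162 - 3 * 2.\<close>

lemma homogenize_nth [simp]:
  "homogenize p $ 1 = of_real (p$1)" "homogenize p $ 2 = of_real (p$2)"
  "homogenize p $ 3 = of_real (p$3)" "homogenize p $ 4 = 1"
  by (simp_all add: homogenize_def)

lemma homogenize_affine:
  assumes "u + w = 1"
  shows "homogenize (u *\<^sub>R p + w *\<^sub>R q) =
    of_real u *s homogenize p + of_real w *s homogenize q"
  using assms by (simp add: vec_eq_iff forall_4) (simp flip: of_real_add)

lemma inj_homogenize: "homogenize p = homogenize q \<longleftrightarrow> p = q"
  by (auto simp: vec_eq_iff forall_3 forall_4)

lemma homogenize_nonzero [simp]: "homogenize p \<noteq> 0"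
  using homogenize_nth(4)[of p] by (metis one_neq_zero zero_index)

lemma homogenize_multiple:
  assumes "homogenize p = c *s homogenize q"
  shows "p = q"
proof -
  have "homogenize p $ 4 = c * homogenize q $ 4"
    by (subst assms) simp
  then have "c = 1" by simp
  with assms show ?thesis by (simp add: inj_homogenize)
qed

lemma CP3_line_of_affine_hull:
  "CP3_line_of (affine hull {p, q}) = vec.span {homogenize p, homogenize q}"
proof -
  have "vec.span (homogenize ` (affine hull {p, q})) \<subseteq> vec.span {homogenize p, homogenize q}"
  proof (rule vec.span_minimal)
    show "homogenize ` (affine hull {p, q}) \<subseteq> vec.span {homogenize p, homogenize q}"
      by (auto simp: affine_hull_2 homogenize_affine simp del: vec.span_insert_0
          intro!: vec.span_add vec.span_scale intro: vec.span_base)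
  qed simp
  moreover have "{homogenize p, homogenize q} \<subseteq> homogenize ` (affine hull {p, q})"
    by (auto simp: hull_inc)
  ultimately show ?thesis
    unfolding CP3_line_of_def by (meson subset_antisym vec.span_mono)
qed

lemma independent_homogenize:
  assumes "p \<noteq> q"
  shows "vec.independent {homogenize p, homogenize q}"
  using assms homogenize_multiple[of p _ q]
  by (auto simp: vec.independent_insert vec.span_singleton inj_homogenize)

lemma CP3_line_span_homogenize:
  assumes "p \<noteq> q"
  shows "is_CP3_line (vec.span {homogenize p, homogenize q})"
  using independent_homogenize[OF assms] assms
  by (simp add: is_CP3_line_def vec.dim_eq_card_independent inj_homogenize)

lemma CP3_lines_meetI:
  assumes "is_CP3_line L" "is_CP3_line M" "x \<in> L" "x \<in> M" "x \<noteq> 0"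
  shows "CP3_lines_meet L M"
  unfolding CP3_lines_meet_def
proof (intro exI conjI)
  show "is_CP3_point (vec.span {x})"
    using assms(5) by (simp add: is_CP3_point_def vec.dim_singleton)
  show "vec.span {x} \<subseteq> L" "vec.span {x} \<subseteq> M"
    using assms by (simp_all add: is_CP3_line_def vec.span_minimal)
qed

text \<open>Grassmann's formula for the dimensions of sum and intersection.\<close>

lemma exists_common_nonzero:
  fixes L M :: "(complex^4) set"
  assumes "vec.subspace L" "vec.subspace M" "vec.dim (L \<union> M) < vec.dim L + vec.dim M"
  obtains x where "x \<in> L" "x \<in> M" "x \<noteq> 0"
proof -
  have "{x + y |x y. x \<in> L \<and> y \<in> M} \<subseteq> vec.span (L \<union> M)"
    by (auto intro!: vec.span_add intro: vec.span_base)
  from vec.dim_subset[OF this] have "vec.dim {x + y |x y. x \<in> L \<and> y \<in> M} \<le> vec.dim (L \<union> M)"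
    by (simp only: vec.dim_span)
  with vec.dim_sums_Int[OF assms(1,2)] assms(3) have "vec.dim (L \<inter> M) \<noteq> 0"
    by linarith
  then have "\<not> L \<inter> M \<subseteq> {0}"
    using vec.dim_eq_0[of "L \<inter> M"] by simp
  then show thesis using that by blast
qed

text \<open>Two lines in a common projective plane meet. Linear dimension 3 stands for a plane
  throughout.\<close>

lemma CP3_lines_meet_if_dim_le_3:
  assumes "is_CP3_line L" "is_CP3_line M" "vec.dim (L \<union> M) \<le> 3"
  shows "CP3_lines_meet L M"
proof -
  obtain x where "x \<in> L" "x \<in> M" "x \<noteq> 0"
    using exists_common_nonzero[of L M] assms unfolding is_CP3_line_def by auto
  then show ?thesis using CP3_lines_meetI assms by blast
qed

lemma CP3_line_through:
  assumes "y \<noteq> 0" "h \<notin> vec.span {y}"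
  shows "is_CP3_line (vec.span {y, h})"
proof -
  have "vec.independent {h, y}" "h \<noteq> y"
    using assms by (auto simp: vec.independent_insert vec.span_base)
  then show ?thesis
    by (simp add: is_CP3_line_def vec.dim_eq_card_independent insert_commute)
qed

lemma CP3_line_through_meets:
  assumes "y \<noteq> 0" "h \<notin> vec.span {y}" "is_CP3_line M" "vec.dim (M \<union> {y, h}) \<le> 3"
  shows "CP3_lines_meet (vec.span {y, h}) M"
proof (rule CP3_lines_meet_if_dim_le_3)
  have "vec.span {y, h} \<union> M \<subseteq> vec.span (M \<union> {y, h})"
    using vec.span_mono[of "{y, h}" "M \<union> {y, h}"] vec.span_superset[of "M \<union> {y, h}"] by auto
  from vec.dim_subset[OF this] show "vec.dim (vec.span {y, h} \<union> M) \<le> 3"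
    using assms(4) by (simp only: vec.dim_span)
qed (use assms CP3_line_through in auto)

lemma dim_insert_le:
  fixes S :: "(complex^4) set"
  shows "vec.dim (insert x S) \<le> Suc (vec.dim S)"
  by (simp add: vec.dim_insert)

text \<open>The plane spanned by \<open>y\<close> and \<open>L\<close> cuts \<open>M\<close> in a
  point \<open>h\<close>, and the line joining \<open>y\<close> to \<open>h\<close> meets both.
  Incidence is delivered as coplanarity, the form consumed by
  \<open>CP3_line_through_meets\<close>.\<close>

lemma ex_meeting_point:
  assumes y: "y \<notin> M" and L: "is_CP3_line L" and M: "is_CP3_line M"
  obtains h where "h \<notin> vec.span {y}" "vec.dim (L \<union> {y, h}) \<le> 3" "vec.dim (M \<union> {y, h}) \<le> 3"
proof -
  have sub: "vec.subspace L" "vec.subspace M" "vec.dim L = 2" "vec.dim M = 2"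
    using L M by (auto simp: is_CP3_line_def)
  have in_span: "h \<notin> vec.span {y}" if "h \<in> M" "h \<noteq> 0" for h
  proof
    assume "h \<in> vec.span {y}"
    then obtain c where c: "h = c *s y" by (auto simp: vec.span_singleton)
    with that have "y = inverse c *s h" by auto
    with y vec.subspace_scale[OF sub(2) that(1)] show False by metis
  qed
  have M3: "vec.dim (M \<union> {y, h}) \<le> 3" if "h \<in> M" for h
    using dim_insert_le[of y M] that sub by (simp add: insert_absorb)
  obtain h where h: "h \<in> M" "h \<noteq> 0" "vec.dim (L \<union> {y, h}) \<le> 3"
  proof (cases "y \<in> L")
    \<comment> \<open>A line through \<open>y\<close> meets \<open>L\<close> already in
      \<open>y\<close>, so any point of \<open>M\<close> serves.\<close>
    case True
    have "\<not> M \<subseteq> {0}"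
      using sub(4) vec.dim_eq_0[of M] by auto
    then obtain h where "h \<in> M" "h \<noteq> 0" by blast
    then show ?thesis
      using that[of h] dim_insert_le[of h L] True sub by (simp add: insert_absorb insert_commute)
  next
    case False
    let ?U = "vec.span (insert y L)"
    have U: "vec.dim ?U = 3"
      using False sub by (simp add: vec.dim_insert vec.span_eq_iff[THEN iffD2])
    have "vec.dim (?U \<union> M) \<le> 4"
      using vec.dim_subset[of "?U \<union> M" UNIV] by (simp add: card_cart_basis)
    then have "vec.dim (?U \<union> M) < vec.dim ?U + vec.dim M"
      using U sub by linarith
    then obtain h where "h \<in> ?U" "h \<in> M" "h \<noteq> 0"
      using exists_common_nonzero[OF vec.subspace_span sub(2)] by blast
    moreover have "L \<union> {y, h} \<subseteq> ?U"
      using \<open>h \<in> ?U\<close> by (auto intro: vec.span_base)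
    ultimately show ?thesis
      using that[of h] U vec.dim_subset[of "L \<union> {y, h}" ?U] by metis
  qed
  then show thesis using that in_span M3 by blast
qed


section \<open>Complex points of real planes\<close>

definition real_plane :: "real^3 \<Rightarrow> real \<Rightarrow> (complex^4) set" where
  "real_plane a c = {X. of_real (a$1) * X$1 + of_real (a$2) * X$2 + of_real (a$3) * X$3
     = of_real c * X$4}"

lemma subspace_real_plane: "vec.subspace (real_plane a c)"
  unfolding vec.subspace_def real_plane_def by auto algebra+

lemma homogenize_in_real_plane: "homogenize p \<in> real_plane a c \<longleftrightarrow> a \<bullet> p = c"
  by (simp add: real_plane_def inner_vec_def sum_3 flip: of_real_mult of_real_add)

lemma dim_subset_real_plane:
  assumes "a \<noteq> 0" "S \<subseteq> real_plane a c"
  shows "vec.dim S \<le> 3"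
proof -
  have "a = 0" if "\<And>x. x \<in> real_plane a c"
    using that[of "axis 1 1"] that[of "axis 2 1"] that[of "axis 3 1"]
    by (simp add: real_plane_def axis_def vec_eq_iff forall_3)
  then have "real_plane a c \<subset> UNIV" using assms(1) by auto
  then have "vec.dim (real_plane a c) < vec.dim (UNIV :: (complex^4) set)"
    by (intro vec.dim_psubset) (simp add: subspace_real_plane vec.span_eq_iff[THEN iffD2])
  with vec.dim_subset[OF assms(2)] show ?thesis by (simp add: card_cart_basis)
qed

section \<open>Lines and triangles\<close>

text \<open>Vanishes iff the points \<open>p\<close> and \<open>q\<close> are coplanar with the line through \<open>z\<close> in direction \<open>m\<close>.\<close>

definition line_vol :: "real^3 \<Rightarrow> real^3 \<Rightarrow> real^3 \<Rightarrow> real^3 \<Rightarrow> real" where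
  "line_vol z m p q = m \<bullet> cross3 (p - z) (q - z)"

lemma line_vol_eq_inner: "line_vol z m p q = cross3 m (p - z) \<bullet> (q - z)"
  by (simp add: line_vol_def inner_vec_def sum_3 cross3_simps)

text \<open>Edges carry the number of the opposite vertex; addition in type \<open>3\<close> is
  cyclic, so \<open>k + 1\<close> and \<open>k + 2\<close> are the two other vertices.\<close>

definition tri_edge :: "(3 \<Rightarrow> real^3) \<Rightarrow> 3 \<Rightarrow> (real^3) set" where
  "tri_edge v k = closed_segment (v (k + 1)) (v (k + 2))"

lemma index_add_3 [simp]: "(k::3) + 1 + 2 = k" "(k::3) + 2 + 1 = k" "(k::3) + 1 + 1 = k + 2"
    "(k::3) + 2 + 2 = k + 1" "(k::3) + 1 \<noteq> k" "(k::3) + 2 \<noteq> k" "k \<noteq> (k::3) + 1" "k \<noteq> (k::3) + 2"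
    "(k::3) + 1 \<noteq> k + 2" "(k::3) + 2 \<noteq> k + 1"
  using exhaust_3[of k] by (elim disjE; simp)+

lemma UNIV_3_shift: "(UNIV :: 3 set) = {k, k + 1, k + 2}"
proof -
  have "x \<in> {k, k + 1, k + 2}" for x
    using exhaust_3[of k] exhaust_3[of x] by (elim disjE) simp_all
  then show ?thesis by blast
qed

lemma inj_if_not_collinear:
  fixes v :: "3 \<Rightarrow> real^3"
  assumes "\<not> collinear (range v)"
  shows "inj v"
proof (rule injI)
  fix x y assume eq: "v x = v y"
  show "x = y"
  proof (rule ccontr)
    assume "x \<noteq> y"
    then have "y = x + 1 \<or> y = x + 2"
      using UNIV_I[of y] unfolding UNIV_3_shift[of x] by auto
    moreover have "range v = {v x, v (x + 1), v (x + 2)}"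
      by (subst UNIV_3_shift[of x]) simp
    ultimately have "range v = {v x, v (x + 1)} \<or> range v = {v x, v (x + 2)}"
      using eq by auto
    with assms show False by (auto simp: collinear_2)
  qed
qed

lemma inj_tri_edge:
  assumes "inj v"
  shows "inj (tri_edge v)"
proof (rule injI)
  fix k l assume "tri_edge v k = tri_edge v l"
  then have "{v (k + 1), v (k + 2)} = {v (l + 1), v (l + 2)}"
    by (simp add: tri_edge_def closed_segment_eq)
  moreover have "- {i} = {i + 1, i + 2}" for i :: 3
    using UNIV_3_shift[of i] by auto
  ultimately have "v ` (- {k}) = v ` (- {l})" by simp
  with assms show "k = l"
    by (simp add: inj_image_eq_iff)
qed

definition edge_line :: "(3 \<Rightarrow> real^3) \<Rightarrow> 3 \<Rightarrow> (complex^4) set" where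
  "edge_line v k = vec.span {homogenize (v (k + 1)), homogenize (v (k + 2))}"

lemma CP3_line_of_tri_edge: "CP3_line_of (supporting_line (tri_edge v k)) = edge_line v k"
  by (simp add: supporting_line_def tri_edge_def edge_line_def CP3_line_of_affine_hull
      affine_hull_closed_segment)

lemma CP3_line_edge_line:
  assumes "inj v"
  shows "is_CP3_line (edge_line v k)"
  unfolding edge_line_def
  by (rule CP3_line_span_homogenize) (simp add: inj_eq[OF assms])

lemma vertex_in_edge_line:
  "homogenize (v k) \<in> edge_line v (k + 1)" "homogenize (v k) \<in> edge_line v (k + 2)"
  by (auto simp: edge_line_def intro: vec.span_base)

text \<open>For fixed \<open>p\<close> the volume is affine in its last argument, so its homogeneous
  extension vanishes at \<alpha> \<open>w\<close> + \<beta> \<open>w'\<close> iff this point is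
  coplanar with the edge line and \<open>p\<close>. Homogeneous weights also cover the point at
  infinity, where \<alpha> + \<beta> = 0.\<close>

lemma dim_edge_line_le_3:
  assumes "inj v"
    and "\<alpha> * line_vol (v (k + 1)) (v (k + 2) - v (k + 1)) p w
       + \<beta> * line_vol (v (k + 1)) (v (k + 2) - v (k + 1)) p w' = 0"
  shows "vec.dim (edge_line v k \<union>
     {homogenize p, of_real \<alpha> *s homogenize w + of_real \<beta> *s homogenize w'}) \<le> 3"
    (is "vec.dim (_ \<union> {_, ?h}) \<le> 3")
proof -
  let ?z = "v (k + 1)" and ?m = "v (k + 2) - v (k + 1)"
  define a where "a = cross3 ?m (p - ?z)"
  show ?thesis
  proof (cases "a = 0")
    \<comment> \<open>Now \<open>p\<close> lies on the edge line itself, so only one further vector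
      is added to a space of dimension 2.\<close>
    case True
    have "?m \<noteq> 0" using assms(1) by (simp add: inj_eq)
    with True have "\<exists>c. p - ?z = c *\<^sub>R ?m"
      unfolding a_def cross_eq_0 by (auto simp: collinear_lemma intro: exI[of _ 0])
    then obtain c where "p - ?z = c *\<^sub>R ?m" ..
    then have "p = (1 - c) *\<^sub>R ?z + c *\<^sub>R v (k + 2)" by (simp add: algebra_simps)
    then have "homogenize p \<in> edge_line v k"
      by (auto simp: homogenize_affine edge_line_def
          intro!: vec.span_add vec.span_diff vec.span_scale intro: vec.span_base)
    then show ?thesis
      using dim_insert_le[of ?h "edge_line v k"] CP3_line_edge_line[OF assms(1), of k]
      by (simp add: insert_absorb insert_commute is_CP3_line_def)
  next
    case False
    \<comment> \<open>The vector \<open>a\<close> is a normal of the plane through the edge line and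
      \<open>p\<close>.\<close>
    have sub: "edge_line v k \<subseteq> real_plane a (a \<bullet> ?z)"
      unfolding edge_line_def
    proof (rule vec.span_minimal[OF _ subspace_real_plane])
      have "a \<bullet> ?m = 0" by (simp add: a_def dot_cross_self)
      then show "{homogenize ?z, homogenize (v (k + 2))} \<subseteq> real_plane a (a \<bullet> ?z)"
        by (simp add: homogenize_in_real_plane inner_diff_right)
    qed
    have "a \<bullet> (p - ?z) = 0" by (simp add: a_def dot_cross_self)
    then have p: "homogenize p \<in> real_plane a (a \<bullet> ?z)"
      by (simp add: homogenize_in_real_plane inner_diff_right)
    have "\<alpha> * (a \<bullet> (w - ?z)) + \<beta> * (a \<bullet> (w' - ?z)) = 0"
      using assms(2) by (simp add: line_vol_eq_inner a_def)
    then have "complex_of_real (\<alpha> * (a \<bullet> (w - ?z)) + \<beta> * (a \<bullet> (w' - ?z))) = 0" by simp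
    then have "?h \<in> real_plane a (a \<bullet> ?z)"
      by (simp add: real_plane_def inner_vec_def sum_3 algebra_simps)
    with sub p dim_subset_real_plane[OF False] show ?thesis by simp
  qed
qed

lemma homogenize_comb_nonzero:
  assumes "p \<noteq> q" "\<alpha> \<noteq> 0 \<or> \<beta> \<noteq> 0"
  shows "of_real \<alpha> *s homogenize p + of_real \<beta> *s homogenize q \<noteq> (0 :: complex^4)"
proof
  assume *: "of_real \<alpha> *s homogenize p + of_real \<beta> *s homogenize q = (0 :: complex^4)"
  have 4: "\<alpha> + \<beta> = 0"
    using arg_cong[OF *, of "\<lambda>x. x $ 4"] by (simp flip: of_real_add)
  then have "\<beta> = - \<alpha>" "\<alpha> \<noteq> 0" using assms(2) by auto
  with * have "homogenize p = homogenize q"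
    by (simp add: vec_eq_iff)
  with assms show False by (simp add: inj_homogenize)
qed

section \<open>Roots of quadratics\<close>

text \<open>Degree at most 2: the leading coefficient may vanish.\<close>

definition quadratic :: "(real \<Rightarrow> real) \<Rightarrow> bool" where
  "quadratic P \<longleftrightarrow> (\<exists>a b c. \<forall>x. P x = a * x\<^sup>2 + b * x + c)"

text \<open>Roots are counted with multiplicity, so \<open>r = s\<close> is allowed: the second root
  obtained from a sign argument may coincide with the first.\<close>

definition two_roots_in :: "real set \<Rightarrow> (real \<Rightarrow> real) \<Rightarrow> bool" where
  "two_roots_in W P \<longleftrightarrow>
     (\<exists>k r s. k \<noteq> 0 \<and> r \<in> W \<and> s \<in> W \<and> (\<forall>x. P x = k * (x - r) * (x - s)))"

lemma quadratic_factor: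
  assumes "quadratic P" "P r = 0"
  obtains a b where "\<And>x. P x = (x - r) * (a * x + b)"
proof -
  obtain a b c where P: "\<And>x. P x = a * x\<^sup>2 + b * x + c"
    using assms(1) unfolding quadratic_def by blast
  have c: "c = - a * r\<^sup>2 - b * r" using assms(2) P[of r] by simp
  have "P x = (x - r) * (a * x + (a * r + b))" for x
    unfolding P c by (simp add: algebra_simps power2_eq_square)
  then show thesis by (rule that)
qed

text \<open>The point \<open>e\<close> with \<open>P e \<noteq> 0\<close> excludes the zero
  polynomial.\<close>

lemma two_roots_in_if_two:
  assumes "quadratic P" "P e \<noteq> 0" "N \<subseteq> W \<inter> {x. P x = 0}" "card N = 2"
  shows "two_roots_in W P"
proof -
  obtain r s where rs: "N = {r, s}" "r \<noteq> s" using assms(4) by (auto simp: card_2_iff)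
  then have roots: "P r = 0" "P s = 0" "r \<in> W" "s \<in> W" using assms(3) by auto
  obtain a b where P: "\<And>x. P x = (x - r) * (a * x + b)"
    using quadratic_factor[OF assms(1) roots(1)] by blast
  have "b = - a * s" using roots(2) P[of s] rs(2) by simp
  then have "P x = a * (x - r) * (x - s)" for x by (simp add: P algebra_simps)
  moreover have "a \<noteq> 0" using calculation assms(2) by auto
  ultimately show ?thesis using roots unfolding two_roots_in_def by blast
qed

lemma two_roots_in_sign_2:
  assumes "two_roots_in {x. (x - a) * (x - b) < 0} P"
  shows "P a * P b > 0"
proof -
  obtain k r s where k: "k \<noteq> 0" and w: "(r - a) * (r - b) < 0" "(s - a) * (s - b) < 0"
    and P: "\<And>x. P x = k * (x - r) * (x - s)"
    using assms unfolding two_roots_in_def by auto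
  have "P a * P b = k\<^sup>2 * (((r - a) * (r - b)) * ((s - a) * (s - b)))"
    by (simp add: P algebra_simps power2_eq_square)
  also have "\<dots> > 0" using k w by (simp add: mult_neg_neg)
  finally show ?thesis .
qed

text \<open>For \<open>a < b < c < d\<close> the set is the union of the intervals from
  \<open>a\<close> to \<open>b\<close> and from \<open>c\<close> to \<open>d\<close>, the shape of
  an intersection of arcs when one of them passes through infinity.\<close>

lemma two_roots_in_sign_4:
  assumes "two_roots_in {x. (x - a) * (x - b) * (x - c) * (x - d) < 0} P"
  shows "P a * P b * P c * P d > 0"
proof -
  obtain k r s where k: "k \<noteq> 0" and w: "(r - a) * (r - b) * (r - c) * (r - d) < 0"
      "(s - a) * (s - b) * (s - c) * (s - d) < 0"
    and P: "\<And>x. P x = k * (x - r) * (x - s)"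
    using assms unfolding two_roots_in_def by auto
  have "P a * P b * P c * P d = k ^ 4 * (((r - a) * (r - b) * (r - c) * (r - d))
      * ((s - a) * (s - b) * (s - c) * (s - d)))"
    unfolding P by algebra
  also have "\<dots> > 0" using k w by (simp add: mult_neg_neg)
  finally show ?thesis .
qed

text \<open>After splitting off the root \<open>r\<close>, the remaining linear factor must change
  sign between \<open>a\<close> and \<open>b\<close>; hence it is not constant and its zero lies
  between them as well.\<close>

lemma two_roots_in_if_sign_2:
  assumes "quadratic P" "P r = 0" "(r - a) * (r - b) < 0" "P a * P b > 0"
  shows "two_roots_in {x. (x - a) * (x - b) < 0} P"
proof -
  obtain k l where P: "\<And>x. P x = (x - r) * (k * x + l)"
    using quadratic_factor[OF assms(1,2)] by blast
  have "P a * P b = ((r - a) * (r - b)) * ((k * a + l) * (k * b + l))"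
    unfolding P by algebra
  with assms(3,4) have neg: "(k * a + l) * (k * b + l) < 0"
    by (metis mult_neg_pos mult_zero_right not_less_iff_gr_or_eq)
  have k: "k \<noteq> 0" using neg by (auto simp: mult_less_0_iff)
  define s where "s = - l / k"
  have l: "l = - k * s" using k by (simp add: s_def)
  have "(k * a + l) * (k * b + l) = k\<^sup>2 * ((s - a) * (s - b))" unfolding l by algebra
  with neg have "(s - a) * (s - b) < 0" by (simp add: mult_less_0_iff)
  moreover have "P x = k * (x - r) * (x - s)" for x unfolding P l by algebra
  ultimately show ?thesis using k assms(3) unfolding two_roots_in_def by blast
qed

lemma two_roots_in_if_sign_4:
  assumes "quadratic P" "P r = 0" "(r - a) * (r - b) * (r - c) * (r - d) < 0"
    "P a * P b * P c * P d > 0"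
  shows "two_roots_in {x. (x - a) * (x - b) * (x - c) * (x - d) < 0} P"
proof -
  obtain k l where P: "\<And>x. P x = (x - r) * (k * x + l)"
    using quadratic_factor[OF assms(1,2)] by blast
  have "P a * P b * P c * P d = ((r - a) * (r - b) * (r - c) * (r - d))
      * ((k * a + l) * (k * b + l) * (k * c + l) * (k * d + l))"
    unfolding P by algebra
  with assms(3,4) have neg: "(k * a + l) * (k * b + l) * (k * c + l) * (k * d + l) < 0"
    by (metis mult_neg_pos mult_zero_right not_less_iff_gr_or_eq)
  have k: "k \<noteq> 0"
  proof
    assume "k = 0"
    then have "(l * l) * (l * l) < 0" using neg by (simp add: mult.assoc)
    then show False by (simp add: mult_less_0_iff)
  qed
  define s where "s = - l / k"
  have l: "l = - k * s" using k by (simp add: s_def)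
  have "(k * a + l) * (k * b + l) * (k * c + l) * (k * d + l) =
      k ^ 4 * ((s - a) * (s - b) * (s - c) * (s - d))" unfolding l by algebra
  with neg have "k ^ 4 * ((s - a) * (s - b) * (s - c) * (s - d)) < 0" by metis
  moreover have "k ^ 4 > 0" using k by simp
  ultimately have "(s - a) * (s - b) * (s - c) * (s - d) < 0"
    by (meson mult_less_0_iff not_less_iff_gr_or_eq)
  moreover have "P x = k * (x - r) * (x - s)" for x unfolding P l by algebra
  ultimately show ?thesis using k assms(3) unfolding two_roots_in_def by blast
qed

text \<open>The sum reaches its maximum only if every \<open>n\<close> is 2.\<close>

lemma list_pos_if_sum_large:
  fixes ps :: "real list" and ns :: "nat list"
  assumes "list_all2 (\<lambda>p n. n \<le> 2 \<and> p \<noteq> 0 \<and> (n = 2 \<longrightarrow> p > 0)) ps ns"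
    and "2 * length ns \<le> sum_list ns"
  shows "\<forall>p\<in>set ps. p > 0"
  using assms
proof (induction rule: list_all2_induct)
  case (Cons p ps n ns)
  have "sum_list ns \<le> 2 * length ns"
    using Cons.hyps(2) by (induction rule: list_all2_induct) auto
  then show ?case using Cons by auto
qed simp

text \<open>A parity argument: the numbers \<open>n\<close> count roots between points where the product of the values
  is \<open>p\<close>, so that \<open>n = 1\<close> would come with \<open>p < 0\<close> unless a root is double.\<close>

lemma list_pos_if_prod_pos:
  fixes ps :: "real list" and ns :: "nat list"
  assumes "list_all2 (\<lambda>p n. n \<le> 2 \<and> p \<noteq> 0 \<and> (n = 2 \<longrightarrow> p > 0)) ps ns"
    and "2 * length ns \<le> sum_list ns + 1" and "prod_list ps > 0"
  shows "\<forall>p\<in>set ps. p > 0"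
  using assms
proof (induction rule: list_all2_induct)
  case (Cons p ps n ns)
  show ?case
  proof (cases "n = 2")
    case True
    then have "p > 0" "prod_list ps > 0" using Cons by (auto simp: zero_less_mult_iff)
    then show ?thesis using Cons True by auto
  next
    \<comment> \<open>The deficit of one is used up here, so all later entries are 2 with
      \<open>p > 0\<close>, and the sign of the total product settles the present
      \<open>p\<close>.\<close>
    case False
    then have "2 * length ns \<le> sum_list ns" using Cons by auto
    then have "\<forall>p\<in>set ps. p > 0" using list_pos_if_sum_large Cons.hyps(2) by blast
    moreover from this have "prod_list ps > 0" by (induction ps) auto
    ultimately show ?thesis using Cons.prems by (auto simp: zero_less_mult_iff)
  qed
qed simp

section \<open>Interpolation\<close>

text \<open>Linear interpolation: for \<open>a \<noteq> b\<close>, the affine function with value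
  \<open>u\<close> at \<open>a\<close> and \<open>w\<close> at \<open>b\<close>.\<close>

definition lerp :: "real \<Rightarrow> real \<Rightarrow> real \<Rightarrow> real \<Rightarrow> real \<Rightarrow> real" where
  "lerp a b u w x = ((x - b) * u - (x - a) * w) / (a - b)"

lemma lerp_commute: "lerp a b u w x = lerp b a w u x"
proof -
  have "lerp a b u w x = (- ((x - b) * u - (x - a) * w)) / (- (a - b))"
    unfolding lerp_def by (simp only: minus_divide_divide)
  then show ?thesis by (simp add: lerp_def)
qed

lemma lerp_at [simp]: "a \<noteq> b \<Longrightarrow> lerp a b u w a = u" "a \<noteq> b \<Longrightarrow> lerp a b u w b = w"
  by (simp_all add: lerp_def field_simps)

lemma lerp_uminus: "lerp (- a) (- b) u w (- x) = lerp a b u w x"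
proof -
  have "lerp (- a) (- b) u w (- x) = (- ((x - b) * u - (x - a) * w)) / (- (a - b))"
    unfolding lerp_def by (simp add: algebra_simps)
  then show ?thesis by (simp only: lerp_def minus_divide_divide)
qed

text \<open>Bilinear interpolation may be carried out in either order, so a quadratic can be read
  along the edges of either triangle.\<close>

lemma lerp_lerp: "lerp a b (lerp c d p q x) (lerp c d r s x) x = lerp c d (lerp a b p r x) (lerp a b q s x) x"
  unfolding lerp_def divide_inverse by algebra

text \<open>Without denominators this expands a determinant with the repeated row
  \<open>x - t1\<close>, \<open>x - t2\<close>, \<open>x - t3\<close> and the row \<open>q1\<close>,
  \<open>q2\<close>, \<open>q3\<close>. Geometrically, a plane of the pencil cuts the three edge
  lines of a triangle in collinear points.\<close>

lemma lerp_collinear: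
  assumes "t1 \<noteq> t2" "t2 \<noteq> t3" "t1 \<noteq> t3"
  shows "(x - t1) * (t3 - t2) * lerp t2 t3 q2 q3 x =
    (x - t2) * (t3 - t1) * lerp t1 t3 q1 q3 x + (t3 - x) * (t2 - t1) * lerp t1 t2 q1 q2 x"
proof -
  have e: "(t3 - t2) * lerp t2 t3 q2 q3 x = (x - t2) * q3 - (x - t3) * q2"
    "(t3 - t1) * lerp t1 t3 q1 q3 x = (x - t1) * q3 - (x - t3) * q1"
    "(t2 - t1) * lerp t1 t2 q1 q2 x = (x - t1) * q2 - (x - t2) * q1"
    using assms by (simp_all add: lerp_def field_simps)
  show ?thesis unfolding mult.assoc e by algebra
qed

lemma quadratic_lerp_lerp: "quadratic (\<lambda>x. lerp a b (lerp c d p q x) (lerp c d r s x) x)"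
proof -
  let ?k = "1 / ((a - b) * (c - d))"
  have "lerp a b (lerp c d p q x) (lerp c d r s x) x =
     ?k * (p - q - r + s) * x\<^sup>2 + ?k * (- d * p + c * q - b * p + b * q + d * r - c * s + a * r - a * s) * x
     + ?k * (b * d * p - b * c * q - a * d * r + a * c * s)" for x
    unfolding lerp_def divide_inverse inverse_mult_distrib by algebra
  then show ?thesis unfolding quadratic_def by blast
qed

text \<open>By \<open>rel\<close>, \<open>a\<close> agrees with \<open>b\<close> at
  \<open>t1\<close> and with \<open>c\<close> at \<open>t3\<close>. These points lie outside the
  respective roots, so the three leading coefficients have one sign. It follows that
  \<open>a\<close> has one root in each interval, and \<open>h2\<close> separates the roots of
  \<open>a\<close> but not those of \<open>b\<close>.\<close>

lemma sign_outer_row: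
  fixes a b c :: "real \<Rightarrow> real"
  assumes ord: "t1 < h2" "h2 < t2" "t2 < h1" "h1 < t3"
    and rel: "\<And>x. (x - t1) * (t3 - t2) * c x = (x - t2) * (t3 - t1) * a x + (t3 - x) * (t2 - t1) * b x"
    and b: "two_roots_in {t1<..<h2} b" and c: "two_roots_in {h1<..<t3} c"
    and a: "two_roots_in ({t1<..<h2} \<union> {h1<..<t3}) a"
  shows "a h2 * b h2 < 0"
proof -
  obtain kb r s where kb: "kb \<noteq> 0" "t1 < r" "r < h2" "t1 < s" "s < h2"
    and b: "\<And>x. b x = kb * (x - r) * (x - s)"
    using b unfolding two_roots_in_def by auto
  obtain kc r' s' where kc: "kc \<noteq> 0" "h1 < r'" "r' < t3" "h1 < s'" "s' < t3"
    and c: "\<And>x. c x = kc * (x - r') * (x - s')"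
    using c unfolding two_roots_in_def by auto
  obtain ka u w where ka: "ka \<noteq> 0" "t1 < u \<and> u < h2 \<or> h1 < u \<and> u < t3"
      "t1 < w \<and> w < h2 \<or> h1 < w \<and> w < t3"
    and a: "\<And>x. a x = ka * (x - u) * (x - w)"
    using a unfolding two_roots_in_def by auto
  have pos: "(x - p) * (x - q) > 0" if "x < p \<and> x < q \<or> p < x \<and> q < x" for x p q :: real
    using that by (auto simp: zero_less_mult_iff)
  have "a t1 = b t1"
  proof -
    have "(t3 - t1) * (t2 - t1) * (b t1 - a t1) = 0" using rel[of t1] by algebra
    then show ?thesis using ord by simp
  qed
  then have "ka * ((t1 - u) * (t1 - w)) = kb * ((t1 - r) * (t1 - s))"
    by (simp add: a b mult.assoc)
  moreover have "(t1 - u) * (t1 - w) > 0" "(t1 - r) * (t1 - s) > 0"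
    using ka kb ord by (auto intro!: pos)
  ultimately have ab: "ka > 0 \<longleftrightarrow> kb > 0"
    by (metis zero_less_mult_pos2 mult_pos_pos)
  have "a t3 = c t3"
  proof -
    have "(t3 - t1) * (t3 - t2) * (c t3 - a t3) = 0" using rel[of t3] by algebra
    then show ?thesis using ord by simp
  qed
  then have "ka * ((t3 - u) * (t3 - w)) = kc * ((t3 - r') * (t3 - s'))"
    by (simp add: a c mult.assoc)
  moreover have "(t3 - u) * (t3 - w) > 0" "(t3 - r') * (t3 - s') > 0"
    using ka kc ord by (auto intro!: pos)
  ultimately have ac: "ka > 0 \<longleftrightarrow> kc > 0"
    by (metis zero_less_mult_pos2 mult_pos_pos)
  have same: "k * (p * X) + l * (q * Y) \<noteq> 0"
    if "k \<noteq> 0" "l \<noteq> 0" "k > 0 \<longleftrightarrow> l > 0" "p > 0" "q > 0" "X > 0" "Y > 0" for k l p q X Y :: real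
  proof (cases "k > 0")
    case True
    then have "k * (p * X) > 0" "l * (q * Y) > 0" using that by auto
    then show ?thesis by linarith
  next
    case False
    then have "k * (p * X) < 0" "l * (q * Y) < 0" using that by (auto simp: mult_less_0_iff)
    then show ?thesis by linarith
  qed
  have "\<not> (u < h2 \<and> w < h2)"
  proof
    assume uw: "u < h2 \<and> w < h2"
    \<comment> \<open>At a root of \<open>c\<close> the relation makes a sum of two nonzero numbers
      of equal sign vanish.\<close>
    have "ka * ((r' - t2) * (t3 - t1) * ((r' - u) * (r' - w)))
        + kb * ((t3 - r') * (t2 - t1) * ((r' - r) * (r' - s))) = 0"
      using rel[of r'] unfolding a b c by algebra
    moreover have "(r' - u) * (r' - w) > 0" "(r' - r) * (r' - s) > 0"
      using uw kb kc ord by (auto intro!: pos)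
    moreover have "(r' - t2) * (t3 - t1) > 0" "(t3 - r') * (t2 - t1) > 0"
      using kc ord by simp_all
    ultimately show False using same[OF ka(1) kb(1) ab] by blast
  qed
  moreover have "\<not> (h1 < u \<and> h1 < w)"
  proof
    assume uw: "h1 < u \<and> h1 < w"
    \<comment> \<open>The mirror argument, at a root of \<open>b\<close>.\<close>
    have "ka * ((t2 - r) * (t3 - t1) * ((r - u) * (r - w)))
        + kc * ((r - t1) * (t3 - t2) * ((r - r') * (r - s'))) = 0"
      using rel[of r] unfolding a b c by algebra
    moreover have "(r - u) * (r - w) > 0" "(r - r') * (r - s') > 0"
      using uw kb kc ord by (auto intro!: pos)
    moreover have "(t2 - r) * (t3 - t1) > 0" "(r - t1) * (t3 - t2) > 0"
      using kb ord by simp_all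
    ultimately show False using same[OF ka(1) kc(1) ac] by blast
  qed
  ultimately have "(h2 - u) * (h2 - w) < 0"
    using ka ord by (auto simp: mult_less_0_iff)
  moreover have "(h2 - r) * (h2 - s) > 0" using kb by simp
  moreover have "ka * kb > 0" using ab ka(1) kb(1) by (auto simp: zero_less_mult_iff)
  moreover have "a h2 * b h2 = (ka * kb) * ((h2 - r) * (h2 - s)) * ((h2 - u) * (h2 - w))"
    by (simp add: a b)
  ultimately show ?thesis by (metis mult_pos_neg mult_pos_pos)
qed

text \<open>The two functions agree at \<open>t1\<close>, and all their roots exceed
  \<open>h2\<close>, so neither changes sign between \<open>t1\<close> and
  \<open>h2\<close>.\<close>

lemma sign_inner_row:
  fixes a b :: "real \<Rightarrow> real"
  assumes "t1 < h2" "a t1 = b t1" "two_roots_in {h2<..<t2} b" "two_roots_in {h2<..<h3} a"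
  shows "a h2 * b h2 > 0"
proof -
  obtain kb r s where kb: "kb \<noteq> 0" "h2 < r" "h2 < s" and b: "\<And>x. b x = kb * (x - r) * (x - s)"
    using assms(3) unfolding two_roots_in_def by auto
  obtain ka u w where ka: "ka \<noteq> 0" "h2 < u" "h2 < w" and a: "\<And>x. a x = ka * (x - u) * (x - w)"
    using assms(4) unfolding two_roots_in_def by auto
  have pos: "(x - p) * (x - q) > 0" if "x < p" "x < q" for x p q :: real
    using that by (auto simp: zero_less_mult_iff)
  have "ka * ((t1 - u) * (t1 - w)) = kb * ((t1 - r) * (t1 - s))"
    using assms(2) by (simp add: a b mult.assoc)
  moreover have "(t1 - u) * (t1 - w) > 0" "(t1 - r) * (t1 - s) > 0"
    using ka kb assms(1) by (auto intro!: pos)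
  ultimately have "ka > 0 \<longleftrightarrow> kb > 0"
    by (metis zero_less_mult_pos2 mult_pos_pos)
  then have "ka * kb > 0" using ka(1) kb(1) by (auto simp: zero_less_mult_iff)
  moreover have "a h2 * b h2 = (ka * kb) * (((h2 - r) * (h2 - s)) * ((h2 - u) * (h2 - w)))"
    by (simp add: a b)
  ultimately show ?thesis using pos ka kb by (metis mult_pos_pos)
qed

section \<open>Nine quadratics\<close>

lemma index_3: "(1::3) + 1 = 2" "(1::3) + 2 = 3" "(2::3) + 1 = 3" "(2::3) + 2 = 1"
    "(3::3) + 1 = 1" "(3::3) + 2 = 2"
  by simp_all

definition edge_lerp :: "(3 \<Rightarrow> real) \<Rightarrow> (3 \<Rightarrow> real) \<Rightarrow> 3 \<Rightarrow> real \<Rightarrow> real" where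
  "edge_lerp \<theta> u k x = lerp (\<theta> (k + 1)) (\<theta> (k + 2)) (u (k + 1)) (u (k + 2)) x"

text \<open>A permutation of three indices preserves or reverses the cyclic order; in both cases the
  two ends of an edge remain the ends of an edge.\<close>

lemma permuted_pair:
  fixes \<pi> :: "3 \<Rightarrow> 3"
  assumes "bij \<pi>"
  shows "\<pi> (k + 1) = \<pi> k + 1 \<and> \<pi> (k + 2) = \<pi> k + 2 \<or>
    \<pi> (k + 1) = \<pi> k + 2 \<and> \<pi> (k + 2) = \<pi> k + 1"
proof -
  have d: "\<pi> (k + 1) \<noteq> \<pi> k" "\<pi> (k + 2) \<noteq> \<pi> k" "\<pi> (k + 1) \<noteq> \<pi> (k + 2)"
    using bij_is_inj[OF assms] by (simp_all add: inj_eq)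
  have "x = \<pi> k \<or> x = \<pi> k + 1 \<or> x = \<pi> k + 2" for x
    using UNIV_I[of x] unfolding UNIV_3_shift[of "\<pi> k"] by blast
  from this[of "\<pi> (k + 1)"] this[of "\<pi> (k + 2)"] d show ?thesis by auto
qed

lemma edge_lerp_permute:
  assumes "bij \<pi>"
  shows "edge_lerp (\<lambda>k. \<theta> (\<pi> k)) (\<lambda>k. u (\<pi> k)) k x = edge_lerp \<theta> u (\<pi> k) x"
  using permuted_pair[OF assms, of k] unfolding edge_lerp_def
  by (elim disjE conjE) (simp, simp add: lerp_commute[of "\<theta> (\<pi> k + 1)" "\<theta> (\<pi> k + 2)"])

lemma edge_lerp_uminus: "edge_lerp (\<lambda>k. - \<theta> k) u k (- x) = edge_lerp \<theta> u k x"
  by (simp add: edge_lerp_def lerp_uminus)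

lemma edge_lerp_swap:
  "edge_lerp \<theta> (\<lambda>i. edge_lerp \<tau> (M i) l x) k x = edge_lerp \<tau> (\<lambda>j. edge_lerp \<theta> (\<lambda>i. M i j) k x) l x"
  unfolding edge_lerp_def by (rule lerp_lerp)

lemma edge_lerp_at:
  assumes "inj \<theta>"
  shows "edge_lerp \<theta> u k (\<theta> (k + 1)) = u (k + 1)" "edge_lerp \<theta> u k (\<theta> (k + 2)) = u (k + 2)"
  using assms by (simp_all add: edge_lerp_def inj_eq)

text \<open>The parameters of the planes of a pencil through the vertices of two triangles are \<open>\<theta>\<close> and \<open>\<tau>\<close>;
  the signs of \<open>\<sigma>\<close> tell which edges of the first triangle pass through the plane at infinity of the
  chart. \<open>N k l\<close> collects the parameters of the lines meeting the edges opposite to the vertices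
  \<open>k\<close> and \<open>l\<close>.\<close>

locale nine_quadratics =
  fixes \<theta> \<tau> \<sigma> :: "3 \<Rightarrow> real" and M :: "3 \<Rightarrow> 3 \<Rightarrow> real" and N :: "3 \<Rightarrow> 3 \<Rightarrow> real set"
  assumes inj: "inj \<theta>" "inj \<tau>" and \<sigma>_nonzero: "\<And>k. \<sigma> k \<noteq> 0"
    and finite_N: "\<And>k l. finite (N k l)"
    and card_le_2: "\<And>k l. card (N k l) \<le> 2"
    and root: "\<And>k l x. x \<in> N k l \<Longrightarrow> edge_lerp \<theta> (\<lambda>i. edge_lerp \<tau> (M i) l x) k x = 0"
    and range_\<theta>: "\<And>k l x. x \<in> N k l \<Longrightarrow>
      \<sigma> (k + 1) * \<sigma> (k + 2) * ((\<theta> (k + 1) - x) * (\<theta> (k + 2) - x)) < 0"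
    and range_\<tau>: "\<And>k l x. x \<in> N k l \<Longrightarrow> (\<tau> (l + 1) - x) * (\<tau> (l + 2) - x) < 0"
    and nonzero_\<theta>: "\<And>k l. edge_lerp \<tau> (M k) l (\<theta> k) \<noteq> 0"
    and nonzero_\<tau>: "\<And>k l. edge_lerp \<theta> (\<lambda>i. M i l) k (\<tau> l) \<noteq> 0"
    and lone: "\<And>k. \<sigma> k * \<sigma> (k + 1) < 0 \<Longrightarrow> \<sigma> k * \<sigma> (k + 2) < 0 \<Longrightarrow>
      (\<theta> (k + 1) - \<theta> k) * (\<theta> (k + 2) - \<theta> k) > 0"

lemma nine_quadratics_permute:
  assumes "nine_quadratics \<theta> \<tau> \<sigma> M N" and \<pi>: "bij \<pi>" and \<rho>: "bij \<rho>"
  shows "nine_quadratics (\<lambda>k. \<theta> (\<pi> k)) (\<lambda>l. \<tau> (\<rho> l)) (\<lambda>k. \<sigma> (\<pi> k))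
    (\<lambda>k l. M (\<pi> k) (\<rho> l)) (\<lambda>k l. N (\<pi> k) (\<rho> l))"
proof -
  interpret nine_quadratics \<theta> \<tau> \<sigma> M N by fact
  have col: "edge_lerp (\<lambda>l. \<tau> (\<rho> l)) (\<lambda>l. M i (\<rho> l)) l x = edge_lerp \<tau> (M i) (\<rho> l) x" for i l x
    by (rule edge_lerp_permute[OF \<rho>])
  show ?thesis
  proof
    show "inj (\<lambda>k. \<theta> (\<pi> k))" "inj (\<lambda>l. \<tau> (\<rho> l))"
      using inj_compose[OF inj(1) bij_is_inj[OF \<pi>]] inj_compose[OF inj(2) bij_is_inj[OF \<rho>]]
      by (simp_all add: comp_def)
  next
    fix k l x assume x: "x \<in> N (\<pi> k) (\<rho> l)"
    show "edge_lerp (\<lambda>k. \<theta> (\<pi> k)) (\<lambda>i. edge_lerp (\<lambda>l. \<tau> (\<rho> l)) (\<lambda>l. M (\<pi> i) (\<rho> l)) l x) k x = 0"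
      unfolding col using root[OF x]
        edge_lerp_permute[OF \<pi>, of \<theta> "\<lambda>i. edge_lerp \<tau> (M i) (\<rho> l) x" k x] by metis
    show "\<sigma> (\<pi> (k + 1)) * \<sigma> (\<pi> (k + 2)) * ((\<theta> (\<pi> (k + 1)) - x) * (\<theta> (\<pi> (k + 2)) - x)) < 0"
      using permuted_pair[OF \<pi>, of k] range_\<theta>[OF x] by (auto simp: mult.commute)
    show "(\<tau> (\<rho> (l + 1)) - x) * (\<tau> (\<rho> (l + 2)) - x) < 0"
      using permuted_pair[OF \<rho>, of l] range_\<tau>[OF x] by (auto simp: mult.commute)
  next
    fix k l
    show "edge_lerp (\<lambda>l. \<tau> (\<rho> l)) (\<lambda>l. M (\<pi> k) (\<rho> l)) l (\<theta> (\<pi> k)) \<noteq> 0"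
      unfolding col by (rule nonzero_\<theta>)
    show "edge_lerp (\<lambda>k. \<theta> (\<pi> k)) (\<lambda>i. M (\<pi> i) (\<rho> l)) k (\<tau> (\<rho> l)) \<noteq> 0"
      unfolding edge_lerp_permute[OF \<pi>, of \<theta> "\<lambda>i. M i (\<rho> l)"] by (rule nonzero_\<tau>)
  next
    fix k assume "\<sigma> (\<pi> k) * \<sigma> (\<pi> (k + 1)) < 0" "\<sigma> (\<pi> k) * \<sigma> (\<pi> (k + 2)) < 0"
    then show "(\<theta> (\<pi> (k + 1)) - \<theta> (\<pi> k)) * (\<theta> (\<pi> (k + 2)) - \<theta> (\<pi> k)) > 0"
      using permuted_pair[OF \<pi>, of k] lone[of "\<pi> k"] by (auto simp: mult.commute)
  qed (use \<sigma>_nonzero finite_N card_le_2 in auto)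
qed

text \<open>Reflecting the chart exchanges the cases where a lone vertex has the smallest and the
  largest parameter.\<close>

lemma nine_quadratics_uminus:
  assumes "nine_quadratics \<theta> \<tau> \<sigma> M N"
  shows "nine_quadratics (\<lambda>k. - \<theta> k) (\<lambda>l. - \<tau> l) \<sigma> M (\<lambda>k l. uminus ` N k l)"
proof -
  interpret nine_quadratics \<theta> \<tau> \<sigma> M N by fact
  have neg: "(- a - - x) * (- b - - x) = (a - x) * (b - x)" for a b x :: real by algebra
  show ?thesis
  proof
    show "inj (\<lambda>k. - \<theta> k)" "inj (\<lambda>l. - \<tau> l)" using inj by (simp_all add: inj_def)
    show "card (uminus ` N k l) \<le> 2" for k l using card_le_2[of k l] by (simp add: card_image)
  next
    fix k l x assume "x \<in> uminus ` N k l"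
    then obtain y where y: "y \<in> N k l" "x = - y" by auto
    show "edge_lerp (\<lambda>k. - \<theta> k) (\<lambda>i. edge_lerp (\<lambda>l. - \<tau> l) (M i) l x) k x = 0"
      using root[OF y(1)] by (simp add: y(2) edge_lerp_uminus)
    show "\<sigma> (k + 1) * \<sigma> (k + 2) * ((- \<theta> (k + 1) - x) * (- \<theta> (k + 2) - x)) < 0"
      using range_\<theta>[OF y(1)] unfolding y(2) neg .
    show "(- \<tau> (l + 1) - x) * (- \<tau> (l + 2) - x) < 0"
      using range_\<tau>[OF y(1)] unfolding y(2) neg .
  next
    fix k assume "\<sigma> k * \<sigma> (k + 1) < 0" "\<sigma> k * \<sigma> (k + 2) < 0"
    from lone[OF this] show "(- \<theta> (k + 1) - - \<theta> k) * (- \<theta> (k + 2) - - \<theta> k) > 0"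
      unfolding neg .
  qed (use \<sigma>_nonzero finite_N nonzero_\<theta> nonzero_\<tau> in \<open>auto simp: edge_lerp_uminus\<close>)
qed

section \<open>Signs at the ends of the arcs\<close>

context nine_quadratics
begin

definition P :: "3 \<Rightarrow> 3 \<Rightarrow> real \<Rightarrow> real" where
  "P k l x = edge_lerp \<theta> (\<lambda>i. edge_lerp \<tau> (M i) l x) k x"

text \<open>At a vertex of the first triangle the value does not depend on which of the two edges
  through that vertex is taken. These shared values link the signs of different quadratics.\<close>

lemma P_at_\<theta>: "P k l (\<theta> (k + 1)) = edge_lerp \<tau> (M (k + 1)) l (\<theta> (k + 1))"
    "P k l (\<theta> (k + 2)) = edge_lerp \<tau> (M (k + 2)) l (\<theta> (k + 2))"
  unfolding P_def by (simp_all add: edge_lerp_at[OF inj(1)])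

lemma P_at_\<tau>: "P k l (\<tau> (l + 1)) = edge_lerp \<theta> (\<lambda>i. M i (l + 1)) k (\<tau> (l + 1))"
    "P k l (\<tau> (l + 2)) = edge_lerp \<theta> (\<lambda>i. M i (l + 2)) k (\<tau> (l + 2))"
  unfolding P_def edge_lerp_swap[of \<theta> \<tau> M] by (simp_all add: edge_lerp_at[OF inj(2)])

lemma quadratic_P: "quadratic (P k l)"
  unfolding P_def edge_lerp_def by (rule quadratic_lerp_lerp)

lemma N_subset_roots: "N k l \<subseteq> {x. P k l x = 0}"
  using root by (auto simp: P_def)


text \<open>Two distinct roots force equal signs at the ends; conversely, equal signs turn one root
  into two with multiplicity. \<open>P k l a \<noteq> 0\<close> rules out the zero
  polynomial.\<close>

lemma count_2:
  assumes "a < b" "N k l \<subseteq> {a<..<b}" "P k l a \<noteq> 0"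
  shows "card (N k l) = 2 \<longrightarrow> P k l a * P k l b > 0"
    "card (N k l) \<ge> 1 \<Longrightarrow> P k l a * P k l b > 0 \<Longrightarrow> two_roots_in {a<..<b} (P k l)"
proof -
  have W: "{a<..<b} = {x. (x - a) * (x - b) < 0}"
    using assms(1) by (auto simp: mult_less_0_iff)
  show "card (N k l) = 2 \<longrightarrow> P k l a * P k l b > 0"
    using two_roots_in_if_two[OF quadratic_P assms(3), of "N k l" "{a<..<b}"] assms(2)
      N_subset_roots two_roots_in_sign_2 unfolding W by blast
  assume "card (N k l) \<ge> 1" and pos: "P k l a * P k l b > 0"
  then obtain r where "r \<in> N k l" by fastforce
  then have "P k l r = 0" "(r - a) * (r - b) < 0"
    using assms(2) N_subset_roots unfolding W by blast+
  then show "two_roots_in {a<..<b} (P k l)"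
    unfolding W using two_roots_in_if_sign_2[OF quadratic_P] pos by blast
qed

lemma count_4:
  assumes "a < b" "b < c" "c < d" "N k l \<subseteq> {a<..<b} \<union> {c<..<d}" "P k l a \<noteq> 0"
  shows "card (N k l) = 2 \<longrightarrow> P k l a * P k l b * P k l c * P k l d > 0"
    "card (N k l) \<ge> 1 \<Longrightarrow> P k l a * P k l b * P k l c * P k l d > 0 \<Longrightarrow>
      two_roots_in ({a<..<b} \<union> {c<..<d}) (P k l)"
proof -
  have W: "{a<..<b} \<union> {c<..<d} = {x. (x - a) * (x - b) * (x - c) * (x - d) < 0}"
  proof (rule set_eqI)
    fix x
    have "(x - a) * (x - b) < 0 \<longleftrightarrow> a < x \<and> x < b" "(x - a) * (x - b) > 0 \<longleftrightarrow> x < a \<or> b < x"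
      "(x - c) * (x - d) < 0 \<longleftrightarrow> c < x \<and> x < d" "(x - c) * (x - d) > 0 \<longleftrightarrow> x < c \<or> d < x"
      using assms(1,3) by (auto simp: mult_less_0_iff zero_less_mult_iff)
    then show "x \<in> {a<..<b} \<union> {c<..<d} \<longleftrightarrow> x \<in> {x. (x - a) * (x - b) * (x - c) * (x - d) < 0}"
      using assms(1-3) mult_less_0_iff[of "(x - a) * (x - b)" "(x - c) * (x - d)"]
      by (auto simp: mult.assoc)
  qed
  show "card (N k l) = 2 \<longrightarrow> P k l a * P k l b * P k l c * P k l d > 0"
    using two_roots_in_if_two[OF quadratic_P assms(5), of "N k l" "{a<..<b} \<union> {c<..<d}"] assms(4)
      N_subset_roots two_roots_in_sign_4 unfolding W by blast
  assume "card (N k l) \<ge> 1" and pos: "P k l a * P k l b * P k l c * P k l d > 0"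
  then obtain r where "r \<in> N k l" by fastforce
  then have "P k l r = 0" "(r - a) * (r - b) * (r - c) * (r - d) < 0"
    using assms(4) N_subset_roots unfolding W by blast+
  then show "two_roots_in ({a<..<b} \<union> {c<..<d}) (P k l)"
    unfolding W using two_roots_in_if_sign_4[OF quadratic_P] pos by blast
qed

text \<open>The eight other sets contribute at most 16 elements.\<close>

lemma nonempty_if_sum_large:
  assumes "(\<Sum>k\<in>UNIV. \<Sum>l\<in>UNIV. card (N k l)) > 16"
  shows "N k l \<noteq> {}"
proof
  assume "N k l = {}"
  then have 0: "card (N k l) = 0" by simp
  have "(\<Sum>k\<in>UNIV. \<Sum>l\<in>UNIV. card (N k l)) = (\<Sum>(k, l)\<in>UNIV. card (N k l))"
    by (simp add: sum.cartesian_product)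
  also have "\<dots> = (\<Sum>(k, l)\<in>UNIV - {(k, l)}. card (N k l))"
    by (subst sum.remove[of _ "(k, l)"]) (simp_all add: 0)
  also have "\<dots> \<le> (\<Sum>(k, l)\<in>UNIV - {(k, l)}. 2)"
    by (rule sum_mono) (use card_le_2 in auto)
  also have "\<dots> = 16"
    by (simp add: case_prod_unfold)
  finally show False using assms by simp
qed

text \<open>A total above 16 leaves a deficit of at most one. The parity argument makes all nine
  products of end values positive, so every quadratic has both roots in its arc. Rows 3 and 1 then
  require opposite signs for the same two values at \<theta> 2.\<close>

lemma sum_le_16_if_interleaved:
  assumes ord: "\<tau> 1 < \<theta> 2" "\<theta> 2 < \<tau> 2" "\<tau> 2 < \<theta> 3" "\<theta> 3 < \<theta> 1" "\<theta> 1 < \<tau> 3"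
    and \<sigma>: "\<sigma> 1 * \<sigma> 2 < 0" "\<sigma> 1 * \<sigma> 3 < 0"
  shows "(\<Sum>k\<in>UNIV. \<Sum>l\<in>UNIV. card (N k l)) \<le> 16"
proof (rule ccontr)
  assume "\<not> ?thesis"
  then have large: "(\<Sum>k\<in>UNIV. \<Sum>l\<in>UNIV. card (N k l)) > 16" by simp
  have ne: "card (N k l) \<ge> 1" for k l
    using nonempty_if_sum_large[OF large, of k l] finite_N[of k l] by (simp add: Suc_le_eq card_gt_0_iff)
  have "\<sigma> 2 * \<sigma> 3 > 0" using \<sigma> by (auto simp: mult_less_0_iff zero_less_mult_iff)
  note \<sigma> = \<sigma> this
  have out: "x < b \<or> c < x" if "s * ((c - x) * (b - x)) < 0" "s < 0" "b < c" for s b c x :: real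
    using that by (auto simp: mult_less_0_iff zero_less_mult_iff)
  have ins: "b < x \<and> x < c" if "s * ((b - x) * (c - x)) < 0" "s > 0" "b < c" for s b c x :: real
    using that by (auto simp: mult_less_0_iff zero_less_mult_iff)
  \<comment> \<open>The signs of \<sigma> separate vertex 1 from the others, so the edges opposite
    to 3 and 2 pass through infinity and occupy the outside of an interval; the edge opposite to 1
    occupies the inside.\<close>
  have r3: "x < \<theta> 2 \<or> \<theta> 1 < x" if "x \<in> N 3 l" for x l
    using out[OF range_\<theta>[OF that, unfolded index_3]] \<sigma> ord by simp
  have r1: "\<theta> 2 < x \<and> x < \<theta> 3" if "x \<in> N 1 l" for x l
    using ins[OF range_\<theta>[OF that, unfolded index_3]] \<sigma> ord by simp
  have r2: "x < \<theta> 3 \<or> \<theta> 1 < x" if "x \<in> N 2 l" for x l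
    using range_\<theta>[OF that, unfolded index_3] out[of "\<sigma> 1 * \<sigma> 3" "\<theta> 1" x "\<theta> 3"] \<sigma> ord
    by (simp add: mult_ac)
  have c3: "\<tau> 1 < x \<and> x < \<tau> 2" if "x \<in> N k 3" for x k
    using ins[of 1 "\<tau> 1" x "\<tau> 2"] range_\<tau>[OF that, unfolded index_3] ord by simp
  have c1: "\<tau> 2 < x \<and> x < \<tau> 3" if "x \<in> N k 1" for x k
    using ins[of 1 "\<tau> 2" x "\<tau> 3"] range_\<tau>[OF that, unfolded index_3] ord by simp
  have c2: "\<tau> 1 < x \<and> x < \<tau> 3" if "x \<in> N k 2" for x k
    using ins[of 1 "\<tau> 1" x "\<tau> 3"] range_\<tau>[OF that, unfolded index_3] ord by (simp add: mult_ac)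
  define T where "T i l = edge_lerp \<tau> (M i) l (\<theta> i)" for i l
  define U where "U k j = edge_lerp \<theta> (\<lambda>i. M i j) k (\<tau> j)" for k j
  have T0: "T i l \<noteq> 0" for i l by (simp add: T_def nonzero_\<theta>)
  have U0: "U k j \<noteq> 0" for k j by (simp add: U_def nonzero_\<tau>)
  note P_\<theta> = P_at_\<theta>[of 1, unfolded index_3, folded T_def] P_at_\<theta>[of 2, unfolded index_3, folded T_def]
    P_at_\<theta>[of 3, unfolded index_3, folded T_def]
  note P_\<tau> = P_at_\<tau>[of _ 1, unfolded index_3, folded U_def] P_at_\<tau>[of _ 2, unfolded index_3, folded U_def]
    P_at_\<tau>[of _ 3, unfolded index_3, folded U_def]
  note PTU = P_\<theta> P_\<tau> T0 U0
  have n33: "N 3 3 \<subseteq> {\<tau> 1<..<\<theta> 2}" using r3 c3 ord by fastforce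
  have n31: "N 3 1 \<subseteq> {\<theta> 1<..<\<tau> 3}" using r3 c1 ord by fastforce
  have n32: "N 3 2 \<subseteq> {\<tau> 1<..<\<theta> 2} \<union> {\<theta> 1<..<\<tau> 3}" using r3 c2 ord by fastforce
  have n13: "N 1 3 \<subseteq> {\<theta> 2<..<\<tau> 2}" using r1 c3 ord by fastforce
  have n11: "N 1 1 \<subseteq> {\<tau> 2<..<\<theta> 3}" using r1 c1 ord by fastforce
  have n12: "N 1 2 \<subseteq> {\<theta> 2<..<\<theta> 3}" using r1 c2 ord by fastforce
  have n23: "N 2 3 \<subseteq> {\<tau> 1<..<\<tau> 2}" using r2 c3 ord by fastforce
  have n21: "N 2 1 \<subseteq> {\<tau> 2<..<\<theta> 3} \<union> {\<theta> 1<..<\<tau> 3}" using r2 c1 ord by fastforce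
  have n22: "N 2 2 \<subseteq> {\<tau> 1<..<\<theta> 3} \<union> {\<theta> 1<..<\<tau> 3}" using r2 c2 ord by fastforce
  have o: "\<tau> 1 < \<tau> 2" "\<theta> 2 < \<theta> 3" "\<theta> 2 < \<theta> 1" "\<tau> 1 < \<theta> 3" using ord by auto
  \<comment> \<open>In each of these facts, part 1 supplies an entry for the parity argument, and
    part 2 turns the resulting sign into two roots.\<close>
  note c33 = count_2[OF ord(1) n33, unfolded PTU, OF U0]
  note c31 = count_2[OF ord(5) n31, unfolded PTU, OF T0]
  note c32 = count_4[OF ord(1) o(3) ord(5) n32, unfolded PTU, OF U0]
  note c13 = count_2[OF ord(2) n13, unfolded PTU, OF T0]
  note c11 = count_2[OF ord(3) n11, unfolded PTU, OF U0]
  note c12 = count_2[OF o(2) n12, unfolded PTU, OF T0]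
  note c23 = count_2[OF o(1) n23, unfolded PTU, OF U0]
  note c21 = count_4[OF ord(3) ord(4) ord(5) n21, unfolded PTU, OF U0]
  note c22 = count_4[OF o(4) ord(4) ord(5) n22, unfolded PTU, OF U0]
  let ?ps = "[U 3 1 * T 2 3, T 1 1 * U 3 3, U 3 1 * T 2 2 * T 1 2 * U 3 3, T 2 3 * U 1 2, U 1 2 * T 3 1,
    T 2 2 * T 3 2, U 2 1 * U 2 2, U 2 2 * T 3 1 * T 1 1 * U 2 3, U 2 1 * T 3 2 * T 1 2 * U 2 3]"
  let ?ns = "[card (N 3 3), card (N 3 1), card (N 3 2), card (N 1 3), card (N 1 1), card (N 1 2),
    card (N 2 3), card (N 2 1), card (N 2 2)]"
  have "\<forall>p\<in>set ?ps. p > 0"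
  proof (rule list_pos_if_prod_pos)
    show "list_all2 (\<lambda>p n. n \<le> 2 \<and> p \<noteq> 0 \<and> (n = 2 \<longrightarrow> p > 0)) ?ps ?ns"
      using c33(1) c31(1) c32(1) c13(1) c11(1) c12(1) c23(1) c21(1) c22(1) card_le_2
      by (simp only: list_all2_Cons list_all2_Nil mult_eq_0_iff T0 U0) simp
    show "2 * length ?ns \<le> sum_list ?ns + 1"
      using large by (simp add: sum_3)
    \<comment> \<open>Each of the twelve end values occurs in exactly two of the nine
      products.\<close>
    have "prod_list ?ps = (U 3 1 * T 2 3 * T 1 1 * U 3 3 * T 2 2 * T 1 2 * U 1 2 * T 3 1 * T 3 2
        * U 2 1 * U 2 2 * U 2 3)\<^sup>2"
      unfolding prod_list.Cons prod_list.Nil by algebra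
    also have "\<dots> > 0" by (simp only: zero_less_power2 mult_eq_0_iff T0 U0) simp
    finally show "prod_list ?ps > 0" .
  qed
  then have pos: "U 3 1 * T 2 3 > 0" "T 1 1 * U 3 3 > 0" "U 3 1 * T 2 2 * T 1 2 * U 3 3 > 0"
    "T 2 3 * U 1 2 > 0" "T 2 2 * T 3 2 > 0"
    by simp_all
  have "P 3 2 (\<theta> 2) * P 3 3 (\<theta> 2) < 0"
  proof (rule sign_outer_row[where a = "P 3 2" and b = "P 3 3" and c = "P 3 1" and ?t1.0 = "\<tau> 1"
        and ?t2.0 = "\<tau> 2" and ?t3.0 = "\<tau> 3" and ?h1.0 = "\<theta> 1"])
    fix x
    have e: "P 3 l x = edge_lerp \<tau> (\<lambda>j. edge_lerp \<theta> (\<lambda>i. M i j) 3 x) l x" for l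
      unfolding P_def by (rule edge_lerp_swap)
    show "(x - \<tau> 1) * (\<tau> 3 - \<tau> 2) * P 3 1 x = (x - \<tau> 2) * (\<tau> 3 - \<tau> 1) * P 3 2 x
        + (\<tau> 3 - x) * (\<tau> 2 - \<tau> 1) * P 3 3 x"
      unfolding e edge_lerp_def[of \<tau>] index_3 lerp_commute[of "\<tau> 3" "\<tau> 1"]
      by (rule lerp_collinear) (use ord in auto)
  qed (use ord c33(2)[OF ne] c31(2)[OF ne] c32(2)[OF ne] pos in auto)
  moreover have "P 1 2 (\<theta> 2) * P 1 3 (\<theta> 2) > 0"
  proof (rule sign_inner_row[of "\<tau> 1" "\<theta> 2" "P 1 2" "P 1 3" "\<tau> 2" "\<theta> 3"])
    show "P 1 2 (\<tau> 1) = P 1 3 (\<tau> 1)" by (simp only: PTU)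
  qed (use ord c13(2)[OF ne] c12(2)[OF ne] pos in auto)
  \<comment> \<open>Both rows evaluate to \<open>T 2 2\<close> and \<open>T 2 3\<close> at \<theta>
    2, since the edges 3 and 1 share vertex 2.\<close>
  ultimately show False by (simp only: PTU)
qed

text \<open>Nonemptiness of the four sets pairing edge 1 or 3 with column 1 or 3 already forces the
  interleaved order.\<close>

lemma sum_le_16_if_lone:
  assumes \<tau>: "\<tau> 1 < \<tau> 2" "\<tau> 2 < \<tau> 3" and \<theta>: "\<theta> 2 < \<theta> 3" "\<theta> 3 < \<theta> 1"
    and \<sigma>: "\<sigma> 1 * \<sigma> 2 < 0" "\<sigma> 1 * \<sigma> 3 < 0"
  shows "(\<Sum>k\<in>UNIV. \<Sum>l\<in>UNIV. card (N k l)) \<le> 16"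
proof (rule ccontr)
  assume large: "\<not> ?thesis"
  then have ne: "\<exists>x. x \<in> N k l" for k l using nonempty_if_sum_large[of k l] by auto
  have "\<sigma> 2 * \<sigma> 3 > 0" using \<sigma> by (auto simp: mult_less_0_iff zero_less_mult_iff)
  have out: "x < b \<or> c < x" if "s * ((c - x) * (b - x)) < 0" "s < 0" "b < c" for s b c x :: real
    using that by (auto simp: mult_less_0_iff zero_less_mult_iff)
  have ins: "b < x \<and> x < c" if "s * ((b - x) * (c - x)) < 0" "s > 0" "b < c" for s b c x :: real
    using that by (auto simp: mult_less_0_iff zero_less_mult_iff)
  have r3: "x < \<theta> 2 \<or> \<theta> 1 < x" if "x \<in> N 3 l" for x l
    using out[OF range_\<theta>[OF that, unfolded index_3]] \<sigma> \<theta> by simp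
  have r1: "\<theta> 2 < x \<and> x < \<theta> 3" if "x \<in> N 1 l" for x l
    using ins[OF range_\<theta>[OF that, unfolded index_3]] \<open>\<sigma> 2 * \<sigma> 3 > 0\<close> \<theta> by simp
  have c3: "\<tau> 1 < x \<and> x < \<tau> 2" if "x \<in> N k 3" for x k
    using ins[of 1 "\<tau> 1" x "\<tau> 2"] range_\<tau>[OF that, unfolded index_3] \<tau> by simp
  have c1: "\<tau> 2 < x \<and> x < \<tau> 3" if "x \<in> N k 1" for x k
    using ins[of 1 "\<tau> 2" x "\<tau> 3"] range_\<tau>[OF that, unfolded index_3] \<tau> by simp
  have 2: "\<theta> 2 < \<tau> 2" using ne[of 1 3] r1 c3 by force
  have 3: "\<tau> 2 < \<theta> 3" using ne[of 1 1] r1 c1 by force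
  have "\<tau> 1 < \<theta> 2" using ne[of 3 3] r3 c3 3 \<theta> by force
  moreover have "\<theta> 1 < \<tau> 3" using ne[of 3 1] r3 c1 2 by force
  ultimately show False using sum_le_16_if_interleaved 2 3 \<theta> \<sigma> large by blast
qed

end

section \<open>Reduction to sorted parameters\<close>

lemma permutation_3:
  fixes a b c :: 3
  assumes "a \<noteq> b" "b \<noteq> c" "a \<noteq> c"
  obtains \<pi> :: "3 \<Rightarrow> 3" where "bij \<pi>" "\<pi> 1 = a" "\<pi> 2 = b" "\<pi> 3 = c"
proof -
  define \<pi> where "\<pi> i = (if i = 1 then a else if i = 2 then b else c)" for i :: 3
  have "inj \<pi>"
  proof (rule injI)
    fix x y assume "\<pi> x = \<pi> y"
    then show "x = y"
      using exhaust_3[of x] exhaust_3[of y] assms by (auto simp: \<pi>_def split: if_splits)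
  qed
  then have "bij \<pi>" by (simp add: bij_def finite_UNIV_inj_surj)
  then show thesis by (rule that) (simp_all add: \<pi>_def)
qed

lemma sort_3:
  fixes f :: "3 \<Rightarrow> real"
  assumes "inj f"
  obtains \<pi> :: "3 \<Rightarrow> 3" where "bij \<pi>" "f (\<pi> 1) < f (\<pi> 2)" "f (\<pi> 2) < f (\<pi> 3)"
proof -
  have "f 1 \<noteq> f 2" "f 1 \<noteq> f 3" "f 2 \<noteq> f 3" using assms by (simp_all add: inj_eq)
  then obtain a b c where "f a < f b" "f b < f c" by (metis linorder_neqE_linordered_idom)
  moreover from this have "a \<noteq> b" "b \<noteq> c" "a \<noteq> c" by auto
  ultimately show thesis using permutation_3[of a b c] that by metis
qed

lemma sum_permute_3:
  fixes \<pi> \<rho> :: "3 \<Rightarrow> 3"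
  assumes "bij \<pi>" "bij \<rho>"
  shows "(\<Sum>k\<in>UNIV. \<Sum>l\<in>UNIV. f (\<pi> k) (\<rho> l)) = (\<Sum>k\<in>UNIV. \<Sum>l\<in>UNIV. f k l)"
proof -
  have "(\<Sum>l\<in>UNIV. f (\<pi> k) (\<rho> l)) = (\<Sum>l\<in>UNIV. f (\<pi> k) l)" for k
    by (rule sum.reindex_bij_betw[OF assms(2)])
  then show ?thesis
    using sum.reindex_bij_betw[OF assms(1), of "\<lambda>k. \<Sum>l\<in>UNIV. f k l"] by simp
qed

theorem (in nine_quadratics) sum_card_N_le_16:
  "(\<Sum>k\<in>UNIV. \<Sum>l\<in>UNIV. card (N k l)) \<le> 16"
proof (rule ccontr)
  assume large: "\<not> ?thesis"
  then have ne: "\<exists>x. x \<in> N k l" for k l using nonempty_if_sum_large[of k l] by auto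
  obtain \<rho> :: "3 \<Rightarrow> 3" where \<rho>: "bij \<rho>" "\<tau> (\<rho> 1) < \<tau> (\<rho> 2)" "\<tau> (\<rho> 2) < \<tau> (\<rho> 3)"
    by (rule sort_3[OF inj(2)])
  have nine: "nine_quadratics \<theta> \<tau> \<sigma> M N" by unfold_locales
  show False
  proof (cases "\<exists>i. \<sigma> i * \<sigma> (i + 1) < 0 \<and> \<sigma> i * \<sigma> (i + 2) < 0")
    case True
    then obtain i where i: "\<sigma> i * \<sigma> (i + 1) < 0" "\<sigma> i * \<sigma> (i + 2) < 0" by blast
    obtain j k where jk: "j = i + 1 \<and> k = i + 2 \<or> j = i + 2 \<and> k = i + 1" "\<theta> j < \<theta> k"
    proof (cases "\<theta> (i + 1) < \<theta> (i + 2)")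
      case False
      moreover have "\<theta> (i + 1) \<noteq> \<theta> (i + 2)" using inj(1) by (simp add: inj_eq)
      ultimately show ?thesis using that[of "i + 2" "i + 1"] by simp
    qed (use that in blast)
    then have "(\<theta> j - \<theta> i) * (\<theta> k - \<theta> i) > 0" and \<sigma>: "\<sigma> i * \<sigma> j < 0" "\<sigma> i * \<sigma> k < 0"
      using lone[OF i] i by (auto simp: mult.commute)
    \<comment> \<open>By \<open>lone\<close>, the parameter of the separated vertex does not lie
      between those of the other two.\<close>
    with jk(2) consider "\<theta> k < \<theta> i" | "\<theta> i < \<theta> j"
      by (auto simp: zero_less_mult_iff)
    then show False
    proof cases
      case 1
      obtain \<pi> :: "3 \<Rightarrow> 3" where \<pi>: "bij \<pi>" "\<pi> 1 = i" "\<pi> 2 = j" "\<pi> 3 = k"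
        by (rule permutation_3[of i j k]) (use jk in auto)
      interpret Q: nine_quadratics "\<lambda>k. \<theta> (\<pi> k)" "\<lambda>l. \<tau> (\<rho> l)" "\<lambda>k. \<sigma> (\<pi> k)"
        "\<lambda>k l. M (\<pi> k) (\<rho> l)" "\<lambda>k l. N (\<pi> k) (\<rho> l)"
        by (rule nine_quadratics_permute[OF nine \<pi>(1) \<rho>(1)])
      show False
        using Q.sum_le_16_if_lone \<rho> \<pi> jk(2) 1 \<sigma> large
          sum_permute_3[OF \<pi>(1) \<rho>(1), of "\<lambda>k l. card (N k l)"] by simp
    next
      case 2
      obtain \<pi> :: "3 \<Rightarrow> 3" where \<pi>: "bij \<pi>" "\<pi> 1 = i" "\<pi> 2 = k" "\<pi> 3 = j"
        by (rule permutation_3[of i k j]) (use jk in auto)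
      \<comment> \<open>Negation reverses the order, so the labels of the second triangle are
        reversed to keep it sorted.\<close>
      have "\<rho> 3 \<noteq> \<rho> 2" "\<rho> 2 \<noteq> \<rho> 1" "\<rho> 3 \<noteq> \<rho> 1" using \<rho> by auto
      then obtain \<rho>' :: "3 \<Rightarrow> 3" where \<rho>': "bij \<rho>'" "\<rho>' 1 = \<rho> 3" "\<rho>' 2 = \<rho> 2" "\<rho>' 3 = \<rho> 1"
        by (rule permutation_3)
      interpret Q: nine_quadratics "\<lambda>k. - \<theta> (\<pi> k)" "\<lambda>l. - \<tau> (\<rho>' l)" "\<lambda>k. \<sigma> (\<pi> k)"
        "\<lambda>k l. M (\<pi> k) (\<rho>' l)" "\<lambda>k l. uminus ` N (\<pi> k) (\<rho>' l)"
        by (rule nine_quadratics_permute[OF nine_quadratics_uminus[OF nine] \<pi>(1) \<rho>'(1)])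
      show False
        using Q.sum_le_16_if_lone \<rho> \<rho>' \<pi> jk(2) 2 \<sigma> large
          sum_permute_3[OF \<pi>(1) \<rho>'(1), of "\<lambda>k l. card (N k l)"] by (simp add: card_image)
    qed
  next
    case False
    have "\<sigma> 1 * \<sigma> 2 > 0" "\<sigma> 2 * \<sigma> 3 > 0" "\<sigma> 1 * \<sigma> 3 > 0"
      using False[unfolded not_ex, THEN spec, of 1, unfolded index_3]
        False[unfolded not_ex, THEN spec, of 2, unfolded index_3]
        False[unfolded not_ex, THEN spec, of 3, unfolded index_3]
        \<sigma>_nonzero[of 1] \<sigma>_nonzero[of 2] \<sigma>_nonzero[of 3]
      by (auto simp: mult_less_0_iff zero_less_mult_iff not_less order.order_iff_strict)
    \<comment> \<open>No edge passes through infinity now, so all arcs are intervals. The lower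
      \<theta>-interval paired with the upper \<tau>-interval, and the reverse pairing, cannot both
      have a common point.\<close>
    then have same: "\<sigma> i * \<sigma> j > 0" for i j
      using exhaust_3[of i] exhaust_3[of j] \<sigma>_nonzero[of i]
      by (auto simp: mult.commute zero_less_mult_iff)
    obtain \<pi> :: "3 \<Rightarrow> 3" where \<pi>: "bij \<pi>" "\<theta> (\<pi> 1) < \<theta> (\<pi> 2)" "\<theta> (\<pi> 2) < \<theta> (\<pi> 3)"
      by (rule sort_3[OF inj(1)])
    interpret Q: nine_quadratics "\<lambda>k. \<theta> (\<pi> k)" "\<lambda>l. \<tau> (\<rho> l)" "\<lambda>k. \<sigma> (\<pi> k)"
      "\<lambda>k l. M (\<pi> k) (\<rho> l)" "\<lambda>k l. N (\<pi> k) (\<rho> l)"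
      by (rule nine_quadratics_permute[OF nine \<pi>(1) \<rho>(1)])
    have ins: "b < x \<and> x < c" if "s * ((b - x) * (c - x)) < 0" "s > 0" "b < c" for s b c x :: real
      using that by (auto simp: mult_less_0_iff zero_less_mult_iff)
    obtain x where x: "x \<in> N (\<pi> 3) (\<rho> 1)" using ne by blast
    obtain y where y: "y \<in> N (\<pi> 1) (\<rho> 3)" using ne by blast
    have "x < \<theta> (\<pi> 2)" "\<tau> (\<rho> 2) < x"
      using ins[OF Q.range_\<theta>[OF x, unfolded index_3] same] ins[of 1, OF _ _ \<rho>(3)]
        Q.range_\<tau>[OF x, unfolded index_3] \<pi> by auto
    moreover have "\<theta> (\<pi> 2) < y" "y < \<tau> (\<rho> 2)"
      using ins[OF Q.range_\<theta>[OF y, unfolded index_3] same] ins[of 1, OF _ _ \<rho>(2)]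
        Q.range_\<tau>[OF y, unfolded index_3] \<pi> by auto
    ultimately show False by linarith
  qed
qed

section \<open>Triangles in general position\<close>

text \<open>General position with chosen vertices; a quadruple of edges becomes a function \<kappa>
  that selects an opposite vertex in each triangle.\<close>

locale general_triangles =
  fixes v :: "4 \<Rightarrow> 3 \<Rightarrow> real^3"
  assumes not_collinear: "\<And>i. \<not> collinear (range (v i))"
    and card_transversals: "\<And>\<kappa>. card (edge_transversals (\<lambda>i. tri_edge (v i) (\<kappa> i))) = 2"
    and disjoint_transversals: "\<And>\<kappa> \<kappa>'. \<kappa> \<noteq> \<kappa>' \<Longrightarrow>
      edge_transversals (\<lambda>i. tri_edge (v i) (\<kappa> i)) \<inter> edge_transversals (\<lambda>i. tri_edge (v i) (\<kappa>' i)) = {}"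
begin

lemma inj_v: "inj (v i)"
  using inj_if_not_collinear not_collinear by blast

lemma CP3_line_edge: "is_CP3_line (edge_line (v i) k)"
  by (rule CP3_line_edge_line[OF inj_v])

lemma edge_transversals_iff:
  "L \<in> edge_transversals (\<lambda>i. tri_edge (v i) (\<kappa> i)) \<longleftrightarrow>
     is_CP3_line L \<and> (\<forall>i. CP3_lines_meet L (edge_line (v i) (\<kappa> i)))"
  by (simp add: edge_transversals_def CP3_transversals_def CP3_line_of_tri_edge)

text \<open>Two edges of triangle \<open>i\<close> contain the vertex, so the line would be a
  transversal of two different quadruples.\<close>

lemma no_transversal_through_vertex:
  assumes "is_CP3_line L" "homogenize (v i x) \<in> L"
    and "\<And>j. j \<noteq> i \<Longrightarrow> CP3_lines_meet L (edge_line (v j) (\<kappa> j))"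
  shows False
proof -
  have "L \<in> edge_transversals (\<lambda>j. tri_edge (v j) ((\<kappa>(i := a)) j))" if "a = x + 1 \<or> a = x + 2" for a
    unfolding edge_transversals_iff
  proof (intro conjI allI)
    fix j show "CP3_lines_meet L (edge_line (v j) ((\<kappa>(i := a)) j))"
    proof (cases "j = i")
      case True
      have "homogenize (v i x) \<in> edge_line (v i) a" using that vertex_in_edge_line by blast
      then show ?thesis using CP3_lines_meetI[OF assms(1) CP3_line_edge assms(2)] True by simp
    qed (use assms(3) in simp)
  qed (rule assms(1))
  from this[of "x + 1"] this[of "x + 2"]
  have "L \<in> edge_transversals (\<lambda>j. tri_edge (v j) ((\<kappa>(i := x + 1)) j))
      \<inter> edge_transversals (\<lambda>j. tri_edge (v j) ((\<kappa>(i := x + 2)) j))" by blast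
  moreover have "\<kappa>(i := x + 1) \<noteq> \<kappa>(i := x + 2)" by (metis fun_upd_same index_add_3(9))
  ultimately show False using disjoint_transversals by blast
qed

lemma four_indices:
  assumes "distinct [i, j, k, m :: 4]"
  shows "l = i \<or> l = j \<or> l = k \<or> l = m"
proof -
  have "card {i, j, k, m} = CARD(4)" using assms by auto
  then have "{i, j, k, m} = UNIV" by (intro card_eq_UNIV_imp_eq_UNIV) auto
  then show ?thesis using UNIV_I[of l] by blast
qed

lemma no_transversal_through_vertex_3:
  assumes "distinct [i, j, k, m]" "is_CP3_line L" "homogenize (v i x) \<in> L"
    and "CP3_lines_meet L (edge_line (v j) d)" "CP3_lines_meet L (edge_line (v k) c)"
    and "CP3_lines_meet L (edge_line (v m) b)"
  shows False
proof (rule no_transversal_through_vertex[OF assms(2,3)])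
  fix l assume "l \<noteq> i"
  then show "CP3_lines_meet L (edge_line (v l) (((\<lambda>_. d)(k := c, m := b)) l))"
    using four_indices[OF assms(1), of l] assms by auto
qed

text \<open>The line joining the vertex to the point \<open>h\<close> would be a forbidden
  transversal. If \<open>h\<close> represents the vertex itself, that vertex lies on the edge line
  of triangle \<open>j\<close>, and any line through it that meets the two remaining edge lines
  gives the contradiction.\<close>

lemma no_transversal_vertex_point:
  assumes ijkm: "distinct [i, j, k, m]"
    and h: "h \<noteq> 0" "h \<in> edge_line (v j) d"
    and dim: "vec.dim (edge_line (v k) c \<union> {homogenize (v i x), h}) \<le> 3"
      "vec.dim (edge_line (v m) b \<union> {homogenize (v i x), h}) \<le> 3"
  shows False
proof -
  let ?y = "homogenize (v i x)"
  have meet: "CP3_lines_meet (vec.span {?y, h'}) (edge_line (v l) a)"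
    if "h' \<notin> vec.span {?y}" "g \<in> {?y, h'}" "g \<in> edge_line (v l) a" for h' g l a
  proof (rule CP3_lines_meetI[OF CP3_line_through CP3_line_edge])
    show "g \<noteq> 0" using that vec.span_zero by auto
    show "g \<in> vec.span {?y, h'}" using that(2) vec.span_superset by blast
  qed (use that in auto)
  note contra = no_transversal_through_vertex_3[OF ijkm CP3_line_through]
  have y: "?y \<in> vec.span {?y, h'}" for h' by (simp add: vec.span_base)
  show False
  proof (cases "h \<in> vec.span {?y}")
    case False
    then show False
      using contra[of ?y h x d c b] y meet[OF False _ h(2)] CP3_line_through_meets[OF _ False] dim
        CP3_line_edge by auto
  next
    case True
    then obtain a where a: "h = a *s ?y" by (auto simp: vec.span_singleton)
    with h(1) have "?y = inverse a *s h" by auto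
    then have yd: "?y \<in> edge_line (v j) d"
      using h(2) CP3_line_edge[of j d] vec.subspace_scale unfolding is_CP3_line_def by metis
    show False
    proof (cases "?y \<in> edge_line (v k) c")
      case True
      have "\<not> edge_line (v m) b \<subseteq> vec.span {?y}"
      proof
        assume "edge_line (v m) b \<subseteq> vec.span {?y}"
        then have "vec.dim (edge_line (v m) b) \<le> vec.dim {?y}"
          by (metis vec.dim_span vec.dim_subset)
        moreover have "vec.dim {?y} \<le> 1" by (simp add: vec.dim_singleton)
        ultimately show False using CP3_line_edge[of m b] by (simp add: is_CP3_line_def)
      qed
      then obtain h' where h': "h' \<in> edge_line (v m) b" "h' \<notin> vec.span {?y}" by blast
      show False
        using contra[of ?y h' x d c b] y h' meet[OF h'(2) _ yd] meet[OF h'(2) _ True]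
          meet[OF h'(2) _ h'(1)] by auto
    next
      case False
      obtain h' where h': "h' \<notin> vec.span {?y}" "vec.dim (edge_line (v m) b \<union> {?y, h'}) \<le> 3"
          "vec.dim (edge_line (v k) c \<union> {?y, h'}) \<le> 3"
        using ex_meeting_point[OF False CP3_line_edge CP3_line_edge] by blast
      show False
        using contra[of ?y h' x d c b] y h' meet[OF h'(1) _ yd] CP3_line_through_meets[OF _ h'(1)]
          CP3_line_edge by auto
    qed
  qed
qed

definition edge_vol :: "4 \<Rightarrow> 3 \<Rightarrow> real^3 \<Rightarrow> real^3 \<Rightarrow> real" where
  "edge_vol k c = line_vol (v k (c + 1)) (v k (c + 2) - v k (c + 1))"

text \<open>\<alpha> and \<beta> are homogeneous coordinates of a point of an edge line of triangle
  \<open>j\<close>. The equations put the line joining it to the vertex into a plane with each of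
  the two other edge lines. In this form general position makes the values of the quadratics at
  vertices nonzero.\<close>

lemma edge_vol_vertex:
  assumes "distinct [i, j, k, m]" "\<alpha> \<noteq> 0 \<or> \<beta> \<noteq> 0"
    and "\<alpha> * edge_vol k c (v i x) (v j (d + 1)) + \<beta> * edge_vol k c (v i x) (v j (d + 2)) = 0"
    and "\<alpha> * edge_vol m b (v i x) (v j (d + 1)) + \<beta> * edge_vol m b (v i x) (v j (d + 2)) = 0"
  shows False
proof -
  let ?h = "of_real \<alpha> *s homogenize (v j (d + 1)) + of_real \<beta> *s homogenize (v j (d + 2))"
  have "?h \<noteq> 0"
    by (rule homogenize_comb_nonzero[OF _ assms(2)]) (simp add: inj_eq[OF inj_v])
  moreover have "?h \<in> edge_line (v j) d"
    by (auto simp: edge_line_def intro!: vec.span_add vec.span_scale intro: vec.span_base)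
  ultimately show False
    using no_transversal_vertex_point[OF assms(1)] dim_edge_line_le_3[OF inj_v] assms(3,4)
    unfolding edge_vol_def by blast
qed

text \<open>Homogeneous coordinates cover an edge line parallel to the plane, where the common point
  is at infinity.\<close>

lemma ex_real_plane_point:
  obtains h where "h \<noteq> 0" "h \<in> edge_line (v k) c" "h \<in> real_plane a e"
proof -
  define s where "s = a \<bullet> v k (c + 1) - e"
  define s' where "s' = a \<bullet> v k (c + 2) - e"
  obtain \<alpha> \<beta> :: real where ab: "\<alpha> \<noteq> 0 \<or> \<beta> \<noteq> 0" "\<alpha> * s + \<beta> * s' = 0"
  proof (cases "s = 0")
    case False
    then show ?thesis using that[of s' "- s"] by auto
  qed (use that[of 1 0] in auto)
  let ?h = "of_real \<alpha> *s homogenize (v k (c + 1)) + of_real \<beta> *s homogenize (v k (c + 2))"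
  show thesis
  proof (rule that)
    show "?h \<noteq> 0"
      by (rule homogenize_comb_nonzero[OF _ ab(1)]) (simp add: inj_eq[OF inj_v])
    show "?h \<in> edge_line (v k) c"
      by (auto simp: edge_line_def intro!: vec.span_add vec.span_scale intro: vec.span_base)
    have "complex_of_real (\<alpha> * s + \<beta> * s') = 0" using ab by simp
    then show "?h \<in> real_plane a e"
      by (simp add: real_plane_def s_def s'_def inner_vec_def sum_3 algebra_simps)
  qed
qed

lemma ex_two_more_indices:
  assumes "i \<noteq> (j :: 4)"
  obtains k m where "distinct [i, j, k, m]"
proof -
  have "card (UNIV - {i, j}) = 2" using assms by (simp add: card_Diff_subset)
  then obtain k m where "UNIV - {i, j} = {k, m}" "k \<noteq> m" by (auto simp: card_2_iff)
  then have "distinct [i, j, k, m]" using assms by auto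
  then show thesis by (rule that)
qed

text \<open>In a common plane, join points of that plane on edge lines of the two other triangles:
  this line meets every edge line of both coplanar triangles and is thus a transversal of several
  quadruples.\<close>

lemma not_coplanar:
  assumes "i \<noteq> j" "a \<noteq> 0" "\<And>x. a \<bullet> v i x = e" "\<And>x. a \<bullet> v j x = e"
  shows False
proof -
  obtain k m where ijkm: "distinct [i, j, k, m]"
    using ex_two_more_indices[OF assms(1)] by blast
  let ?W = "real_plane a e"
  obtain h where h: "h \<noteq> 0" "h \<in> edge_line (v k) 1" "h \<in> ?W" by (rule ex_real_plane_point)
  obtain h' where h': "h' \<noteq> 0" "h' \<in> edge_line (v m) 1" "h' \<in> ?W" by (rule ex_real_plane_point)
  have vW: "homogenize (v i x) \<in> ?W" "homogenize (v j x) \<in> ?W" for x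
    by (simp_all add: homogenize_in_real_plane assms)
  \<comment> \<open>If \<open>h\<close> and \<open>h'\<close> are the same projective point, any
    second point of the plane completes the line.\<close>
  obtain g where g: "g \<notin> vec.span {h}" "g \<in> ?W" "h' \<in> vec.span {h, g}"
  proof (cases "h' \<in> vec.span {h}")
    case True
    have "\<not> edge_line (v i) 1 \<subseteq> vec.span {h}"
    proof
      assume "edge_line (v i) 1 \<subseteq> vec.span {h}"
      then have "vec.dim (edge_line (v i) 1) \<le> vec.dim {h}"
        by (metis vec.dim_span vec.dim_subset)
      moreover have "vec.dim {h} \<le> 1" by (simp add: vec.dim_singleton)
      ultimately show False using CP3_line_edge[of i 1] by (simp add: is_CP3_line_def)
    qed
    then obtain g where "g \<in> edge_line (v i) 1" "g \<notin> vec.span {h}" by blast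
    moreover have "edge_line (v i) 1 \<subseteq> ?W"
      unfolding edge_line_def by (rule vec.span_minimal) (simp_all add: vW subspace_real_plane)
    moreover have "vec.span {h} \<subseteq> vec.span {h, g}" by (rule vec.span_mono) auto
    ultimately show ?thesis using that[of g] True by blast
  next
    case False
    then show ?thesis using that[of h'] h' by (simp add: vec.span_base)
  qed
  let ?L = "vec.span {h, g}"
  have L: "is_CP3_line ?L" by (rule CP3_line_through[OF h(1) g(1)])
  have LW: "?L \<subseteq> ?W" by (rule vec.span_minimal) (use g h subspace_real_plane in auto)
  have meet: "CP3_lines_meet ?L (edge_line (v l) x)" if "l = i \<or> l = j" for l x
  proof (rule CP3_lines_meet_if_dim_le_3[OF L CP3_line_edge dim_subset_real_plane[OF assms(2)]])
    have "edge_line (v l) x \<subseteq> ?W"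
      unfolding edge_line_def by (rule vec.span_minimal) (use that vW subspace_real_plane in auto)
    then show "?L \<union> edge_line (v l) x \<subseteq> ?W" using LW by blast
  qed
  have "?L \<in> edge_transversals (\<lambda>l. tri_edge (v l) (((\<lambda>_. 1)(i := x)) l))" for x
    unfolding edge_transversals_iff
  proof (intro conjI allI L)
    fix l
    have "CP3_lines_meet ?L (edge_line (v k) 1)"
      by (rule CP3_lines_meetI[OF L CP3_line_edge _ h(2,1)]) (simp add: vec.span_base)
    moreover have "CP3_lines_meet ?L (edge_line (v m) 1)"
      by (rule CP3_lines_meetI[OF L CP3_line_edge g(3) h'(2,1)])
    ultimately show "CP3_lines_meet ?L (edge_line (v l) (((\<lambda>_. 1)(i := x)) l))"
      using meet four_indices[OF ijkm, of l] by auto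
  qed
  from this[of 1] this[of 2]
  have "edge_transversals (\<lambda>l. tri_edge (v l) (((\<lambda>_. 1)(i := 1)) l))
      \<inter> edge_transversals (\<lambda>l. tri_edge (v l) (((\<lambda>_. 1)(i := 2)) l)) \<noteq> {}" by blast
  moreover have "(\<lambda>_. 1)(i := 1) \<noteq> ((\<lambda>_. 1)(i := 2) :: 4 \<Rightarrow> 3)"
    by (metis fun_upd_same index_add_3(5) one_add_one)
  ultimately show False using disjoint_transversals by blast
qed

end

section \<open>Supporting lines meeting another triangle\<close>

lemma barycentric_unique:
  fixes a b c :: "real^3"
  assumes "\<not> collinear {a, b, c}" "p + q + r = 0" "p *\<^sub>R a + q *\<^sub>R b + r *\<^sub>R c = 0"
  shows "p = 0" "q = 0" "r = 0"
proof -
  have p: "p = - q - r" using assms(2) by simp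
  have eq: "q *\<^sub>R (b - a) + r *\<^sub>R (c - a) = 0"
    using assms(3) unfolding p by (simp add: algebra_simps)
  have nc: "\<not> collinear {0, b - a, c - a}"
    using assms(1) collinear_3[of b a c] by (simp add: insert_commute)
  have "q = 0"
  proof (rule ccontr)
    assume q: "q \<noteq> 0"
    have "q *\<^sub>R (b - a) = - (r *\<^sub>R (c - a))" using eq by (simp add: eq_neg_iff_add_eq_0)
    then have "inverse q *\<^sub>R (q *\<^sub>R (b - a)) = inverse q *\<^sub>R (- (r *\<^sub>R (c - a)))" by simp
    then have "b - a = (- r / q) *\<^sub>R (c - a)" using q by (simp add: divide_inverse mult.commute)
    then have "collinear {0, c - a, b - a}" unfolding collinear_lemma by blast
    with nc show False by (simp add: insert_commute)
  qed
  moreover have "c - a \<noteq> 0" using nc by (auto simp: insert_commute collinear_2)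
  ultimately show "q = 0" "r = 0" using eq by simp_all
  then show "p = 0" using p by simp
qed

text \<open>A form of Menelaus' theorem.\<close>

lemma line_misses_triangle:
  fixes a b c :: "real^3"
  assumes nc: "\<not> collinear {a, b, c}"
    and y: "y1 \<in> affine hull {a, b}" "y2 \<in> affine hull {b, c}"
    and out: "y1 \<notin> convex hull {a, b, c}" "y2 \<notin> convex hull {a, b, c}"
    and z: "z \<in> convex hull {a, b, c}" "collinear {y1, y2, z}"
  shows False
proof -
  obtain s1 s2 where y1: "y1 = s1 *\<^sub>R a + s2 *\<^sub>R b" "s1 + s2 = 1"
    using y(1) by (auto simp: affine_hull_2)
  obtain r1 r2 where y2: "y2 = r1 *\<^sub>R b + r2 *\<^sub>R c" "r1 + r2 = 1"
    using y(2) by (auto simp: affine_hull_2)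
  obtain \<alpha> \<beta> \<gamma> where zz: "z = \<alpha> *\<^sub>R a + \<beta> *\<^sub>R b + \<gamma> *\<^sub>R c" "\<alpha> \<ge> 0" "\<beta> \<ge> 0" "\<gamma> \<ge> 0" "\<alpha> + \<beta> + \<gamma> = 1"
    using z(1) by (auto simp: convex_hull_3)
  have s: "s1 < 0 \<or> s2 < 0"
  proof (rule ccontr)
    assume "\<not> ?thesis"
    then have "\<exists>u v w. y1 = u *\<^sub>R a + v *\<^sub>R b + w *\<^sub>R c \<and> 0 \<le> u \<and> 0 \<le> v \<and> 0 \<le> w \<and> u + v + w = 1"
    proof -
      assume "\<not> (s1 < 0 \<or> s2 < 0)"
      then have "y1 = s1 *\<^sub>R a + s2 *\<^sub>R b + 0 *\<^sub>R c \<and> 0 \<le> s1 \<and> 0 \<le> s2 \<and> 0 \<le> (0::real) \<and> s1 + s2 + 0 = 1"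
        using y1 by simp
      then show ?thesis by blast
    qed
    then have "y1 \<in> convex hull {a, b, c}" unfolding convex_hull_3 by blast
    then show False using out by blast
  qed
  have r: "r1 < 0 \<or> r2 < 0"
  proof (rule ccontr)
    assume "\<not> ?thesis"
    then have "\<exists>u v w. y2 = u *\<^sub>R a + v *\<^sub>R b + w *\<^sub>R c \<and> 0 \<le> u \<and> 0 \<le> v \<and> 0 \<le> w \<and> u + v + w = 1"
    proof -
      assume "\<not> (r1 < 0 \<or> r2 < 0)"
      then have "y2 = 0 *\<^sub>R a + r1 *\<^sub>R b + r2 *\<^sub>R c \<and> 0 \<le> (0::real) \<and> 0 \<le> r1 \<and> 0 \<le> r2 \<and> 0 + r1 + r2 = 1"
        using y2 by simp
      then show ?thesis by blast
    qed
    then have "y2 \<in> convex hull {a, b, c}" unfolding convex_hull_3 by blast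
    then show False using out by blast
  qed
  have "y1 \<noteq> y2"
  proof
    assume "y1 = y2"
    then have "s1 *\<^sub>R a + (s2 - r1) *\<^sub>R b + (- r2) *\<^sub>R c = 0"
      using y1 y2 by (simp add: algebra_simps)
    moreover have "s1 + (s2 - r1) + (- r2) = 0" using y1 y2 by simp
    ultimately have "s1 = 0" using barycentric_unique[OF nc] by blast
    then show False using s y1 by simp
  qed
  then obtain \<mu> where l: "z = (1 - \<mu>) *\<^sub>R y1 + \<mu> *\<^sub>R y2"
  proof -
    have "collinear {0, y2 - y1, z - y1}"
      using z(2) collinear_3[of y2 y1 z] by (simp add: insert_commute)
    then obtain \<mu> where "z - y1 = \<mu> *\<^sub>R (y2 - y1)"
      using \<open>y1 \<noteq> y2\<close> unfolding collinear_lemma by (auto intro: that[of 0])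
    then show thesis using that[of \<mu>] by (simp add: algebra_simps)
  qed
  have "(\<alpha> - (1 - \<mu>) * s1) *\<^sub>R a + (\<beta> - (1 - \<mu>) * s2 - \<mu> * r1) *\<^sub>R b + (\<gamma> - \<mu> * r2) *\<^sub>R c = 0"
    using l unfolding zz(1) y1(1) y2(1) by (simp add: algebra_simps)
  moreover have "(\<alpha> - (1 - \<mu>) * s1) + (\<beta> - (1 - \<mu>) * s2 - \<mu> * r1) + (\<gamma> - \<mu> * r2) = 0"
  proof -
    have "(1 - \<mu>) * (s1 + s2) + \<mu> * (r1 + r2) = 1" by (simp add: y1 y2)
    then show ?thesis using zz(5) by (simp add: algebra_simps)
  qed
  ultimately have "\<alpha> - (1 - \<mu>) * s1 = 0" "\<beta> - (1 - \<mu>) * s2 - \<mu> * r1 = 0" "\<gamma> - \<mu> * r2 = 0"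
    by (rule barycentric_unique[OF nc, rotated])+
  then have co: "\<alpha> = (1 - \<mu>) * s1" "\<beta> = (1 - \<mu>) * s2 + \<mu> * r1" "\<gamma> = \<mu> * r2"
    by linarith+
  \<comment> \<open>Nonnegativity of \<alpha> and \<gamma> restricts \<mu> in each sign pattern so
    that \<beta> becomes negative.\<close>
  show False
  proof (cases "s1 < 0")
    case True
    then have "\<mu> \<ge> 1" using co(1) zz(2) by (auto simp: zero_le_mult_iff)
    then have "r2 \<ge> 0" using co(3) zz(4) by (auto simp: zero_le_mult_iff)
    then have "\<mu> * r1 < 0" using r \<open>\<mu> \<ge> 1\<close> by (simp add: mult_less_0_iff)
    moreover have "(1 - \<mu>) * s2 \<le> 0" using \<open>\<mu> \<ge> 1\<close> True y1(2) by (simp add: mult_le_0_iff)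
    ultimately show False using co(2) zz(3) by linarith
  next
    case False
    then have "s2 < 0" "s1 > 0" using s y1(2) by auto
    then have l1: "\<mu> \<le> 1" using co(1) zz(2) by (auto simp: zero_le_mult_iff)
    show False
    proof (cases "r2 < 0")
      case True
      then have "\<mu> \<le> 0" using co(3) zz(4) by (auto simp: zero_le_mult_iff)
      then have "(1 - \<mu>) * s2 < 0" "\<mu> * r1 \<le> 0"
        using \<open>s2 < 0\<close> True y2(2) by (simp_all add: mult_less_0_iff mult_le_0_iff)
      then show False using co(2) zz(3) by linarith
    next
      case False
      then have "r1 < 0" "r2 > 0" using r y2(2) by auto
      then have "\<mu> \<ge> 0" using co(3) zz(4) by (auto simp: zero_le_mult_iff)
      have "(1 - \<mu>) * s2 \<le> 0" "\<mu> * r1 \<le> 0"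
        using \<open>s2 < 0\<close> \<open>r1 < 0\<close> l1 \<open>\<mu> \<ge> 0\<close> by (simp_all add: mult_le_0_iff)
      moreover have "(1 - \<mu>) * s2 \<noteq> 0 \<or> \<mu> * r1 \<noteq> 0"
        using \<open>s2 < 0\<close> \<open>r1 < 0\<close> by auto
      ultimately show False using co(2) zz(3) by linarith
    qed
  qed
qed

lemma affine_hull_eq_if_not_collinear:
  fixes S :: "(real^3) set"
  assumes "\<not> collinear T" "T \<subseteq> affine hull S" "finite S" "card S \<le> 3"
  shows "affine hull T = affine hull S"
proof (rule affine_dim_equal)
  show "affine hull T \<subseteq> affine hull S"
    using assms(2) by (simp add: hull_minimal)
  from aff_dim_subset[OF this] have "aff_dim T \<le> aff_dim S" by simp
  moreover have "aff_dim S \<le> 2"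
    using aff_dim_le_card[OF assms(3)] assms(4) by linarith
  moreover have "aff_dim T \<ge> 2"
    using assms(1) by (simp add: collinear_aff_dim)
  ultimately show "aff_dim (affine hull T) = aff_dim (affine hull S)" by simp
  show "affine hull T \<noteq> {}" using assms(1) by auto
qed simp_all

context general_triangles
begin

abbreviation tri :: "4 \<Rightarrow> (real^3) set" where
  "tri i \<equiv> convex hull (range (v i))"

definition line_meets :: "4 \<Rightarrow> 3 \<Rightarrow> 4 \<Rightarrow> bool" where
  "line_meets i a j \<longleftrightarrow> affine hull (tri_edge (v i) a) \<inter> tri j \<noteq> {}"

lemma range_v: "range (v i) = {v i (a + 1), v i (a + 2), v i a}"
  by (subst UNIV_3_shift[of a]) auto

lemma line_subset_plane: "affine hull (tri_edge (v i) a) \<subseteq> affine hull (range (v i))"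
proof -
  have "affine hull (tri_edge (v i) a) = affine hull {v i (a + 1), v i (a + 2)}"
    by (simp add: tri_edge_def affine_hull_closed_segment)
  also have "\<dots> \<subseteq> affine hull (range (v i))" by (rule hull_mono) auto
  finally show ?thesis .
qed

text \<open>Otherwise \<open>S\<close> spans both planes, which would then coincide.\<close>

lemma collinear_if_in_planes:
  assumes "i \<noteq> j" "S \<subseteq> affine hull (range (v i))" "S \<subseteq> affine hull (range (v j))"
  shows "collinear S"
proof (rule ccontr)
  assume nc: "\<not> collinear S"
  have card: "card (range (v l)) \<le> 3" for l
    using card_image_le[of UNIV "v l"] by simp
  have i: "affine hull S = affine hull (range (v i))"
    using affine_hull_eq_if_not_collinear[OF nc assms(2) _ card] by simp
  have j: "affine hull S = affine hull (range (v j))"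
    using affine_hull_eq_if_not_collinear[OF nc assms(3) _ card] by simp
  have "aff_dim (range (v i)) \<le> 2"
    using aff_dim_le_card[of "range (v i)"] card[of i] by simp
  moreover have "aff_dim (range (v i)) \<ge> 2"
    using not_collinear[of i] by (simp add: collinear_aff_dim)
  ultimately have "aff_dim (range (v i)) = int (DIM(real^3) - 1)" by simp
  then obtain a e where "a \<noteq> 0" "affine hull (range (v i)) = {x. a \<bullet> x = e}"
    using aff_dim_eq_hyperplane[of "range (v i)"] by auto
  then show False
    using not_coplanar[OF assms(1), of a e] i j hull_inc[of _ "range (v i)" affine]
      hull_inc[of _ "range (v j)" affine] by blast
qed

text \<open>The two points in triangle \<open>j\<close> and a point of the line \<open>d\<close> in
  triangle \<open>i\<close> lie in both planes, hence on one line. By disjointness the first two are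
  outside triangle \<open>i\<close>, so this line misses it.\<close>

lemma two_lines_meet:
  assumes "i \<noteq> j" "tri i \<inter> tri j = {}" "line_meets i a j" "line_meets i (a + 1) j"
  shows "\<not> line_meets j d i"
proof
  assume "line_meets j d i"
  then obtain z where z: "z \<in> affine hull (tri_edge (v j) d)" "z \<in> tri i"
    unfolding line_meets_def by blast
  obtain y1 where y1: "y1 \<in> affine hull (tri_edge (v i) a)" "y1 \<in> tri j"
    using assms(3) unfolding line_meets_def by blast
  obtain y2 where y2: "y2 \<in> affine hull (tri_edge (v i) (a + 1))" "y2 \<in> tri j"
    using assms(4) unfolding line_meets_def by blast
  have tri: "tri i = convex hull {v i (a + 1), v i (a + 2), v i a}"
    by (subst range_v[of i a]) (rule refl)
  have sub: "tri l \<subseteq> affine hull (range (v l))" for l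
    by (rule convex_hull_subset_affine_hull)
  have col: "collinear {y1, y2, z}"
    by (rule collinear_if_in_planes[OF assms(1)])
      (use y1 y2 z sub line_subset_plane in blast)+
  show False
  proof (rule line_misses_triangle[OF _ _ _ _ _ _ col])
    show "\<not> collinear {v i (a + 1), v i (a + 2), v i a}"
      using not_collinear[of i] unfolding range_v[of i a] .
    show "y1 \<in> affine hull {v i (a + 1), v i (a + 2)}" "y2 \<in> affine hull {v i (a + 2), v i a}"
      using y1 y2 by (simp_all add: tri_edge_def affine_hull_closed_segment)
  qed (use y1 y2 z assms(2) tri in auto)
qed

lemma two_lines_meet':
  assumes "i \<noteq> j" "tri i \<inter> tri j = {}" "line_meets i a j" "line_meets i b j" "a \<noteq> b"
  shows "\<not> line_meets j d i"
proof -
  have "b = a + 1 \<or> b = a + 2"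
    using assms(5) UNIV_I[of b] unfolding UNIV_3_shift[of a] by auto
  then show ?thesis
    using two_lines_meet[OF assms(1-3)] two_lines_meet[OF assms(1,2,4)] assms(3,4) by auto
qed

text \<open>Otherwise each of the twelve supporting lines meets at least two other triangles, giving
  24 incidences. For a pair of triangles, two incidences in one direction exclude all in the other,
  so at most 3 occur per pair and 18 altogether.\<close>

lemma ex_line_missing_two:
  assumes disj: "\<And>i j. i \<noteq> j \<Longrightarrow> tri i \<inter> tri j = {}"
  obtains i j k c where "i \<noteq> j" "i \<noteq> k" "j \<noteq> k" "\<not> line_meets k c i" "\<not> line_meets k c j"
proof (rule ccontr)
  assume "\<not> thesis"
  with that have H: "line_meets k c i \<or> line_meets k c j" if "i \<noteq> j" "i \<noteq> k" "j \<noteq> k" for i j k c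
    using \<open>i \<noteq> j\<close> \<open>i \<noteq> k\<close> \<open>j \<noteq> k\<close> by blast
  define g where "g k j c = (if k \<noteq> j \<and> line_meets k c j then 1 else 0 :: nat)" for k j c
  define S where "S = (\<Sum>k\<in>UNIV. \<Sum>j\<in>UNIV. \<Sum>c\<in>UNIV. g k j c)"
  have lower: "(\<Sum>j\<in>UNIV. g k j c) \<ge> 2" for k c
    using exhaust_4[of k] H[of 1 2 k c] H[of 1 3 k c] H[of 1 4 k c] H[of 2 3 k c] H[of 2 4 k c] H[of 3 4 k c]
    by (elim disjE) (simp_all add: sum_4 g_def, auto)
  have "S = (\<Sum>k\<in>UNIV. \<Sum>c\<in>UNIV. \<Sum>j\<in>UNIV. g k j c)"
    unfolding S_def by (intro sum.cong refl sum.swap)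
  also have "\<dots> \<ge> (\<Sum>k\<in>(UNIV::4 set). \<Sum>c\<in>(UNIV::3 set). 2)"
    by (intro sum_mono lower)
  finally have "S \<ge> 24" by simp
  have upper: "(\<Sum>c\<in>UNIV. g k j c) + (\<Sum>c\<in>UNIV. g j k c) \<le> (if k = j then 0 else 3)" for k j
  proof (cases "k = j")
    case False
    have "g j k d = 0" if "g k j a = 1" "g k j b = 1" "a \<noteq> b" for k j a b d
    proof -
      have "k \<noteq> j" "line_meets k a j" "line_meets k b j"
        using that(1,2) unfolding g_def by (metis zero_neq_one)+
      then have "\<not> line_meets j d k" using two_lines_meet'[OF _ disj _ _ that(3)] by blast
      then show ?thesis by (simp add: g_def)
    qed
    note zero = this
    have g01: "g k j c \<le> 1" for k j c by (simp add: g_def)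
    have le3: "(\<Sum>c\<in>UNIV. g k j c) \<le> 3" for k j
      using g01[of k j 1] g01[of k j 2] g01[of k j 3] by (simp add: sum_3)
    have "(\<Sum>c\<in>UNIV. g k j c) \<le> 1 \<or> (\<Sum>c\<in>UNIV. g j k c) = 0" for k j
    proof (cases "\<exists>a b. a \<noteq> b \<and> g k j a = 1 \<and> g k j b = 1")
      case True
      then show ?thesis using zero by (metis sum.neutral)
    next
      case False
      then have "\<not> (g k j 1 = 1 \<and> g k j 2 = 1)" "\<not> (g k j 1 = 1 \<and> g k j 3 = 1)"
        "\<not> (g k j 2 = 1 \<and> g k j 3 = 1)"
        by (metis index_3(1) index_add_3(7), metis index_3(2) index_add_3(8), metis index_3(3) index_add_3(7))
      then have "(\<Sum>c\<in>UNIV. g k j c) \<le> 1"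
        unfolding sum_3 using g01[of k j 1] g01[of k j 2] g01[of k j 3] by linarith
      then show ?thesis ..
    qed
    from this[of k j] this[of j k] le3[of k j] le3[of j k] show ?thesis
      using False by (simp, linarith)
  qed (simp add: g_def)
  \<comment> \<open>Ordered pairs count everything twice: 12 pairs with at most 3 incidences
    each.\<close>
  have "S + S = (\<Sum>k\<in>UNIV. \<Sum>j\<in>UNIV. (\<Sum>c\<in>UNIV. g k j c) + (\<Sum>c\<in>UNIV. g j k c))"
    unfolding sum.distrib S_def
    using sum.swap[of "\<lambda>k j. \<Sum>c\<in>UNIV. g k j c" UNIV UNIV] by simp
  also have "\<dots> \<le> (\<Sum>k\<in>(UNIV::4 set). \<Sum>j\<in>(UNIV::4 set). (if k = j then 0 else 3))"
    by (intro sum_mono upper)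
  also have "\<dots> = 36" by (simp add: sum_4)
  finally show False using \<open>S \<ge> 24\<close> by linarith
qed

end

section \<open>Lines meeting two triangles and two fixed lines\<close>

lemma line_vol_affine:
  assumes "u + w = 1"
  shows "line_vol z m (u *\<^sub>R p + w *\<^sub>R p') q = u * line_vol z m p q + w * line_vol z m p' q"
    "line_vol z m q (u *\<^sub>R p + w *\<^sub>R p') = u * line_vol z m q p + w * line_vol z m q p'"
proof -
  have w: "w = 1 - u" using assms by simp
  show "line_vol z m q (u *\<^sub>R p + w *\<^sub>R p') = u * line_vol z m q p + w * line_vol z m q p'"
    unfolding line_vol_eq_inner w by (simp add: inner_simps algebra_simps)
  then show "line_vol z m (u *\<^sub>R p + w *\<^sub>R p') q = u * line_vol z m p q + w * line_vol z m p' q"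
    unfolding line_vol_def cross_skew[of _ "q - z"] by simp
qed

lemma line_vol_commute: "line_vol z m p q = - line_vol z m q p"
  unfolding line_vol_def by (subst cross_skew) simp

lemma line_vol_self [simp]: "line_vol z m p p = 0"
  by (simp add: line_vol_def)

text \<open>A common point makes \<open>s *\<^sub>R m\<close> a combination of \<open>p - z\<close>
  and \<open>q - z\<close>, hence orthogonal to their cross product. For \<open>s = 0\<close> the
  point \<open>z\<close> itself is on the line, and the cross product vanishes.\<close>

lemma line_vol_eq_0_if_meets:
  assumes "z + s *\<^sub>R m = p + t *\<^sub>R (q - p)"
  shows "line_vol z m p q = 0"
proof -
  define X where "X = cross3 (p - z) (q - z)"
  have sm: "s *\<^sub>R m = (1 - t) *\<^sub>R (p - z) + t *\<^sub>R (q - z)"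
    using assms by (simp add: algebra_simps)
  have "s * (m \<bullet> X) = ((1 - t) *\<^sub>R (p - z) + t *\<^sub>R (q - z)) \<bullet> X"
    by (simp flip: sm)
  also have "\<dots> = 0" by (simp add: inner_left_distrib X_def dot_cross_self)
  finally have "s = 0 \<or> m \<bullet> X = 0" by simp
  moreover have "X = 0" if "s = 0"
  proof -
    have 0: "(1 - t) *\<^sub>R (p - z) + t *\<^sub>R (q - z) = 0" using sm that by simp
    have "(1 - t) *\<^sub>R X = cross3 ((1 - t) *\<^sub>R (p - z) + t *\<^sub>R (q - z)) (q - z)"
      by (simp add: X_def cross_add_left cross_mult_left)
    then have "(1 - t) *\<^sub>R X = 0" using 0 by simp
    moreover have "t *\<^sub>R X = cross3 (p - z) ((1 - t) *\<^sub>R (p - z) + t *\<^sub>R (q - z))"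
      by (simp add: X_def cross_add_right cross_mult_right)
    then have "t *\<^sub>R X = 0" using 0 by simp
    ultimately show "X = 0" by auto
  qed
  ultimately show ?thesis by (auto simp: line_vol_def X_def)
qed

lemma on_line_if_cross_eq_0:
  assumes "cross3 m x = 0" "m \<noteq> (0::real^3)"
  obtains s where "x = s *\<^sub>R m"
proof -
  have "\<exists>s. x = s *\<^sub>R m"
    using assms unfolding cross_eq_0 collinear_lemma by (auto intro: exI[of _ 0])
  then show thesis using that by blast
qed

lemma triple_eq_0_if_orthogonal:
  fixes a x y z :: "real^3"
  assumes "a \<noteq> 0" "a \<bullet> x = 0" "a \<bullet> y = 0" "a \<bullet> z = 0"
  shows "x \<bullet> cross3 y z = 0"
proof -
  have "cross3 a (cross3 y z) = 0" using assms by (simp add: Lagrange)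
  then obtain s where "cross3 y z = s *\<^sub>R a" using on_line_if_cross_eq_0 assms(1) by blast
  then show ?thesis using assms(2) by (simp add: inner_commute)
qed

text \<open>The plane through the axis and \<open>p\<close> is determined, with normal
  \<open>cross3 m (p - z)\<close>, and contains both \<open>q\<close> and \<open>r\<close>.\<close>

lemma line_vol_trans:
  assumes "m \<noteq> 0" "\<And>s. p \<noteq> z + s *\<^sub>R m" "line_vol z m p q = 0" "line_vol z m p r = 0"
  shows "line_vol z m q r = 0"
  unfolding line_vol_def
proof (rule triple_eq_0_if_orthogonal)
  show "cross3 m (p - z) \<noteq> 0"
  proof
    assume "cross3 m (p - z) = 0"
    then obtain s where "p - z = s *\<^sub>R m" using on_line_if_cross_eq_0 assms(1) by blast
    then have "p = z + s *\<^sub>R m" by (simp add: algebra_simps)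
    then show False using assms(2) by blast
  qed
  show "cross3 m (p - z) \<bullet> m = 0" by (simp add: inner_commute dot_cross_self)
  show "cross3 m (p - z) \<bullet> (q - z) = 0" "cross3 m (p - z) \<bullet> (r - z) = 0"
    using assms(3,4) by (simp_all add: line_vol_eq_inner)
qed

lemma is_line_through:
  assumes "is_line l" "p \<in> l" "q \<in> l" "p \<noteq> q"
  shows "l = affine hull {p, q}"
proof -
  have "affine hull {p, q} = l"
  proof (rule affine_dim_equal)
    show "affine hull {p, q} \<subseteq> l" using assms by (simp add: is_line_def hull_minimal)
    show "aff_dim (affine hull {p, q}) = aff_dim l" using assms by (simp add: is_line_def aff_dim_2)
  qed (use assms in \<open>auto simp: is_line_def\<close>)
  then show ?thesis by simp
qed

lemma affine_hull_2_point:
  assumes "x \<in> affine hull {p, q}"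
  obtains t where "x = p + t *\<^sub>R (q - p)"
proof -
  obtain u w where "x = u *\<^sub>R p + w *\<^sub>R q" "u + w = 1" using assms by (auto simp: affine_hull_2)
  then have "x = p + w *\<^sub>R (q - p)" by (simp add: algebra_simps flip: scaleR_add_left)
  then show thesis by (rule that)
qed

section \<open>The pencil of planes through a fixed line\<close>

lemma tri_edge_subset: "tri_edge v a \<subseteq> convex hull (range v)"
  unfolding tri_edge_def segment_convex_hull by (rule hull_mono) auto

lemma tri_edgeE:
  assumes "p \<in> tri_edge v a"
  obtains u where "0 \<le> u" "u \<le> 1" "p = (1 - u) *\<^sub>R v (a + 1) + u *\<^sub>R v (a + 2)"
  using assms unfolding tri_edge_def in_segment by blast

text \<open>The axis has base point \<open>c\<close> and direction \<open>d\<close>; the second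
  fixed line has \<open>z\<close> and \<open>m\<close>; \<open>v\<close> and \<open>w\<close> are
  the two triangles off the axis. \<open>vertex_v\<close> and \<open>vertex_w\<close> express
  general position: at a vertex, two linear forms in the homogeneous coordinates of an edge line
  have no common zero.\<close>

locale pencil =
  fixes v w :: "3 \<Rightarrow> real^3" and c d z m :: "real^3" and S :: "3 \<Rightarrow> 3 \<Rightarrow> (real^3) set set"
  assumes d_nonzero: "d \<noteq> 0"
    and disjoint: "convex hull (range v) \<inter> convex hull (range w) = {}"
    and v_off_axis: "\<And>p s. p \<in> convex hull (range v) \<Longrightarrow> p \<noteq> c + s *\<^sub>R d"
    and w_off_axis: "\<And>p s. p \<in> convex hull (range w) \<Longrightarrow> p \<noteq> c + s *\<^sub>R d"
    and finite_S: "\<And>a b. finite (S a b)" and card_S: "\<And>a b. card (S a b) \<le> 2"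
    and S_line: "\<And>a b l. l \<in> S a b \<Longrightarrow> is_line l"
    and S_v: "\<And>a b l. l \<in> S a b \<Longrightarrow> l \<inter> tri_edge v a \<noteq> {}"
    and S_w: "\<And>a b l. l \<in> S a b \<Longrightarrow> l \<inter> tri_edge w b \<noteq> {}"
    and S_axis: "\<And>a b l. l \<in> S a b \<Longrightarrow> \<exists>s. c + s *\<^sub>R d \<in> l"
    and S_line2: "\<And>a b l. l \<in> S a b \<Longrightarrow> \<exists>s. z + s *\<^sub>R m \<in> l"
    and vertex_v: "\<And>\<alpha> \<beta> i b. \<alpha> \<noteq> 0 \<or> \<beta> \<noteq> 0 \<Longrightarrow>
      \<alpha> * line_vol c d (v i) (w (b + 1)) + \<beta> * line_vol c d (v i) (w (b + 2)) = 0 \<Longrightarrow>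
      \<alpha> * line_vol z m (v i) (w (b + 1)) + \<beta> * line_vol z m (v i) (w (b + 2)) = 0 \<Longrightarrow> False"
    and vertex_w: "\<And>\<alpha> \<beta> j a. \<alpha> \<noteq> 0 \<or> \<beta> \<noteq> 0 \<Longrightarrow>
      \<alpha> * line_vol c d (w j) (v (a + 1)) + \<beta> * line_vol c d (w j) (v (a + 2)) = 0 \<Longrightarrow>
      \<alpha> * line_vol z m (w j) (v (a + 1)) + \<beta> * line_vol z m (w j) (v (a + 2)) = 0 \<Longrightarrow> False"
begin

lemma S_points:
  assumes "l \<in> S a b"
  obtains p q where "p \<in> tri_edge v a" "q \<in> tri_edge w b" "p \<in> l" "q \<in> l" "p \<noteq> q" "l = affine hull {p, q}"
    "line_vol c d p q = 0" "line_vol z m p q = 0"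
proof -
  obtain p q where pq: "p \<in> tri_edge v a" "q \<in> tri_edge w b" "p \<in> l" "q \<in> l"
    using S_v[OF assms] S_w[OF assms] by blast
  then have "p \<noteq> q" using disjoint tri_edge_subset by blast
  then have l: "l = affine hull {p, q}" using is_line_through S_line[OF assms] pq by blast
  have "line_vol c d p q = 0" "line_vol z m p q = 0"
    using S_axis[OF assms] S_line2[OF assms] unfolding l
    by (metis affine_hull_2_point line_vol_eq_0_if_meets)+
  then show thesis using that pq \<open>p \<noteq> q\<close> l by blast
qed

lemma vertex_v_point:
  assumes "q \<in> tri_edge w b" "line_vol c d (v i) q = 0" "line_vol z m (v i) q = 0"
  shows False
proof -
  obtain u where "q = (1 - u) *\<^sub>R w (b + 1) + u *\<^sub>R w (b + 2)"
    using assms(1) by (rule tri_edgeE)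
  then show False
    using vertex_v[of "1 - u" u i b] assms(2,3) by (simp add: line_vol_affine)
qed

text \<open>All lines of \<open>S a b\<close> lie in the one plane through the axis and edge
  \<open>a\<close>. That plane meets edge \<open>b\<close> in at most one point, and through this
  point only one line meets edge \<open>a\<close> and the second fixed line.\<close>

lemma degenerate_edge:
  assumes deg: "line_vol c d (v (a + 1)) (v (a + 2)) = 0"
  shows "card (S a b) \<le> 1"
proof -
  let ?V = "v (a + 1)" and ?V' = "v (a + 2)" and ?W = "w (b + 1)" and ?W' = "w (b + 2)"
  have V: "line_vol c d ?V q = 0" if p: "p \<in> tri_edge v a" "line_vol c d p q = 0" for p q
  proof (rule line_vol_trans[OF d_nonzero _ _ p(2)])
    show "p \<noteq> c + s *\<^sub>R d" for s using v_off_axis tri_edge_subset p(1) by blast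
    obtain u where "p = (1 - u) *\<^sub>R ?V + u *\<^sub>R ?V'" using p(1) by (rule tri_edgeE)
    then show "line_vol c d p ?V = 0"
      using deg line_vol_commute[of c d ?V ?V'] by (simp add: line_vol_affine)
  qed
  have "l = l'" if l: "l \<in> S a b" "l' \<in> S a b" for l l'
  proof -
    obtain p q where pq: "p \<in> tri_edge v a" "q \<in> tri_edge w b" "l = affine hull {p, q}"
      "line_vol c d p q = 0" "line_vol z m p q = 0" using S_points[OF l(1)] by blast
    obtain p' q' where pq': "p' \<in> tri_edge v a" "q' \<in> tri_edge w b" "l' = affine hull {p', q'}"
      "line_vol c d p' q' = 0" "line_vol z m p' q' = 0" using S_points[OF l(2)] by blast
    have q0: "line_vol c d ?V q = 0" "line_vol c d ?V q' = 0" using V pq pq' by blast+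
    obtain s where s: "q = (1 - s) *\<^sub>R ?W + s *\<^sub>R ?W'" using pq(2) by (rule tri_edgeE)
    obtain s' where s': "q' = (1 - s') *\<^sub>R ?W + s' *\<^sub>R ?W'" using pq'(2) by (rule tri_edgeE)
    obtain u where u: "p = (1 - u) *\<^sub>R ?V + u *\<^sub>R ?V'" using pq(1) by (rule tri_edgeE)
    obtain u' where u': "p' = (1 - u') *\<^sub>R ?V + u' *\<^sub>R ?V'" using pq'(1) by (rule tri_edgeE)
    have zero: "X = 0 \<and> Y = 0" if "(1 - r) * X + r * Y = 0" "(1 - r') * X + r' * Y = 0" "r \<noteq> r'"
      for r r' X Y :: real
    proof -
      have "(r - r') * (Y - X) = 0" using that(1,2) by (simp add: algebra_simps)
      then have "Y = X" using that(3) by simp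
      then show ?thesis using that(1) by (simp add: algebra_simps)
    qed
    have "s = s'"
    proof (rule ccontr)
      assume "s \<noteq> s'"
      then have C: "line_vol c d ?V ?W = 0" "line_vol c d ?V ?W' = 0"
        using zero[of s "line_vol c d ?V ?W" "line_vol c d ?V ?W'" s'] q0 unfolding s s'
        by (simp_all add: line_vol_affine)
      show False
      \<comment> \<open>The form belonging to the axis vanishes identically, so any nontrivial zero
        of the other form contradicts \<open>vertex_v\<close>.\<close>
      proof (cases "line_vol z m ?V ?W = 0")
        case True
        then show False using vertex_v[of 1 0 "a + 1" b] C by simp
      next
        case False
        then show False
          using vertex_v[of "line_vol z m ?V ?W'" "- line_vol z m ?V ?W" "a + 1" b] C by simp
      qed
    qed
    then have "q = q'" using s s' by simp
    moreover have "u = u'"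
    proof (rule ccontr)
      assume "u \<noteq> u'"
      then have "line_vol z m ?V q = 0"
        using zero[of u "line_vol z m ?V q" "line_vol z m ?V' q" u'] pq(5) pq'(5) \<open>q = q'\<close>
        unfolding u u' by (simp add: line_vol_affine)
      then show False using vertex_v_point pq(2) q0(1) by blast
    qed
    ultimately show "l = l'" using pq(3) pq'(3) u u' by simp
  qed
  then show ?thesis by (simp add: card_le_Suc0_iff_eq[OF finite_S])
qed

text \<open>The degenerate edge contributes at most 3 and the two others at most 6 each, 15 in
  total.\<close>

lemma sum_le_16_if_degenerate:
  assumes "line_vol c d (v (a + 1)) (v (a + 2)) = 0"
  shows "(\<Sum>a\<in>UNIV. \<Sum>b\<in>UNIV. card (S a b)) \<le> 16"
proof -
  have "(\<Sum>b\<in>UNIV. card (S a' b)) \<le> (if a' = a then 3 else 6)" for a'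
    using sum_mono[of UNIV "\<lambda>b. card (S a' b)" "\<lambda>_. if a' = a then 1 else 2"]
      degenerate_edge[OF assms] card_S by auto
  then have "(\<Sum>a\<in>UNIV. \<Sum>b\<in>UNIV. card (S a b)) \<le> (\<Sum>a'\<in>UNIV. if a' = a then 3 else 6)"
    by (rule sum_mono)
  also have "\<dots> = 15" using exhaust_3[of a] by (elim disjE) (simp_all add: sum_3)
  finally show ?thesis by simp
qed

end

lemma pencil_swap:
  assumes "pencil v w c d z m S"
  shows "pencil w v c d z m (\<lambda>b a. S a b)"
proof -
  interpret pencil v w c d z m S by fact
  show ?thesis
  proof
    show "convex hull range w \<inter> convex hull range v = {}" using disjoint by blast
    show "p \<noteq> c + s *\<^sub>R d" if "p \<in> convex hull range w" for p s using w_off_axis that .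
    show "p \<noteq> c + s *\<^sub>R d" if "p \<in> convex hull range v" for p s using v_off_axis that .
  next
    fix a b l assume l: "l \<in> S b a"
    show "is_line l" "l \<inter> tri_edge w a \<noteq> {}" "l \<inter> tri_edge v b \<noteq> {}"
      "\<exists>s. c + s *\<^sub>R d \<in> l" "\<exists>s. z + s *\<^sub>R m \<in> l"
      by (fact S_line[OF l] S_w[OF l] S_v[OF l] S_axis[OF l] S_line2[OF l])+
  qed (fact d_nonzero finite_S card_S vertex_w vertex_v)+
qed

section \<open>Coordinates on the pencil\<close>

lemma lerp_quotient:
  fixes u x :: real
  assumes "(1 - u) * f0 + u * f1 = x * g" "(1 - u) * g0 + u * g1 = g"
    and "g \<noteq> 0" "g0 \<noteq> 0" "g1 \<noteq> 0" "f0 / g0 \<noteq> f1 / g1"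
  shows "lerp (f0 / g0) (f1 / g1) (\<beta>0 / g0) (\<beta>1 / g1) x = ((1 - u) * \<beta>0 + u * \<beta>1) / g"
proof -
  define a where "a = f0 / g0"
  define b where "b = f1 / g1"
  have f: "f0 = a * g0" "f1 = b * g1" using assms by (simp_all add: a_def b_def)
  have ab: "a - b \<noteq> 0" using assms by (simp add: a_def b_def)
  have "(x - b) * g = (1 - u) * g0 * (a - b)" "(a - x) * g = u * g1 * (a - b)"
    using assms(1,2) unfolding f by (simp_all add: algebra_simps flip: assms(2))
  then have x: "x - b = (1 - u) * g0 * (a - b) / g" "a - x = u * g1 * (a - b) / g"
    using assms(3) by (simp_all add: eq_divide_eq)
  have "(x - b) * (\<beta>0 / g0) - (x - a) * (\<beta>1 / g1) = (x - b) * (\<beta>0 / g0) + (a - x) * (\<beta>1 / g1)"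
    by (simp add: algebra_simps diff_divide_distrib)
  also have "\<dots> = (a - b) * (((1 - u) * \<beta>0 + u * \<beta>1) / g)"
    unfolding x using assms(3-5) by (simp add: field_simps)
  finally show ?thesis
    unfolding lerp_def a_def[symmetric] b_def[symmetric] using ab by simp
qed

lemma lerp_divide: "lerp a b (u / k) (w / k) x = lerp a b u w x / k"
  unfolding lerp_def divide_inverse by algebra

lemma lerp_minus: "lerp a b (- u) (- w) x = - lerp a b u w x"
  unfolding lerp_def divide_inverse by algebra

lemma convex_combination_sign:
  fixes u X Y :: real
  assumes "(1 - u) * X + u * Y = 0" "0 < u" "u < 1" "X \<noteq> 0 \<or> Y \<noteq> 0"
  shows "X * Y < 0"
proof -
  have X: "(1 - u) * X = - (u * Y)" using assms(1) by simp
  have "Y \<noteq> 0" using X assms by auto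
  have "(1 - u) * (X * Y) = - (u * Y\<^sup>2)" using X by (simp add: power2_eq_square flip: mult.assoc)
  also have "\<dots> < 0" using assms(2) \<open>Y \<noteq> 0\<close> by simp
  finally show ?thesis using assms(3) by (simp add: mult_less_0_iff)
qed

lemma parallel_if_orthogonal:
  fixes n d x :: "real^3"
  assumes "n \<noteq> 0" "d \<noteq> 0" "n \<bullet> d = 0" "n \<bullet> x = 0" "cross3 d n \<bullet> x = 0"
  obtains s where "x = s *\<^sub>R d"
proof -
  have "cross3 x ((n \<bullet> n) *\<^sub>R d) = cross3 x (cross3 n (cross3 d n))"
    using assms(3) by (simp add: Lagrange)
  also have "\<dots> = 0"
    using assms(4,5) by (subst Lagrange) (simp add: inner_commute)
  finally have "cross3 x d = 0" using assms(1) by (simp add: cross_mult_right)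
  then have "cross3 d x = 0" by (subst cross_skew) simp
  then show thesis using on_line_if_cross_eq_0 assms(2) that by blast
qed

text \<open>The planes of the pencil are given by \<open>f = x * g\<close>; the second triangle lies on one side of the
  plane \<open>g = 0\<close>, but the first one may cross it.\<close>

locale pencil_chart = pencil +
  fixes n :: "real^3"
  assumes n_orth: "n \<bullet> d = 0"
    and n_w: "\<And>j. n \<bullet> (w j - c) > 0" and n_v: "\<And>i. n \<bullet> (v i - c) \<noteq> 0"
begin

text \<open>\<open>f\<close> and \<open>g\<close> vanish together exactly on the axis, so their
  quotient is a coordinate on the pencil, with \<open>g = 0\<close> as the plane at
  infinity.\<close>

definition f :: "real^3 \<Rightarrow> real" where "f p = cross3 d n \<bullet> (p - c)"
definition g :: "real^3 \<Rightarrow> real" where "g p = n \<bullet> (p - c)"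

lemma f_affine: "u + t = 1 \<Longrightarrow> f (u *\<^sub>R p + t *\<^sub>R q) = u * f p + t * f q"
proof -
  assume "u + t = 1"
  then have "u *\<^sub>R p + t *\<^sub>R q - c = u *\<^sub>R (p - c) + t *\<^sub>R (q - c)"
    by (simp add: algebra_simps flip: scaleR_add_left)
  then show ?thesis by (simp add: f_def inner_right_distrib)
qed

lemma g_affine: "u + t = 1 \<Longrightarrow> g (u *\<^sub>R p + t *\<^sub>R q) = u * g p + t * g q"
proof -
  assume "u + t = 1"
  then have "u *\<^sub>R p + t *\<^sub>R q - c = u *\<^sub>R (p - c) + t *\<^sub>R (q - c)"
    by (simp add: algebra_simps flip: scaleR_add_left)
  then show ?thesis by (simp add: g_def inner_right_distrib)
qed

lemma f_g_segment: "f ((1 - u) *\<^sub>R p + u *\<^sub>R q) = (1 - u) * f p + u * f q"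
    "g ((1 - u) *\<^sub>R p + u *\<^sub>R q) = (1 - u) * g p + u * g q"
  by (simp_all add: f_affine g_affine)

lemma n_nonzero: "n \<noteq> 0"
  using n_w[of 1] by auto

text \<open>Up to the factor \<open>n \<bullet> n\<close>, coplanarity with the axis is the
  vanishing of a 2 by 2 determinant in \<open>f\<close> and \<open>g\<close>.\<close>

lemma line_vol_f_g: "(n \<bullet> n) * line_vol c d p q = f q * g p - f p * g q"
proof -
  have "f p * g q - f q * g p = cross3 (cross3 d n) n \<bullet> cross3 (p - c) (q - c)"
    by (simp add: f_def g_def dot_cross)
  also have "cross3 (cross3 d n) n = - ((n \<bullet> n) *\<^sub>R d)"
    by (subst cross_skew) (simp add: Lagrange n_orth)
  finally show ?thesis by (simp add: line_vol_def)
qed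

lemma line_vol_eq_0_iff: "line_vol c d p q = 0 \<longleftrightarrow> f p * g q = f q * g p"
proof -
  have "line_vol c d p q = 0 \<longleftrightarrow> (n \<bullet> n) * line_vol c d p q = 0" using n_nonzero by simp
  then show ?thesis unfolding line_vol_f_g by linarith
qed

lemma on_axis:
  assumes "f p = 0" "g p = 0"
  obtains s where "p = c + s *\<^sub>R d"
proof -
  obtain s where "p - c = s *\<^sub>R d"
    using parallel_if_orthogonal[OF n_nonzero d_nonzero n_orth] assms unfolding f_def g_def by blast
  then show thesis using that[of s] by (simp add: algebra_simps)
qed

abbreviation \<theta> :: "3 \<Rightarrow> real" where "\<theta> i \<equiv> f (v i) / g (v i)"
abbreviation \<tau> :: "3 \<Rightarrow> real" where "\<tau> j \<equiv> f (w j) / g (w j)"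

lemma g_v: "g (v i) \<noteq> 0" and g_w: "g (w j) > 0"
  using n_v n_w by (simp_all add: g_def)

text \<open>The choice is determined for lines in \<open>S a b\<close>: they lie in a plane of the
  pencil and contain a point with \<open>g > 0\<close>.\<close>

definition param :: "(real^3) set \<Rightarrow> real" where
  "param l = (SOME x. \<forall>p\<in>l. f p = x * g p)"

text \<open>Division by \<open>g\<close> normalizes homogeneous coordinates: along an edge, volumes
  divided by \<open>g\<close> are affine in the coordinate \<open>f / g\<close>.\<close>

definition M :: "3 \<Rightarrow> 3 \<Rightarrow> real" where
  "M i j = line_vol z m (v i) (w j) / g (v i) / g (w j)"

lemma g_edge_w: "q \<in> tri_edge w b \<Longrightarrow> g q > 0"
proof -
  assume "q \<in> tri_edge w b"
  then obtain u where "0 \<le> u" "u \<le> 1" "q = (1 - u) *\<^sub>R w (b + 1) + u *\<^sub>R w (b + 2)"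
    by (rule tri_edgeE)
  then have "g q = (1 - u) * g (w (b + 1)) + u * g (w (b + 2))" by (simp add: g_affine)
  also have "\<dots> > 0"
    using \<open>0 \<le> u\<close> \<open>u \<le> 1\<close> g_w[of "b + 1"] g_w[of "b + 2"]
    by (cases "u = 0") (auto intro: add_nonneg_pos)
  finally show ?thesis .
qed

lemma S_param:
  assumes "l \<in> S a b"
  obtains p q where "p \<in> tri_edge v a" "q \<in> tri_edge w b" "l = affine hull {p, q}"
    "f p = param l * g p" "f q = param l * g q" "g p \<noteq> 0" "g q > 0"
    "line_vol c d p q = 0" "line_vol z m p q = 0"
proof -
  obtain p q where pq: "p \<in> tri_edge v a" "q \<in> tri_edge w b" "l = affine hull {p, q}"
    "line_vol c d p q = 0" "line_vol z m p q = 0" using S_points[OF assms] by blast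
  have q: "g q > 0" using g_edge_w pq(2) .
  define x where "x = f q / g q"
  have fq: "f q = x * g q" using q by (simp add: x_def)
  have fp: "f p = x * g p"
    using pq(4) q unfolding line_vol_eq_0_iff by (simp add: x_def field_simps)
  have "f r = x * g r" if r: "r \<in> l" for r
  proof -
    obtain u t where "r = u *\<^sub>R p + t *\<^sub>R q" "u + t = 1"
      using r unfolding pq(3) affine_hull_2 by blast
    then show ?thesis by (simp add: f_affine g_affine fp fq algebra_simps)
  qed
  then have param: "\<forall>r\<in>l. f r = param l * g r"
    unfolding param_def by (intro someI[of "\<lambda>x. \<forall>p\<in>l. f p = x * g p" x]) blast
  have "p \<in> l" "q \<in> l" using pq(3) by (simp_all add: hull_inc)
  moreover have "g p \<noteq> 0"
  proof
    assume "g p = 0"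
    then obtain s where "p = c + s *\<^sub>R d" using on_axis fp by auto
    then show False using v_off_axis pq(1) tri_edge_subset by blast
  qed
  ultimately show thesis using that[OF pq(1-3) _ _ _ q pq(4,5)] param by blast
qed

lemma vertex_w_point:
  assumes "p \<in> tri_edge v a" "line_vol c d p (w j) = 0" "line_vol z m p (w j) = 0"
  shows False
proof -
  obtain u where u: "p = (1 - u) *\<^sub>R v (a + 1) + u *\<^sub>R v (a + 2)"
    using assms(1) by (rule tri_edgeE)
  have "line_vol c d (w j) p = 0" "line_vol z m (w j) p = 0"
    using assms line_vol_commute by (metis neg_equal_0_iff_equal)+
  then show False
    using vertex_w[of "1 - u" u j a] unfolding u by (simp add: line_vol_affine)
qed

text \<open>The coordinate \<open>f / g\<close> is projective, not affine, in the position on the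
  edge; dividing the volumes by \<open>g\<close> compensates for this.\<close>

lemma lerp_v:
  assumes "\<theta> (a + 1) \<noteq> \<theta> (a + 2)" "p = (1 - u) *\<^sub>R v (a + 1) + u *\<^sub>R v (a + 2)" "f p = x * g p" "g p \<noteq> 0"
  shows "lerp (\<theta> (a + 1)) (\<theta> (a + 2)) (line_vol z m (v (a + 1)) q / g (v (a + 1)))
    (line_vol z m (v (a + 2)) q / g (v (a + 2))) x = line_vol z m p q / g p"
proof -
  have e: "f p = (1 - u) * f (v (a + 1)) + u * f (v (a + 2))" "g p = (1 - u) * g (v (a + 1)) + u * g (v (a + 2))"
    "line_vol z m p q = (1 - u) * line_vol z m (v (a + 1)) q + u * line_vol z m (v (a + 2)) q"
    unfolding assms(2) by (simp_all add: f_affine g_affine line_vol_affine)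
  show ?thesis
    unfolding e(3)
  proof (rule lerp_quotient)
    show "(1 - u) * f (v (a + 1)) + u * f (v (a + 2)) = x * g p" using e(1) assms(3) by linarith
    show "(1 - u) * g (v (a + 1)) + u * g (v (a + 2)) = g p" using e(2) by linarith
  qed (fact assms g_v)+
qed

lemma lerp_w:
  assumes "\<tau> (b + 1) \<noteq> \<tau> (b + 2)" "q = (1 - u) *\<^sub>R w (b + 1) + u *\<^sub>R w (b + 2)" "f q = x * g q" "g q \<noteq> 0"
  shows "lerp (\<tau> (b + 1)) (\<tau> (b + 2)) (line_vol z m p (w (b + 1)) / g (w (b + 1)))
    (line_vol z m p (w (b + 2)) / g (w (b + 2))) x = line_vol z m p q / g q"
proof -
  have e: "f q = (1 - u) * f (w (b + 1)) + u * f (w (b + 2))" "g q = (1 - u) * g (w (b + 1)) + u * g (w (b + 2))"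
    "line_vol z m p q = (1 - u) * line_vol z m p (w (b + 1)) + u * line_vol z m p (w (b + 2))"
    unfolding assms(2) by (simp_all add: f_affine g_affine line_vol_affine)
  have g_w': "g (w j) \<noteq> 0" for j using g_w[of j] by simp
  show ?thesis
    unfolding e(3)
  proof (rule lerp_quotient)
    show "(1 - u) * f (w (b + 1)) + u * f (w (b + 2)) = x * g q" using e(1) assms(3) by linarith
    show "(1 - u) * g (w (b + 1)) + u * g (w (b + 2)) = g q" using e(2) by linarith
  qed (fact assms g_w')+
qed

lemma edge_point_unique:
  assumes "p = (1 - u) *\<^sub>R V + u *\<^sub>R V'" "p' = (1 - u') *\<^sub>R V + u' *\<^sub>R V'"
    and "f p = x * g p" "f p' = x * g p'" "g V \<noteq> 0" "g V' \<noteq> 0" "f V / g V \<noteq> f V' / g V'"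
  shows "p = p'"
proof -
  define X where "X = f V - x * g V"
  define Y where "Y = f V' - x * g V'"
  have "(1 - u) * X + u * Y = 0" "(1 - u') * X + u' * Y = 0"
    using assms(3,4) unfolding assms(1,2) X_def Y_def f_g_segment by (simp_all add: algebra_simps)
  then have e: "(u - u') * (Y - X) = 0" "X + u * (Y - X) = 0" by (simp_all add: algebra_simps)
  have "u = u'"
  proof (rule ccontr)
    assume "u \<noteq> u'"
    then have "X = 0" "Y = 0" using e by auto
    then have "f V / g V = x" "f V' / g V' = x" using assms(5,6) by (simp_all add: X_def Y_def)
    then show False using assms(7) by simp
  qed
  then show ?thesis using assms(1,2) by simp
qed

text \<open>The form \<open>f - x * g\<close> vanishes strictly inside the edge, so its end values
  have opposite signs. The factor \<open>g V * g V'\<close> records whether the edge crosses the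
  plane at infinity.\<close>

lemma crossing:
  assumes p: "p = (1 - u) *\<^sub>R V + u *\<^sub>R V'" "0 \<le> u" "u \<le> 1" "p \<noteq> V" "p \<noteq> V'"
    and "f p = x * g p" "g V \<noteq> 0" "g V' \<noteq> 0" "f V / g V \<noteq> f V' / g V'"
  shows "g V * g V' * ((f V / g V - x) * (f V' / g V' - x)) < 0"
proof -
  define X where "X = f V - x * g V"
  define Y where "Y = f V' - x * g V'"
  have "u \<noteq> 0" "u \<noteq> 1" using p by auto
  then have u: "0 < u" "u < 1" using p by auto
  have "(1 - u) * X + u * Y = 0"
    using assms(6) unfolding assms(1) X_def Y_def f_g_segment by (simp add: algebra_simps)
  moreover have "X \<noteq> 0 \<or> Y \<noteq> 0"
  proof (rule ccontr)
    assume "\<not> ?thesis"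
    then have "f V / g V = x" "f V' / g V' = x" using assms(7,8) by (simp_all add: X_def Y_def)
    then show False using assms(9) by simp
  qed
  ultimately have "X * Y < 0" using convex_combination_sign u by blast
  moreover have "X = g V * (f V / g V - x)" "Y = g V' * (f V' / g V' - x)"
    using assms(7,8) by (simp_all add: X_def Y_def field_simps)
  ultimately show ?thesis by (simp add: mult_ac)
qed

text \<open>A zero would be a point of the edge line \<open>W W'\<close> in the plane of the pencil
  through \<open>V\<close> at which the second form vanishes too; the weights chosen in the proof
  are its homogeneous coordinates.\<close>

lemma lerp_vertex_nonzero:
  assumes V: "\<And>\<alpha> \<beta>. \<alpha> \<noteq> 0 \<or> \<beta> \<noteq> 0 \<Longrightarrow>
      \<alpha> * line_vol c d V W + \<beta> * line_vol c d V W' = 0 \<Longrightarrow> \<alpha> * B + \<beta> * B' = 0 \<Longrightarrow> False"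
    and g: "g V \<noteq> 0" "g W \<noteq> 0" "g W' \<noteq> 0" and ne: "f W / g W \<noteq> f W' / g W'"
  shows "lerp (f W / g W) (f W' / g W') (B / g W) (B' / g W') (f V / g V) \<noteq> 0"
proof
  define h where "h = f V / g V"
  define t where "t = f W / g W"
  define t' where "t' = f W' / g W'"
  have f: "f V = h * g V" "f W = t * g W" "f W' = t' * g W'"
    using g by (simp_all add: h_def t_def t'_def)
  assume "lerp (f W / g W) (f W' / g W') (B / g W) (B' / g W') (f V / g V) = 0"
  then have 0: "(h - t') * (B / g W) - (h - t) * (B' / g W') = 0"
    using ne unfolding lerp_def h_def t_def t'_def by simp
  let ?\<alpha> = "(h - t') / g W" and ?\<beta> = "- ((h - t) / g W')"
  show False
  proof (rule V[of ?\<alpha> ?\<beta>])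
    show "?\<alpha> \<noteq> 0 \<or> ?\<beta> \<noteq> 0" using g ne by (auto simp: t_def t'_def)
    show "?\<alpha> * B + ?\<beta> * B' = 0" using 0 by simp
    have "(n \<bullet> n) * (?\<alpha> * line_vol c d V W + ?\<beta> * line_vol c d V W')
        = ?\<alpha> * ((n \<bullet> n) * line_vol c d V W) + ?\<beta> * ((n \<bullet> n) * line_vol c d V W')"
      by (simp add: algebra_simps)
    also have "\<dots> = 0"
      unfolding line_vol_f_g f using g by (simp add: field_simps)
    finally show "?\<alpha> * line_vol c d V W + ?\<beta> * line_vol c d V W' = 0" using n_nonzero by simp
  qed
qed

text \<open>If the plane of the pencil through \<open>V\<close> separated the two other vertices, it
  would meet the opposite edge in some \<open>r\<close>. The segment from \<open>V\<close> to
  \<open>r\<close> crosses \<open>g = 0\<close> inside that plane, hence on the axis, which the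
  triangle misses.\<close>

lemma lone_vertex:
  assumes g: "g V * g V' < 0" "g V * g V'' < 0"
    and sub: "convex hull {V, V', V''} \<subseteq> convex hull (range v)"
  shows "\<not> (f V' / g V' - f V / g V) * (f V'' / g V'' - f V / g V) < 0"
proof
  assume neg: "(f V' / g V' - f V / g V) * (f V'' / g V'' - f V / g V) < 0"
  define x where "x = f V / g V"
  have g0: "g V \<noteq> 0" "g V' \<noteq> 0" "g V'' \<noteq> 0" using g by auto
  have fV: "f V = x * g V" using g0 by (simp add: x_def)
  define X where "X = f V' - x * g V'"
  define Y where "Y = f V'' - x * g V''"
  have gg: "g V' * g V'' > 0" using g by (auto simp: mult_less_0_iff zero_less_mult_iff)
  have XY': "X = g V' * (f V' / g V' - x)" "Y = g V'' * (f V'' / g V'' - x)"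
    using g0 by (simp_all add: X_def Y_def field_simps)
  have "X * Y = (g V' * g V'') * ((f V' / g V' - x) * (f V'' / g V'' - x))"
    unfolding XY' by (simp add: mult_ac)
  also have "\<dots> < 0" using gg neg unfolding x_def by (rule mult_pos_neg)
  finally have XY: "X * Y < 0" .
  \<comment> \<open>The weight at which \<open>f - x * g\<close> vanishes on the edge opposite to
    \<open>V\<close>.\<close>
  define u where "u = X / (X - Y)"
  have u: "0 < u" "u < 1"
    using XY unfolding u_def by (auto simp: mult_less_0_iff field_simps)
  have uXY: "(1 - u) * X + u * Y = 0"
  proof -
    have "X - Y \<noteq> 0" using XY by (auto simp: mult_less_0_iff)
    then have "u * (X - Y) = X" by (simp add: u_def)
    then show ?thesis by (simp add: algebra_simps)
  qed
  define r where "r = (1 - u) *\<^sub>R V' + u *\<^sub>R V''"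
  have fr: "f r = x * g r"
    using uXY unfolding r_def X_def Y_def f_g_segment by (simp add: algebra_simps)
  have gr: "g r = (1 - u) * g V' + u * g V''" unfolding r_def by (simp add: g_affine)
  have "g V * g r = (1 - u) * (g V * g V') + u * (g V * g V'')" unfolding gr by (simp add: algebra_simps)
  also have "\<dots> < 0" using u g by (intro add_neg_neg) (simp_all add: mult_pos_neg)
  finally have neg: "g V * g r < 0" .
  \<comment> \<open>The weight at which \<open>g\<close> vanishes between \<open>V\<close> and
    \<open>r\<close>.\<close>
  define t where "t = g V / (g V - g r)"
  have t: "0 < t" "t < 1"
    using neg unfolding t_def by (auto simp: mult_less_0_iff field_simps)
  define s where "s = (1 - t) *\<^sub>R V + t *\<^sub>R r"
  have "g V - g r \<noteq> 0" using neg by (auto simp: mult_less_0_iff)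
  then have "t * (g V - g r) = g V" by (simp add: t_def)
  then have gs: "g s = 0" unfolding s_def f_g_segment by (simp add: algebra_simps)
  have "f s = x * g s" unfolding s_def f_g_segment fV fr by (simp add: algebra_simps)
  then obtain e where e: "s = c + e *\<^sub>R d" using on_axis[of s] gs by auto
  have "r \<in> convex hull {V, V', V''}"
    unfolding r_def using u by (intro convexD[OF convex_convex_hull] hull_inc) auto
  then have "s \<in> convex hull {V, V', V''}"
    unfolding s_def using t by (intro convexD[OF convex_convex_hull]) (auto intro: hull_inc)
  then show False using v_off_axis sub e by blast
qed

lemma nine_quadratics_pencil:
  assumes inj: "inj \<theta>" "inj \<tau>"
  shows "nine_quadratics \<theta> \<tau> (\<lambda>i. g (v i)) M (\<lambda>a b. param ` S a b)"
proof -
  have g_w': "g (w j) \<noteq> 0" for j using g_w[of j] by simp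
  have \<theta>: "\<theta> (a + 1) \<noteq> \<theta> (a + 2)" for a using injD[OF inj(1), of "a + 1" "a + 2"] by auto
  have \<tau>: "\<tau> (b + 1) \<noteq> \<tau> (b + 2)" for b using injD[OF inj(2), of "b + 1" "b + 2"] by auto
  have M_v: "M i j = line_vol z m (v i) (w j) / g (w j) / g (v i)" for i j
    by (simp add: M_def mult.commute)
  show ?thesis
  proof
    show "inj \<theta>" "inj \<tau>" by fact+
    show "g (v i) \<noteq> 0" for i by (rule g_v)
    show "finite (param ` S a b)" for a b using finite_S by simp
    show "card (param ` S a b) \<le> 2" for a b
      using card_image_le[OF finite_S, of param a b] card_S[of a b] by linarith
  next
    fix a b x assume "x \<in> param ` S a b"
    then obtain l where l: "l \<in> S a b" "x = param l" by blast
    obtain p q where pq: "p \<in> tri_edge v a" "q \<in> tri_edge w b"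
      "f p = x * g p" "f q = x * g q" "g p \<noteq> 0" "g q > 0" "line_vol c d p q = 0" "line_vol z m p q = 0"
      using S_param[OF l(1)] unfolding l(2) by metis
    obtain u where u: "0 \<le> u" "u \<le> 1" "p = (1 - u) *\<^sub>R v (a + 1) + u *\<^sub>R v (a + 2)"
      using pq(1) by (rule tri_edgeE)
    obtain t where t: "0 \<le> t" "t \<le> 1" "q = (1 - t) *\<^sub>R w (b + 1) + t *\<^sub>R w (b + 2)"
      using pq(2) by (rule tri_edgeE)
    have q0: "g q \<noteq> 0" using pq(6) by simp
    have inner: "edge_lerp \<tau> (M i) b x = line_vol z m (v i) q / g (v i) / g q" for i
    proof -
      have "edge_lerp \<tau> (M i) b x = lerp (\<tau> (b + 1)) (\<tau> (b + 2))
          (line_vol z m (v i) (w (b + 1)) / g (w (b + 1))) (line_vol z m (v i) (w (b + 2)) / g (w (b + 2))) x / g (v i)"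
        unfolding edge_lerp_def M_v by (rule lerp_divide)
      then show ?thesis unfolding lerp_w[OF \<tau> t(3) pq(4) q0] by (simp add: mult.commute)
    qed
    have "edge_lerp \<theta> (\<lambda>i. edge_lerp \<tau> (M i) b x) a x = lerp (\<theta> (a + 1)) (\<theta> (a + 2))
        (line_vol z m (v (a + 1)) q / g (v (a + 1))) (line_vol z m (v (a + 2)) q / g (v (a + 2))) x / g q"
      unfolding inner unfolding edge_lerp_def by (rule lerp_divide)
    then show "edge_lerp \<theta> (\<lambda>i. edge_lerp \<tau> (M i) b x) a x = 0"
      unfolding lerp_v[OF \<theta> u(3) pq(3,5)] using pq(8) by simp
    \<comment> \<open>General position keeps the line away from vertices, which makes the
      inequalities strict.\<close>
    have "p \<noteq> v i" for i using vertex_v_point pq(2,7,8) by blast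
    then show "g (v (a + 1)) * g (v (a + 2)) * ((\<theta> (a + 1) - x) * (\<theta> (a + 2) - x)) < 0"
      using crossing[OF u(3,1,2) _ _ pq(3) g_v g_v \<theta>] by blast
    have "q \<noteq> w j" for j using vertex_w_point pq(1,7,8) by blast
    then have "g (w (b + 1)) * g (w (b + 2)) * ((\<tau> (b + 1) - x) * (\<tau> (b + 2) - x)) < 0"
      using crossing[OF t(3,1,2) _ _ pq(4) g_w' g_w' \<tau>] by blast
    moreover have "g (w (b + 1)) * g (w (b + 2)) > 0" using g_w by simp
    ultimately show "(\<tau> (b + 1) - x) * (\<tau> (b + 2) - x) < 0"
      by (meson mult_less_0_iff not_less_iff_gr_or_eq)
  next
    fix i b
    have "edge_lerp \<tau> (M i) b (\<theta> i) = lerp (\<tau> (b + 1)) (\<tau> (b + 2))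
          (line_vol z m (v i) (w (b + 1)) / g (w (b + 1))) (line_vol z m (v i) (w (b + 2)) / g (w (b + 2))) (\<theta> i) / g (v i)"
      unfolding edge_lerp_def M_v by (rule lerp_divide)
    moreover have "lerp (\<tau> (b + 1)) (\<tau> (b + 2)) (line_vol z m (v i) (w (b + 1)) / g (w (b + 1)))
        (line_vol z m (v i) (w (b + 2)) / g (w (b + 2))) (\<theta> i) \<noteq> 0"
      by (rule lerp_vertex_nonzero[OF vertex_v g_v g_w' g_w' \<tau>])
    ultimately show "edge_lerp \<tau> (M i) b (\<theta> i) \<noteq> 0" using g_v[of i] by simp
  next
    fix a j
    have M_w: "M i j = - (line_vol z m (w j) (v i) / g (v i)) / g (w j)" for i
      using line_vol_commute[of z m "v i" "w j"] by (simp add: M_def)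
    have "edge_lerp \<theta> (\<lambda>i. M i j) a (\<tau> j) = - (lerp (\<theta> (a + 1)) (\<theta> (a + 2))
          (line_vol z m (w j) (v (a + 1)) / g (v (a + 1))) (line_vol z m (w j) (v (a + 2)) / g (v (a + 2))) (\<tau> j) / g (w j))"
      unfolding edge_lerp_def M_w lerp_divide lerp_minus by simp
    moreover have "lerp (\<theta> (a + 1)) (\<theta> (a + 2)) (line_vol z m (w j) (v (a + 1)) / g (v (a + 1)))
        (line_vol z m (w j) (v (a + 2)) / g (v (a + 2))) (\<tau> j) \<noteq> 0"
      by (rule lerp_vertex_nonzero[OF vertex_w g_w' g_v g_v \<theta>])
    ultimately show "edge_lerp \<theta> (\<lambda>i. M i j) a (\<tau> j) \<noteq> 0" using g_w'[of j] by simp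
  next
    fix k assume *: "g (v k) * g (v (k + 1)) < 0" "g (v k) * g (v (k + 2)) < 0"
    have "convex hull {v k, v (k + 1), v (k + 2)} \<subseteq> convex hull (range v)" by (rule hull_mono) auto
    from lone_vertex[OF * this]
    have "\<not> (\<theta> (k + 1) - \<theta> k) * (\<theta> (k + 2) - \<theta> k) < 0" .
    moreover have "\<theta> (k + 1) \<noteq> \<theta> k" "\<theta> (k + 2) \<noteq> \<theta> k"
      using injD[OF inj(1), of "k + 1" k] injD[OF inj(1), of "k + 2" k] by auto
    then have "(\<theta> (k + 1) - \<theta> k) * (\<theta> (k + 2) - \<theta> k) \<noteq> 0" by (simp only: mult_eq_0_iff) simp
    ultimately show "(\<theta> (k + 1) - \<theta> k) * (\<theta> (k + 2) - \<theta> k) > 0" by linarith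
  qed
qed

text \<open>A plane of the pencil meets each of the two edges in at most one point, and these two
  points span the line.\<close>

lemma inj_on_param:
  assumes inj: "inj \<theta>" "inj \<tau>"
  shows "inj_on param (S a b)"
proof (rule inj_onI)
  fix l l' assume l: "l \<in> S a b" and l': "l' \<in> S a b" and eq: "param l = param l'"
  have g_w': "g (w j) \<noteq> 0" for j using g_w[of j] by simp
  have \<theta>: "\<theta> (a + 1) \<noteq> \<theta> (a + 2)" using injD[OF inj(1), of "a + 1" "a + 2"] by auto
  have \<tau>: "\<tau> (b + 1) \<noteq> \<tau> (b + 2)" using injD[OF inj(2), of "b + 1" "b + 2"] by auto
  obtain p q where pq: "p \<in> tri_edge v a" "q \<in> tri_edge w b" "l = affine hull {p, q}"
    "f p = param l * g p" "f q = param l * g q" using S_param[OF l] by metis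
  obtain p' q' where pq': "p' \<in> tri_edge v a" "q' \<in> tri_edge w b" "l' = affine hull {p', q'}"
    "f p' = param l * g p'" "f q' = param l * g q'" using S_param[OF l'] unfolding eq by metis
  obtain u where u: "p = (1 - u) *\<^sub>R v (a + 1) + u *\<^sub>R v (a + 2)" using pq(1) by (rule tri_edgeE)
  obtain u' where u': "p' = (1 - u') *\<^sub>R v (a + 1) + u' *\<^sub>R v (a + 2)" using pq'(1) by (rule tri_edgeE)
  obtain t where t: "q = (1 - t) *\<^sub>R w (b + 1) + t *\<^sub>R w (b + 2)" using pq(2) by (rule tri_edgeE)
  obtain t' where t': "q' = (1 - t') *\<^sub>R w (b + 1) + t' *\<^sub>R w (b + 2)" using pq'(2) by (rule tri_edgeE)
  have "p = p'" by (rule edge_point_unique[OF u u' pq(4) pq'(4) g_v g_v \<theta>])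
  moreover have "q = q'" by (rule edge_point_unique[OF t t' pq(5) pq'(5) g_w' g_w' \<tau>])
  ultimately show "l = l'" using pq(3) pq'(3) by simp
qed

lemma sum_le_16_if_inj:
  assumes inj: "inj \<theta>" "inj \<tau>"
  shows "(\<Sum>a\<in>UNIV. \<Sum>b\<in>UNIV. card (S a b)) \<le> 16"
  using nine_quadratics.sum_card_N_le_16[OF nine_quadratics_pencil[OF inj]]
  by (simp add: card_image[OF inj_on_param[OF inj]])

end

section \<open>Choice of the plane at infinity\<close>

lemma eventually_affine_nonzero:
  fixes A B :: real
  assumes "A \<noteq> 0 \<or> B \<noteq> 0"
  shows "eventually (\<lambda>\<epsilon>. A + \<epsilon> * B \<noteq> 0) (at_right 0)"
proof (cases "A = 0")
  case True
  then show ?thesis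
    using assms eventually_at_right_less[of "0::real"] by (auto elim: eventually_mono)
next
  case False
  have "((\<lambda>\<epsilon>. A + \<epsilon> * B) \<longlongrightarrow> A) (at_right 0)" by (auto intro!: tendsto_eq_intros)
  then show ?thesis using False tendsto_imp_eventually_ne by blast
qed

lemma eventually_affine_pos:
  fixes A B :: real
  assumes "A > 0"
  shows "eventually (\<lambda>\<epsilon>. A + \<epsilon> * B > 0) (at_right 0)"
proof -
  have "((\<lambda>\<epsilon>. A + \<epsilon> * B) \<longlongrightarrow> A) (at_right 0)" by (auto intro!: tendsto_eq_intros)
  then show ?thesis using assms order_tendstoD(1) by blast
qed

context pencil
begin

text \<open>A plane separating the axis from the triangle \<open>w\<close> yields a normal that is
  positive on \<open>w\<close>. A small rotation about the axis makes it nonzero at the vertices of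
  \<open>v\<close> without losing this.\<close>

lemma ex_chart:
  obtains n where "n \<bullet> d = 0" "\<And>j. n \<bullet> (w j - c) > 0" "\<And>i. n \<bullet> (v i - c) \<noteq> 0"
proof -
  let ?S = "affine hull {c, c + d}" and ?T = "convex hull (range w)"
  have S: "c + s *\<^sub>R d \<in> ?S" for s
  proof -
    have "c + s *\<^sub>R d = (1 - s) *\<^sub>R c + s *\<^sub>R (c + d)" by (simp add: algebra_simps)
    moreover have "(1 - s) + s = 1" by simp
    ultimately show ?thesis unfolding affine_hull_2 by blast
  qed
  have "?S \<inter> ?T = {}"
  proof (rule ccontr)
    assume "?S \<inter> ?T \<noteq> {}"
    then obtain x where x: "x \<in> ?S" "x \<in> ?T" by blast
    then obtain t where "x = c + t *\<^sub>R (c + d - c)" using affine_hull_2_point by blast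
    then show False using w_off_axis[OF x(2), of t] by simp
  qed
  moreover have "compact ?T" by (simp add: compact_convex_hull finite_imp_compact)
  ultimately have "\<exists>a b. (\<forall>x\<in>?S. a \<bullet> x < b) \<and> (\<forall>x\<in>?T. a \<bullet> x > b)"
    by (intro separating_hyperplane_closed_compact) (auto simp: affine_imp_convex)
  then obtain a b where ab: "\<And>x. x \<in> ?S \<Longrightarrow> a \<bullet> x < b" "\<And>x. x \<in> ?T \<Longrightarrow> a \<bullet> x > b"
    by blast
  \<comment> \<open>A linear functional that is bounded above on a line is constant on it.\<close>
  have ad: "a \<bullet> d = 0"
  proof (rule ccontr)
    assume "a \<bullet> d \<noteq> 0"
    then have "a \<bullet> (c + ((b - a \<bullet> c) / (a \<bullet> d)) *\<^sub>R d) = b" by (simp add: inner_right_distrib)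
    then show False using ab(1)[OF S, of "(b - a \<bullet> c) / (a \<bullet> d)"] by simp
  qed
  have aw: "a \<bullet> (w j - c) > 0" for j
    using ab(1)[OF S[of 0]] ab(2)[of "w j"] by (simp add: inner_diff_right hull_inc)
  then have a0: "a \<noteq> 0" using aw[of 1] by auto
  define u where "u = cross3 d a"
  \<comment> \<open>Both would vanish only for a vertex on the axis, so each vertex excludes at most
    one value of \<epsilon>.\<close>
  have av: "a \<bullet> (v i - c) \<noteq> 0 \<or> u \<bullet> (v i - c) \<noteq> 0" for i
  proof (rule ccontr)
    assume "\<not> ?thesis"
    then obtain s where "v i - c = s *\<^sub>R d"
      using parallel_if_orthogonal[OF a0 d_nonzero ad] unfolding u_def by blast
    then have "v i = c + s *\<^sub>R d" by (simp add: algebra_simps)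
    then show False using v_off_axis[of "v i" s] by (simp add: hull_inc)
  qed
  have "eventually (\<lambda>\<epsilon>. \<forall>i\<in>UNIV. a \<bullet> (v i - c) + \<epsilon> * (u \<bullet> (v i - c)) \<noteq> 0) (at_right 0)"
    using eventually_affine_nonzero[OF av] by (intro eventually_ball_finite) auto
  moreover have "eventually (\<lambda>\<epsilon>. \<forall>j\<in>UNIV. a \<bullet> (w j - c) + \<epsilon> * (u \<bullet> (w j - c)) > 0) (at_right 0)"
    using eventually_affine_pos[OF aw] by (intro eventually_ball_finite) auto
  ultimately have "eventually (\<lambda>\<epsilon>. (\<forall>i\<in>UNIV. a \<bullet> (v i - c) + \<epsilon> * (u \<bullet> (v i - c)) \<noteq> 0) \<and>
      (\<forall>j\<in>UNIV. a \<bullet> (w j - c) + \<epsilon> * (u \<bullet> (w j - c)) > 0)) (at_right 0)"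
    by (rule eventually_conj)
  then obtain \<epsilon> where \<epsilon>: "\<And>i. a \<bullet> (v i - c) + \<epsilon> * (u \<bullet> (v i - c)) \<noteq> 0"
      "\<And>j. a \<bullet> (w j - c) + \<epsilon> * (u \<bullet> (w j - c)) > 0"
    using eventually_happens'[OF trivial_limit_at_right_real] by blast
  show thesis
  proof (rule that[of "a + \<epsilon> *\<^sub>R u"])
    show "(a + \<epsilon> *\<^sub>R u) \<bullet> d = 0"
      using ad by (simp add: inner_left_distrib inner_right_distrib u_def inner_commute[of _ d] dot_cross_self)
  qed (use \<epsilon> in \<open>simp_all add: inner_left_distrib\<close>)
qed

text \<open>If no edge is coplanar with the axis, the parameters of the vertices of each triangle
  are distinct, and the nine quadratics apply.\<close>

theorem sum_card_S_le_16: "(\<Sum>a\<in>UNIV. \<Sum>b\<in>UNIV. card (S a b)) \<le> 16"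
proof (cases "(\<exists>a. line_vol c d (v (a + 1)) (v (a + 2)) = 0) \<or> (\<exists>b. line_vol c d (w (b + 1)) (w (b + 2)) = 0)")
  case True
  then show ?thesis
  proof (elim disjE exE)
    fix b assume b: "line_vol c d (w (b + 1)) (w (b + 2)) = 0"
    interpret swap: pencil w v c d z m "\<lambda>b a. S a b"
      by (rule pencil_swap) unfold_locales
    show ?thesis using swap.sum_le_16_if_degenerate[OF b] by (subst sum.swap)
  qed (rule sum_le_16_if_degenerate)
next
  case False
  obtain n where "n \<bullet> d = 0" "\<And>j. n \<bullet> (w j - c) > 0" "\<And>i. n \<bullet> (v i - c) \<noteq> 0"
    using ex_chart by blast
  then interpret pencil_chart v w c d z m S n by unfold_locales
  have pair: "\<exists>a. i = a + 1 \<and> j = a + 2 \<or> i = a + 2 \<and> j = a + 1" if "i \<noteq> j" for i j :: 3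
  proof -
    have "j = i + 1 \<or> j = i + 2"
      using that UNIV_I[of j] unfolding UNIV_3_shift[of i] by auto
    then show ?thesis by (elim disjE) (auto intro: exI[of _ "i + 2"] exI[of _ "i + 1"])
  qed
  have vol: "line_vol c d p q = 0" if "f p / g p = f q / g q" "g p \<noteq> 0" "g q \<noteq> 0" for p q
    using that by (simp add: line_vol_eq_0_iff frac_eq_eq)
  have "inj \<theta>"
  proof (rule injI, rule ccontr)
    fix i j assume eq: "\<theta> i = \<theta> j" and "i \<noteq> j"
    then obtain a where "i = a + 1 \<and> j = a + 2 \<or> i = a + 2 \<and> j = a + 1" using pair by blast
    then have "\<theta> (a + 1) = \<theta> (a + 2)" using eq by auto
    then show False using vol g_v False by blast
  qed
  moreover have "inj \<tau>"
  proof (rule injI, rule ccontr)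
    fix i j assume eq: "\<tau> i = \<tau> j" and "i \<noteq> j"
    then obtain a where "i = a + 1 \<and> j = a + 2 \<or> i = a + 2 \<and> j = a + 1" using pair by blast
    then have "\<tau> (a + 1) = \<tau> (a + 2)" using eq by auto
    moreover have "g (w j) \<noteq> 0" for j using g_w[of j] by simp
    ultimately show False using vol False by blast
  qed
  ultimately show ?thesis by (rule sum_le_16_if_inj)
qed

end

section \<open>Counting\<close>

lemma is_line_two_points:
  assumes "is_line l"
  obtains p q where "p \<noteq> q" "l = affine hull {p, q}"
proof -
  have "l \<noteq> {}" "\<And>p. l \<noteq> {p}" using assms by (auto simp: is_line_def)
  then obtain p q where "p \<in> l" "q \<in> l" "p \<noteq> q" by blast
  then show thesis using that is_line_through assms by blast
qed

text \<open>The real parts of complex coefficients still represent a real point, and the fourth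
  coordinate gives their sum 1.\<close>

lemma in_line_if_homogenize_in:
  assumes "homogenize x \<in> CP3_line_of (affine hull {p, q})"
  shows "x \<in> affine hull {p, q}"
proof -
  obtain \<alpha> \<beta> where x: "homogenize x = \<alpha> *s homogenize p + \<beta> *s homogenize q"
    using assms unfolding CP3_line_of_affine_hull
    by (auto simp: vec.span_insert vec.span_singleton) (metis add.commute diff_eq_eq)
  have nth: "homogenize x $ i = \<alpha> * homogenize p $ i + \<beta> * homogenize q $ i" for i
    unfolding x by simp
  have "Re \<alpha> + Re \<beta> = 1"
    using arg_cong[OF nth[of 4], of Re] by simp
  moreover have "x = Re \<alpha> *\<^sub>R p + Re \<beta> *\<^sub>R q"
    using arg_cong[OF nth[of 1], of Re] arg_cong[OF nth[of 2], of Re] arg_cong[OF nth[of 3], of Re]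
    by (simp add: vec_eq_iff forall_3)
  ultimately show ?thesis unfolding affine_hull_2 by blast
qed

lemma inj_CP3_line_of: "inj_on CP3_line_of {l. is_line l}"
proof (rule inj_onI)
  have sub: "l \<subseteq> l'" if l: "is_line l'" "CP3_line_of l = CP3_line_of l'" for l l'
  proof
    fix x assume "x \<in> l"
    then have "homogenize x \<in> CP3_line_of l" by (simp add: CP3_line_of_def vec.span_base)
    then have "homogenize x \<in> CP3_line_of l'" using l(2) by simp
    then show "x \<in> l'" using is_line_two_points[OF l(1)] in_line_if_homogenize_in by metis
  qed
  fix l l' assume "l \<in> {l. is_line l}" "l' \<in> {l. is_line l}" "CP3_line_of l = CP3_line_of l'"
  then show "l = l'" using sub[of l' l] sub[of l l'] by auto
qed

lemma CP3_line_of_line: "is_line l \<Longrightarrow> is_CP3_line (CP3_line_of l)"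
  by (metis is_line_two_points CP3_line_of_affine_hull CP3_line_span_homogenize)

context general_triangles
begin

definition tangents :: "(4 \<Rightarrow> 3) \<Rightarrow> (real^3) set set" where
  "tangents \<kappa> = {l. is_line l \<and> (\<forall>i. l \<inter> tri_edge (v i) (\<kappa> i) \<noteq> {})}"

lemma CP3_line_of_tangents:
  "CP3_line_of ` tangents \<kappa> \<subseteq> edge_transversals (\<lambda>i. tri_edge (v i) (\<kappa> i))"
proof (rule image_subsetI)
  fix l assume l: "l \<in> tangents \<kappa>"
  then have line: "is_CP3_line (CP3_line_of l)" by (simp add: tangents_def CP3_line_of_line)
  show "CP3_line_of l \<in> edge_transversals (\<lambda>i. tri_edge (v i) (\<kappa> i))"
    unfolding edge_transversals_iff
  proof (intro conjI allI line)
    fix i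
    obtain x where x: "x \<in> l" "x \<in> tri_edge (v i) (\<kappa> i)" using l by (auto simp: tangents_def)
    show "CP3_lines_meet (CP3_line_of l) (edge_line (v i) (\<kappa> i))"
    proof (rule CP3_lines_meetI[OF line CP3_line_edge _ _ homogenize_nonzero])
      show "homogenize x \<in> CP3_line_of l" using x(1) by (simp add: CP3_line_of_def vec.span_base)
      have "x \<in> supporting_line (tri_edge (v i) (\<kappa> i))"
        using x(2) by (simp add: supporting_line_def hull_inc)
      then show "homogenize x \<in> edge_line (v i) (\<kappa> i)"
        unfolding CP3_line_of_tri_edge[symmetric] CP3_line_of_def by (simp add: vec.span_base)
    qed
  qed
qed

text \<open>Distinct real lines have distinct complexifications, which are among the two
  transversals of the quadruple.\<close>

lemma finite_tangents: "finite (tangents \<kappa>)" and card_tangents: "card (tangents \<kappa>) \<le> 2"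
proof -
  have inj: "inj_on CP3_line_of (tangents \<kappa>)"
    by (rule inj_on_subset[OF inj_CP3_line_of]) (auto simp: tangents_def)
  have fin: "finite (edge_transversals (\<lambda>i. tri_edge (v i) (\<kappa> i)))"
    using card_transversals[of \<kappa>] by (intro card_ge_0_finite) simp
  show "finite (tangents \<kappa>)" using inj_on_finite[OF inj CP3_line_of_tangents fin] .
  show "card (tangents \<kappa>) \<le> 2"
    using card_inj_on_le[OF inj CP3_line_of_tangents fin] card_transversals[of \<kappa>] by simp
qed

text \<open>The default \<open>e\<close> of the function update applies to index \<open>k\<close>
  alone: edge \<open>e\<close> of triangle \<open>k\<close> spans the axis, and edge
  \<open>r\<close> of triangle \<open>m\<close> the second fixed line.\<close>

lemma sum_tangents_le_16:
  assumes ijkm: "distinct [i, j, k, m]" and disj: "tri i \<inter> tri j = {}"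
    and miss: "\<not> line_meets k e i" "\<not> line_meets k e j"
  shows "(\<Sum>a\<in>UNIV. \<Sum>b\<in>UNIV. card (tangents ((\<lambda>_. e)(i := a, j := b, m := r)))) \<le> 16"
proof -
  let ?c = "v k (e + 1)" and ?d = "v k (e + 2) - v k (e + 1)"
  have jikm: "distinct [j, i, k, m]" using ijkm by auto
  have ne: "i \<noteq> j" "i \<noteq> k" "i \<noteq> m" "j \<noteq> k" "j \<noteq> m" "k \<noteq> m" using ijkm by auto
  have seg: "\<exists>s. p = v l (x + 1) + s *\<^sub>R (v l (x + 2) - v l (x + 1))" if p: "p \<in> tri_edge (v l) x" for p l x
  proof -
    obtain u where "p = (1 - u) *\<^sub>R v l (x + 1) + u *\<^sub>R v l (x + 2)" using p by (rule tri_edgeE)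
    then have "p = v l (x + 1) + u *\<^sub>R (v l (x + 2) - v l (x + 1))" by (simp add: algebra_simps)
    then show ?thesis by blast
  qed
  have off: "p \<noteq> ?c + s *\<^sub>R ?d" if "p \<in> tri l" "\<not> line_meets k e l" for p s l
  proof
    assume "p = ?c + s *\<^sub>R ?d"
    then have "p = (1 - s) *\<^sub>R v k (e + 1) + s *\<^sub>R v k (e + 2)" by (simp add: algebra_simps)
    moreover have "(1 - s) + s = 1" by simp
    ultimately have "p \<in> affine hull {v k (e + 1), v k (e + 2)}" unfolding affine_hull_2 by blast
    then show False
      using that by (auto simp: line_meets_def tri_edge_def affine_hull_closed_segment)
  qed
  interpret pencil "v i" "v j" ?c ?d "v m (r + 1)" "v m (r + 2) - v m (r + 1)"
    "\<lambda>a b. tangents ((\<lambda>_. e)(i := a, j := b, m := r))"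
  proof
    show "?d \<noteq> 0" by (simp add: inj_eq[OF inj_v])
    show "tri i \<inter> tri j = {}" by (rule disj)
    show "p \<noteq> ?c + s *\<^sub>R ?d" if "p \<in> tri i" for p s using off that miss by blast
    show "p \<noteq> ?c + s *\<^sub>R ?d" if "p \<in> tri j" for p s using off that miss by blast
  next
    fix a b l assume l: "l \<in> tangents ((\<lambda>_. e)(i := a, j := b, m := r))"
    then have meets: "l \<inter> tri_edge (v h) (((\<lambda>_. e)(i := a, j := b, m := r)) h) \<noteq> {}" for h
      by (simp add: tangents_def)
    show "is_line l" using l by (simp add: tangents_def)
    show "l \<inter> tri_edge (v i) a \<noteq> {}" using meets[of i] ne by simp
    show "l \<inter> tri_edge (v j) b \<noteq> {}" using meets[of j] ne by simp
    show "\<exists>s. ?c + s *\<^sub>R ?d \<in> l" using meets[of k] ne seg by fastforce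
    show "\<exists>s. v m (r + 1) + s *\<^sub>R (v m (r + 2) - v m (r + 1)) \<in> l" using meets[of m] seg by fastforce
  qed (fact finite_tangents card_tangents edge_vol_vertex[OF ijkm, unfolded edge_vol_def]
      edge_vol_vertex[OF jikm, unfolded edge_vol_def])+
  show ?thesis by (rule sum_card_S_le_16)
qed

text \<open>Each of the three edges \<open>r\<close> of triangle \<open>m\<close> loses at least two
  of the 18 possible lines, and different \<open>r\<close> concern different quadruples, so at least
  6 of the 162 are lost.\<close>

lemma sum_card_tangents_le_156:
  assumes disj: "\<And>i j. i \<noteq> j \<Longrightarrow> tri i \<inter> tri j = {}"
  shows "(\<Sum>\<kappa>\<in>UNIV. card (tangents \<kappa>)) \<le> 156"
proof -
  obtain i j k e where ijk: "i \<noteq> j" "i \<noteq> k" "j \<noteq> k" and miss: "\<not> line_meets k e i" "\<not> line_meets k e j"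
    using ex_line_missing_two[OF disj] by blast
  have "card (UNIV - {i, j, k}) = 1" using ijk by (simp add: card_Diff_subset)
  then obtain m where "UNIV - {i, j, k} = {m}" by (auto simp: card_1_singleton_iff)
  then have m: "m \<notin> {i, j, k}" by blast
  then have ijkm: "distinct [i, j, k, m]" using ijk by auto
  define K where "K = (\<lambda>(r, a, b). (\<lambda>_. e)(i := a, j := b, m := r) :: 4 \<Rightarrow> 3)"
  \<comment> \<open>The number of lines lost by a quadruple; the subtraction of naturals is exact
    because of \<open>card_tangents\<close>.\<close>
  define D where "D \<kappa> = 2 - card (tangents \<kappa>)" for \<kappa>
  have CD: "card (tangents \<kappa>) + D \<kappa> = 2" for \<kappa> using card_tangents[of \<kappa>] by (simp add: D_def)
  have "inj K"
  proof (rule injI)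
    fix x y assume eq: "K x = K y"
    obtain r a b where x: "x = (r, a, b)" by (cases x)
    obtain r' a' b' where y: "y = (r', a', b')" by (cases y)
    have "K x i = a" "K x j = b" "K x m = r" "K y i = a'" "K y j = b'" "K y m = r'"
      using ijkm by (auto simp: K_def x y)
    then show "x = y" using eq x y by simp
  qed
  have "2 \<le> (\<Sum>a\<in>UNIV. \<Sum>b\<in>UNIV. D (K (r, a, b)))" for r
  proof -
    have "(\<Sum>a\<in>UNIV. \<Sum>b\<in>UNIV. card (tangents (K (r, a, b)))) + (\<Sum>a\<in>UNIV. \<Sum>b\<in>UNIV. D (K (r, a, b))) = 18"
      by (simp add: CD flip: sum.distrib)
    moreover have "(\<Sum>a\<in>UNIV. \<Sum>b\<in>UNIV. card (tangents (K (r, a, b)))) \<le> 16"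
      using sum_tangents_le_16[OF ijkm disj[OF ijk(1)] miss, of r] by (simp add: K_def)
    ultimately show ?thesis by linarith
  qed
  then have "(\<Sum>r\<in>(UNIV :: 3 set). 2) \<le> (\<Sum>r\<in>UNIV. \<Sum>a\<in>UNIV. \<Sum>b\<in>UNIV. D (K (r, a, b)))"
    by (intro sum_mono)
  also have "\<dots> = (\<Sum>x\<in>UNIV. D (K x))"
    by (simp add: sum.cartesian_product UNIV_Times_UNIV case_prod_unfold)
  also have "\<dots> = (\<Sum>\<kappa>\<in>range K. D \<kappa>)"
    by (simp add: sum.reindex[OF \<open>inj K\<close>])
  also have "\<dots> \<le> (\<Sum>\<kappa>\<in>UNIV. D \<kappa>)"
    by (rule sum_mono2) auto
  finally have "6 \<le> (\<Sum>\<kappa>\<in>UNIV. D \<kappa>)" by simp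
  moreover have "(\<Sum>\<kappa>\<in>UNIV. card (tangents \<kappa>)) + (\<Sum>\<kappa>\<in>UNIV. D \<kappa>) = 162"
    by (simp add: CD card_fun flip: sum.distrib)
  ultimately show ?thesis by linarith
qed

lemma triangle_edges_tri: "triangle_edges (tri i) = range (tri_edge (v i))"
proof -
  have r: "range (v i) = {v i 1, v i 2, v i 3}" by (auto simp: UNIV_3)
  have "triangle_edges (tri i) = {closed_segment (v i 1) (v i 2), closed_segment (v i 2) (v i 3),
      closed_segment (v i 3) (v i 1)}"
    unfolding r using not_collinear[of i] unfolding r by (rule triangle_edges_convex_hull)
  also have "\<dots> = range (tri_edge (v i))"
    unfolding UNIV_3 tri_edge_def image_insert image_empty index_3 by blast
  finally show ?thesis .
qed

lemma common_tangent_lines_eq: "common_tangent_lines tri = (\<Union>\<kappa>. tangents \<kappa>)"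
proof (rule set_eqI)
  fix l
  have "l \<in> common_tangent_lines tri \<longleftrightarrow> is_line l \<and> (\<forall>i. \<exists>k. l \<inter> tri_edge (v i) k \<noteq> {})"
    by (simp add: common_tangent_lines_def tangent_to_triangle_def triangle_edges_tri)
  also have "\<dots> \<longleftrightarrow> l \<in> (\<Union>\<kappa>. tangents \<kappa>)"
    unfolding choice_iff by (auto simp: tangents_def)
  finally show "l \<in> common_tangent_lines tri \<longleftrightarrow> l \<in> (\<Union>\<kappa>. tangents \<kappa>)" .
qed

end

theorem theorem3:
  fixes t :: "4 \<Rightarrow> (real^3) set"
  assumes "\<And>i. is_triangle (t i)"
    and "algebraic_general_position t"
  shows "finite (common_tangent_lines t) \<and> card (common_tangent_lines t) \<le> 162 \<and>
         (disjoint_family t \<longrightarrow> card (common_tangent_lines t) \<le> 156)"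
proof -
  \<comment> \<open>Labelling the vertices by type \<open>3\<close> makes the cyclic edge numbering
    available.\<close>
  have "\<exists>u :: 3 \<Rightarrow> real^3. \<not> collinear (range u) \<and> t i = convex hull (range u)" for i
  proof -
    obtain a b c where abc: "\<not> collinear {a, b, c}" "t i = convex hull {a, b, c}"
      using assms(1)[of i] unfolding is_triangle_def by blast
    define u :: "3 \<Rightarrow> real^3" where "u k = (if k = 1 then a else if k = 2 then b else c)" for k
    have "range u = {a, b, c}" unfolding UNIV_3 by (auto simp: u_def)
    then show ?thesis using abc by metis
  qed
  then obtain v :: "4 \<Rightarrow> 3 \<Rightarrow> real^3" where v: "\<And>i. \<not> collinear (range (v i))"
    "\<And>i. t i = convex hull (range (v i))"
    by metis
  have t: "t = (\<lambda>i. convex hull (range (v i)))" using v(2) by blast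
  have edge: "tri_edge (v i) k \<in> triangle_edges (t i)" for i k
  proof -
    have r: "range (v i) = {v i (k + 1), v i (k + 2), v i k}" by (subst UNIV_3_shift[of k]) auto
    show ?thesis
      unfolding triangle_edges_def tri_edge_def using v(1)[of i] v(2)[of i] unfolding r by blast
  qed
  interpret general_triangles v
  proof
    show "\<not> collinear (range (v i))" for i by (rule v(1))
    have quad: "(\<lambda>i. tri_edge (v i) (\<kappa> i)) \<in> edge_quadruples t" for \<kappa>
      using edge by (simp add: edge_quadruples_def)
    show "card (edge_transversals (\<lambda>i. tri_edge (v i) (\<kappa> i))) = 2" for \<kappa>
      using assms(2) quad unfolding algebraic_general_position_def by blast
    fix \<kappa> \<kappa>' :: "4 \<Rightarrow> 3" assume "\<kappa> \<noteq> \<kappa>'"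
    then obtain i where "\<kappa> i \<noteq> \<kappa>' i" by blast
    then have "tri_edge (v i) (\<kappa> i) \<noteq> tri_edge (v i) (\<kappa>' i)"
      using inj_tri_edge[OF inj_if_not_collinear[OF v(1)]] by (simp add: inj_eq)
    then have "(\<lambda>i. tri_edge (v i) (\<kappa> i)) \<noteq> (\<lambda>i. tri_edge (v i) (\<kappa>' i))" by metis
    then show "edge_transversals (\<lambda>i. tri_edge (v i) (\<kappa> i))
        \<inter> edge_transversals (\<lambda>i. tri_edge (v i) (\<kappa>' i)) = {}"
      using assms(2) quad unfolding algebraic_general_position_def disjoint_family_on_def by blast
  qed
  have lines: "common_tangent_lines t = (\<Union>\<kappa>. tangents \<kappa>)"
    unfolding t by (rule common_tangent_lines_eq)
  have card: "card (common_tangent_lines t) \<le> (\<Sum>\<kappa>\<in>UNIV. card (tangents \<kappa>))"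
    unfolding lines by (rule card_UN_le) simp
  have "(\<Sum>\<kappa>\<in>UNIV. card (tangents \<kappa>)) \<le> (\<Sum>\<kappa>\<in>(UNIV :: (4 \<Rightarrow> 3) set). 2)"
    by (intro sum_mono card_tangents)
  then have "(\<Sum>\<kappa>\<in>UNIV. card (tangents \<kappa>)) \<le> 162" by (simp add: card_fun)
  moreover have "finite (common_tangent_lines t)"
    unfolding lines by (simp add: finite_tangents)
  moreover have "(\<Sum>\<kappa>\<in>UNIV. card (tangents \<kappa>)) \<le> 156" if "disjoint_family t"
    using that unfolding t disjoint_family_on_def by (intro sum_card_tangents_le_156) blast
  ultimately show ?thesis using card by linarith
qed

end
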